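(* Let $G$ be a group, let $F$ be an algebraically closed field of characteristic zero, and let $L=\bigoplus_{g\in G}L_g$ be a finite dimensional $G$-graded Lie algebra over $F$. 1) If $L$ is graded simple and $\mathrm{Supp}\,L$ generates $G$, then $G$ is abelian and $L=B_1\oplus\cdots\oplus B_n$ is semisimple (in the non-graded sense) with pairwise isomorphic simple components $B_1,\ldots,B_n$. 2) If $L$ is semisimple (in the non-graded sense), then $L=A_1\oplus\cdots\oplus A_m$ is a direct sum of graded simple components, and $\mathrm{Supp}\,A_i$ is a commutative subset of $G$ for every $1\le i\le m$.
   Context: Let $G$ be a group (written multiplicatively) and $F$ a field. A Lie algebra $L$ over $F$ is $G$-graded if it is equipped with a vector space decomposition $L=\bigoplus_{g\in G}L_g$ such that $[L_g,L_h]\subseteq L_{gh}$ for all $g,h\in G$. A subspace (resp. subalgebra, ideal) $V\subseteq L$ is graded if $V=\bigoplus_{g\in G}(V\cap L_g)$; a graded subalgebra or ideal $V$ is itself $G$-graded with components $V_g=V\cap L_g$. The support of a $G$-graded algebra $L$ is $\mathrm{Supp}\,L=\{g\in G\mid L_g\neq 0\}$. A $G$-graded Lie algebra $L$ is graded simple if $[L,L]\neq 0$ and $L$ has no graded ideals other than $0$ and $L$. A subset of $G$ is commutative if any two of its elements commute. Simple components of a semisimple Lie algebra are its simple ideals; graded simple components are graded ideals of $L$ which are graded simple as $G$-graded Lie algebras. The zero algebra is regarded as the empty direct sum. *)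

theory Defs
  imports "HOL-Computational_Algebra.Polynomial" "HOL-Algebra.Generated_Groups"
begin

text \<open>
  Lie algebras live on a carrier \<open>L\<close> which is a subspace of an ambient \<open>'f\<close>-vector space
  (the type \<open>'v\<close> with scalar multiplication \<open>scale\<close>), so that subalgebras and ideals are Lie
  algebras in their own right, with the same \<open>scale\<close> and bracket \<open>br\<close>.  Nothing is required of
  \<open>br\<close> outside \<open>L\<close>.
\<close>

locale lie_algebra = vector_space scale
  for scale :: "'f::field \<Rightarrow> 'v::ab_group_add \<Rightarrow> 'v" +
  fixes br :: "'v \<Rightarrow> 'v \<Rightarrow> 'v" and L :: "'v set"
  assumes subspace_L: "subspace L"
    and br_closed: "\<lbrakk>x \<in> L; y \<in> L\<rbrakk> \<Longrightarrow> br x y \<in> L"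
    and br_add_left: "\<lbrakk>x \<in> L; y \<in> L; z \<in> L\<rbrakk> \<Longrightarrow> br (x + y) z = br x z + br y z"
    and br_add_right: "\<lbrakk>x \<in> L; y \<in> L; z \<in> L\<rbrakk> \<Longrightarrow> br x (y + z) = br x y + br x z"
    and br_scale_left: "\<lbrakk>x \<in> L; y \<in> L\<rbrakk> \<Longrightarrow> br (scale c x) y = scale c (br x y)"
    and br_scale_right: "\<lbrakk>x \<in> L; y \<in> L\<rbrakk> \<Longrightarrow> br x (scale c y) = scale c (br x y)"
    and br_self: "x \<in> L \<Longrightarrow> br x x = 0"
    and jacobi: "\<lbrakk>x \<in> L; y \<in> L; z \<in> L\<rbrakk> \<Longrightarrow>
      br x (br y z) + br y (br z x) + br z (br x y) = 0"

definition finite_dim :: "('f::field \<Rightarrow> 'v::ab_group_add \<Rightarrow> 'v) \<Rightarrow> 'v set \<Rightarrow> bool" where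
  "finite_dim scale V \<longleftrightarrow> (\<exists>S. finite S \<and> Modules.module.span scale S = V)"

text \<open>
  Internal direct sum of a possibly infinite family: every element of \<open>V\<close> is in exactly one way
  a sum of a finitely supported family of components.
\<close>

definition is_direct_sum ::
    "('f::field \<Rightarrow> 'v::ab_group_add \<Rightarrow> 'v) \<Rightarrow> 'v set \<Rightarrow> 'i set \<Rightarrow> ('i \<Rightarrow> 'v set) \<Rightarrow> bool" where
  "is_direct_sum scale V I W \<longleftrightarrow>
     Modules.module.subspace scale V \<and>
     (\<forall>i\<in>I. Modules.module.subspace scale (W i) \<and> W i \<subseteq> V) \<and>
     (\<forall>v\<in>V. \<exists>!f. (\<forall>i\<in>I. f i \<in> W i) \<and> (\<forall>i. i \<notin> I \<longrightarrow> f i = 0) \<and>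
        finite {i. f i \<noteq> 0} \<and> v = (\<Sum>i\<in>{i. f i \<noteq> 0}. f i))"

definition lie_ideal ::
    "('f::field \<Rightarrow> 'v::ab_group_add \<Rightarrow> 'v) \<Rightarrow> ('v \<Rightarrow> 'v \<Rightarrow> 'v) \<Rightarrow> 'v set \<Rightarrow> 'v set \<Rightarrow> bool" where
  "lie_ideal scale br L I \<longleftrightarrow>
     Modules.module.subspace scale I \<and> I \<subseteq> L \<and> (\<forall>x\<in>L. \<forall>y\<in>I. br x y \<in> I)"

definition lie_prod ::
    "('f::field \<Rightarrow> 'v::ab_group_add \<Rightarrow> 'v) \<Rightarrow> ('v \<Rightarrow> 'v \<Rightarrow> 'v) \<Rightarrow> 'v set \<Rightarrow> 'v set \<Rightarrow> 'v set" where
  "lie_prod scale br V W = Modules.module.span scale {br x y | x y. x \<in> V \<and> y \<in> W}"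

primrec derived_series ::
    "('f::field \<Rightarrow> 'v::ab_group_add \<Rightarrow> 'v) \<Rightarrow> ('v \<Rightarrow> 'v \<Rightarrow> 'v) \<Rightarrow> 'v set \<Rightarrow> nat \<Rightarrow> 'v set" where
  "derived_series scale br L 0 = L"
| "derived_series scale br L (Suc n) =
     lie_prod scale br (derived_series scale br L n) (derived_series scale br L n)"

definition lie_solvable ::
    "('f::field \<Rightarrow> 'v::ab_group_add \<Rightarrow> 'v) \<Rightarrow> ('v \<Rightarrow> 'v \<Rightarrow> 'v) \<Rightarrow> 'v set \<Rightarrow> bool" where
  "lie_solvable scale br L \<longleftrightarrow> (\<exists>n. derived_series scale br L n = {0})"

text \<open>Vanishing solvable radical; in particular the zero algebra is semisimple.\<close>

definition lie_semisimple ::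
    "('f::field \<Rightarrow> 'v::ab_group_add \<Rightarrow> 'v) \<Rightarrow> ('v \<Rightarrow> 'v \<Rightarrow> 'v) \<Rightarrow> 'v set \<Rightarrow> bool" where
  "lie_semisimple scale br L \<longleftrightarrow>
     (\<forall>I. lie_ideal scale br L I \<and> lie_solvable scale br I \<longrightarrow> I = {0})"

definition lie_simple ::
    "('f::field \<Rightarrow> 'v::ab_group_add \<Rightarrow> 'v) \<Rightarrow> ('v \<Rightarrow> 'v \<Rightarrow> 'v) \<Rightarrow> 'v set \<Rightarrow> bool" where
  "lie_simple scale br L \<longleftrightarrow>
     lie_prod scale br L L \<noteq> {0} \<and> (\<forall>I. lie_ideal scale br L I \<longrightarrow> I = {0} \<or> I = L)"

definition lie_isomorphic ::
    "('f::field \<Rightarrow> 'v::ab_group_add \<Rightarrow> 'v) \<Rightarrow> ('v \<Rightarrow> 'v \<Rightarrow> 'v) \<Rightarrow> 'v set \<Rightarrow> 'v set \<Rightarrow> bool" where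
  "lie_isomorphic scale br A B \<longleftrightarrow>
     (\<exists>\<phi>. bij_betw \<phi> A B \<and>
        (\<forall>x\<in>A. \<forall>y\<in>A. \<phi> (x + y) = \<phi> x + \<phi> y) \<and>
        (\<forall>c. \<forall>x\<in>A. \<phi> (scale c x) = scale c (\<phi> x)) \<and>
        (\<forall>x\<in>A. \<forall>y\<in>A. \<phi> (br x y) = br (\<phi> x) (\<phi> y)))"

definition simple_component ::
    "('f::field \<Rightarrow> 'v::ab_group_add \<Rightarrow> 'v) \<Rightarrow> ('v \<Rightarrow> 'v \<Rightarrow> 'v) \<Rightarrow> 'v set \<Rightarrow> 'v set \<Rightarrow> bool" where
  "simple_component scale br L B \<longleftrightarrow> lie_ideal scale br L B \<and> lie_simple scale br B"

text \<open>The values of \<open>gr\<close> outside \<open>carrier G\<close> are irrelevant.\<close>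

locale graded_lie_algebra = lie_algebra scale br L + group G
  for scale :: "'f::field \<Rightarrow> 'v::ab_group_add \<Rightarrow> 'v"
    and br :: "'v \<Rightarrow> 'v \<Rightarrow> 'v" and L :: "'v set" and G :: "('g, 'm) monoid_scheme" (structure) +
  fixes gr :: "'g \<Rightarrow> 'v set"
  assumes direct_sum_gr: "is_direct_sum scale L (carrier G) gr"
    and br_gr: "\<lbrakk>g \<in> carrier G; h \<in> carrier G; x \<in> gr g; y \<in> gr h\<rbrakk> \<Longrightarrow>
      br x y \<in> gr (g \<otimes> h)"

definition restrict_grading :: "('g \<Rightarrow> 'v set) \<Rightarrow> 'v set \<Rightarrow> 'g \<Rightarrow> 'v set" where
  "restrict_grading gr V = (\<lambda>g. V \<inter> gr g)"

definition graded_subspace ::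
    "('f::field \<Rightarrow> 'v::ab_group_add \<Rightarrow> 'v) \<Rightarrow> ('g, 'm) monoid_scheme \<Rightarrow> ('g \<Rightarrow> 'v set) \<Rightarrow>
     'v set \<Rightarrow> bool" where
  "graded_subspace scale G gr V \<longleftrightarrow>
     is_direct_sum scale V (carrier G) (restrict_grading gr V)"

definition graded_ideal ::
    "('f::field \<Rightarrow> 'v::ab_group_add \<Rightarrow> 'v) \<Rightarrow> ('v \<Rightarrow> 'v \<Rightarrow> 'v) \<Rightarrow> 'v set \<Rightarrow>
     ('g, 'm) monoid_scheme \<Rightarrow> ('g \<Rightarrow> 'v set) \<Rightarrow> 'v set \<Rightarrow> bool" where
  "graded_ideal scale br L G gr I \<longleftrightarrow>
     lie_ideal scale br L I \<and> graded_subspace scale G gr I"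

definition grading_supp ::
    "('g, 'm) monoid_scheme \<Rightarrow> ('g \<Rightarrow> 'v::zero set) \<Rightarrow> 'g set" where
  "grading_supp G gr = {g \<in> carrier G. gr g \<noteq> {0}}"

definition graded_simple ::
    "('f::field \<Rightarrow> 'v::ab_group_add \<Rightarrow> 'v) \<Rightarrow> ('v \<Rightarrow> 'v \<Rightarrow> 'v) \<Rightarrow> 'v set \<Rightarrow>
     ('g, 'm) monoid_scheme \<Rightarrow> ('g \<Rightarrow> 'v set) \<Rightarrow> bool" where
  "graded_simple scale br L G gr \<longleftrightarrow>
     lie_prod scale br L L \<noteq> {0} \<and>
     (\<forall>I. graded_ideal scale br L G gr I \<longrightarrow> I = {0} \<or> I = L)"

definition graded_simple_component ::
    "('f::field \<Rightarrow> 'v::ab_group_add \<Rightarrow> 'v) \<Rightarrow> ('v \<Rightarrow> 'v \<Rightarrow> 'v) \<Rightarrow> 'v set \<Rightarrow>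
     ('g, 'm) monoid_scheme \<Rightarrow> ('g \<Rightarrow> 'v set) \<Rightarrow> 'v set \<Rightarrow> bool" where
  "graded_simple_component scale br L G gr A \<longleftrightarrow>
     graded_ideal scale br L G gr A \<and>
     graded_simple scale br A G (restrict_grading gr A)"

definition commutative_subset :: "('g, 'm) monoid_scheme \<Rightarrow> 'g set \<Rightarrow> bool" where
  "commutative_subset G S \<longleftrightarrow> S \<subseteq> carrier G \<and> (\<forall>g\<in>S. \<forall>h\<in>S. g \<otimes>\<^bsub>G\<^esub> h = h \<otimes>\<^bsub>G\<^esub> g)"

lemma (in lie_algebra) lie_algebra_ideal:
  assumes "lie_ideal scale br L I"
  shows "lie_algebra scale br I"
proof -
  have I: "subspace I" "I \<subseteq> L" "\<And>x y. x \<in> L \<Longrightarrow> y \<in> I \<Longrightarrow> br x y \<in> I"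
    using assms by (auto simp: lie_ideal_def)
  show ?thesis
    by unfold_locales
      (use I in \<open>auto intro!: br_add_left br_add_right br_scale_left br_scale_right br_self jacobi\<close>)
qed

lemma (in graded_lie_algebra) graded_lie_algebra_ideal:
  assumes "graded_ideal scale br L G gr I"
  shows "graded_lie_algebra scale br I G (restrict_grading gr I)"
proof -
  have I: "lie_ideal scale br L I" "graded_subspace scale G gr I"
    using assms by (auto simp: graded_ideal_def)
  interpret I: lie_algebra scale br I
    using I(1) by (rule lie_algebra_ideal)
  show ?thesis
    by unfold_locales
      (use I(2) in \<open>auto simp: graded_subspace_def restrict_grading_def intro: I.br_closed br_gr\<close>)
qed

end

theory Submission
  imports Defs
begin

text \<open>
  In a graded simple algebra the homogeneous elements whose degree commutes with a fixed \<open>h\<close> in the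
  support, and which annihilate every component of degree not commuting with \<open>h\<close>, span a nonzero
  graded ideal; so the support is commutative. If it generates \<open>G\<close>, then \<open>G\<close> is abelian, its
  characters separate its elements and act on \<open>L\<close> by automorphisms, and the subspaces invariant
  under all of them are graded. The images of a minimal ideal under the characters therefore span
  \<open>L\<close>, so \<open>L\<close> is a direct sum of some of them, and these are simple and conjugate to each other.

  If \<open>L\<close> is semisimple, then Cartan's criterion for the Killing form shows that \<open>L\<close> is the direct
  sum of any ideal and its centralizer. The centralizer of a graded ideal is graded, so minimal
  graded ideals can be split off one by one.
\<close>


section \<open>Linear algebra on finite-dimensional subspaces\<close>

text \<open>The two claims use the field differently. For graded simple algebras it has to supply
  characters: \<open>G\<close> may be infinite, but \<open>L\<close> has finite support, so
  \<open>G\<close> is finitely generated and characters are extended by one generator at a time.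
  Algebraic closedness gives the roots that an extension needs, and characteristic zero a value
  other than 1 at any element other than the identity. Semisimplicity then follows from the
  decomposition, since the centralizer of \<open>L\<close> is a graded ideal and hence zero. For
  semisimple algebras it is Cartan's criterion that needs the field: algebraic closedness splits
  \<open>L\<close> into generalized eigenspaces of ad x, and characteristic zero provides
  functionals with rational values, whose squares cannot cancel. The complement of a graded ideal is
  taken to be its centralizer because cancellation in \<open>G\<close> shows directly that it is
  graded, also for noncommutative \<open>G\<close>. Since Lie algebras are carriers inside an
  ambient type, maps, traces and eigenspaces are taken relative to a subspace, and pairs of
  subspaces replace quotients.\<close>

text \<open>
  A copy of \<open>vector_space\<close>: constants defined inside \<open>vector_space\<close> itself would be shadowed by
  those of the global interpretation for \<open>real_vector\<close>.
\<close>

locale vspace = vector_space scale for scale :: "'a::field \<Rightarrow> 'b::ab_group_add \<Rightarrow> 'b"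
begin

lemma finite_dim_basis_extend:
  assumes V: "finite_dim scale V" and C: "independent C" "C \<subseteq> V"
  obtains B where "C \<subseteq> B" "finite B" "independent B" "span B = V"
proof -
  obtain S where S: "finite S" "span S = V" using V by (auto simp: finite_dim_def)
  obtain B where B: "C \<subseteq> B" "B \<subseteq> V" "independent B" "V \<subseteq> span B"
    by (rule maximal_independent_subset_extend[OF C(2,1)])
  have "finite B" using independent_span_bound[OF S(1) B(3)] B(2) S(2) by blast
  moreover have "span B = V" using B span_subspace[of B V] S(2) subspace_span by blast
  ultimately show ?thesis using that B by blast
qed

lemma finite_dim_basis:
  assumes "finite_dim scale V"
  obtains B where "finite B" "independent B" "span B = V"
  using finite_dim_basis_extend[OF assms independent_empty] by blast

lemma finite_dim_imp_subspace: "finite_dim scale V \<Longrightarrow> subspace V"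
  by (auto simp: finite_dim_def)

lemma finite_dim_subspace:
  assumes V: "finite_dim scale V" and U: "subspace U" "U \<subseteq> V"
  shows "finite_dim scale U"
proof -
  obtain S where S: "finite S" "span S = V" using V by (auto simp: finite_dim_def)
  obtain B where B: "B \<subseteq> U" "independent B" "U \<subseteq> span B"
    by (rule maximal_independent_subset)
  have "finite B" using independent_span_bound[OF S(1) B(2)] B(1) S(2) U(2) by blast
  moreover have "span B = U" using B U span_subspace by blast
  ultimately show ?thesis by (auto simp: finite_dim_def)
qed

lemma dim_less_dim:
  assumes V: "finite_dim scale V" and U: "subspace U" "U \<subseteq> V" "U \<noteq> V"
  shows "dim U < dim V"
proof -
  obtain C where C: "finite C" "independent C" "span C = U"
    using finite_dim_basis[OF finite_dim_subspace[OF V U(1,2)]] .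
  have "C \<subseteq> V" using C(3) U(2) span_superset by blast
  then obtain B where B: "C \<subseteq> B" "finite B" "independent B" "span B = V"
    using finite_dim_basis_extend[OF V C(2)] by blast
  have "C \<noteq> B" using B C U by auto
  then have "card C < card B" using B(1,2) by (simp add: psubset_card_mono psubset_eq)
  then show ?thesis using B C dim_span_eq_card_independent by metis
qed

lemma independent_card_dim_span:
  assumes V: "finite_dim scale V" and C: "independent C" "C \<subseteq> V" "dim V \<le> card C"
  shows "span C = V"
proof (rule ccontr)
  assume ne: "span C \<noteq> V"
  have "span C \<subseteq> V" using C(2) finite_dim_imp_subspace[OF V] by (rule span_minimal)
  then have "dim (span C) < dim V" using dim_less_dim[OF V] ne by blast
  then show False using C dim_span_eq_card_independent by simp
qed

text \<open>Linearity is demanded on \<open>V\<close> alone: the bracket is constrained only on its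
  carrier, so \<open>br x\<close> may fail to be linear on the whole type.\<close>

definition endo :: "'b set \<Rightarrow> ('b \<Rightarrow> 'b) \<Rightarrow> bool" where
  "endo V f \<longleftrightarrow> (\<forall>x\<in>V. f x \<in> V) \<and> (\<forall>x\<in>V. \<forall>y\<in>V. f (x + y) = f x + f y) \<and>
     (\<forall>c. \<forall>x\<in>V. f (scale c x) = scale c (f x))"

lemma endoI:
  "\<lbrakk>\<And>x. x \<in> V \<Longrightarrow> f x \<in> V; \<And>x y. \<lbrakk>x \<in> V; y \<in> V\<rbrakk> \<Longrightarrow> f (x + y) = f x + f y;
    \<And>c x. x \<in> V \<Longrightarrow> f (scale c x) = scale c (f x)\<rbrakk> \<Longrightarrow> endo V f"
  by (auto simp: endo_def)

lemma endo_in: "endo V f \<Longrightarrow> x \<in> V \<Longrightarrow> f x \<in> V"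
  and endo_add: "endo V f \<Longrightarrow> x \<in> V \<Longrightarrow> y \<in> V \<Longrightarrow> f (x + y) = f x + f y"
  and endo_scale: "endo V f \<Longrightarrow> x \<in> V \<Longrightarrow> f (scale c x) = scale c (f x)"
  by (auto simp: endo_def)

lemma endo_zero: "endo V f \<Longrightarrow> subspace V \<Longrightarrow> f 0 = 0"
  using endo_scale[of V f 0 0] subspace_0 by auto

lemma endo_diff:
  assumes "endo V f" "subspace V" "x \<in> V" "y \<in> V" shows "f (x - y) = f x - f y"
  using endo_add[of V f "x - y" y] subspace_diff[of V x y] assms by (simp add: algebra_simps)

lemma endo_sum:
  assumes f: "endo V f" and V: "subspace V" and g: "\<And>i. i \<in> A \<Longrightarrow> g i \<in> V"
  shows "f (\<Sum>i\<in>A. g i) = (\<Sum>i\<in>A. f (g i))"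
  using g
proof (induction A rule: infinite_finite_induct)
  case (insert a A)
  then show ?case using endo_add[OF f, of "g a" "sum g A"] subspace_sum[OF V, of A g] by auto
qed (simp_all add: endo_zero[OF f V])

lemma endo_id: "endo V (\<lambda>x. x)"
  by (auto simp: endo_def)

lemma endo_comp: "endo V f \<Longrightarrow> endo V g \<Longrightarrow> endo V (\<lambda>x. f (g x))"
  by (auto simp: endo_def)

lemma endo_plus: "subspace V \<Longrightarrow> endo V f \<Longrightarrow> endo V g \<Longrightarrow> endo V (\<lambda>x. f x + g x)"
  by (auto simp: endo_def subspace_add algebra_simps)

lemma endo_minus: "subspace V \<Longrightarrow> endo V f \<Longrightarrow> endo V g \<Longrightarrow> endo V (\<lambda>x. f x - g x)"
  by (auto simp: endo_def subspace_diff algebra_simps)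

lemma endo_smult: "subspace V \<Longrightarrow> endo V f \<Longrightarrow> endo V (\<lambda>x. scale c (f x))"
  by (auto simp: endo_def subspace_scale algebra_simps)

lemma endo_funpow: "endo V f \<Longrightarrow> endo V (f ^^ n)"
  by (induction n) (auto simp: endo_def)

lemma endo_eq_0_on_span:
  assumes "endo V f" "subspace V" "B \<subseteq> V" "\<And>b. b \<in> B \<Longrightarrow> f b = 0" "x \<in> span B"
  shows "f x = 0"
proof -
  have "x \<in> V \<and> f x = 0"
    using assms(5)
  proof (induction rule: span_induct_alt)
    case base then show ?case using assms endo_zero subspace_0 by blast
  next
    case (step c x y)
    then show ?case
      using assms endo_add[of V f "scale c x" y] endo_scale[of V f x c] subspace_add subspace_scale
      by auto
  qed
  then show ?thesis ..
qed

subsection \<open>The trace\<close>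

text \<open>The sum of the diagonal matrix entries in an arbitrarily chosen basis;
  \<open>trace_on_eq\<close> removes the dependence on the choice.\<close>

definition trace_on :: "'b set \<Rightarrow> ('b \<Rightarrow> 'b) \<Rightarrow> 'a" where
  "trace_on V f =
    (let B = (SOME B. finite B \<and> independent B \<and> span B = V) in \<Sum>b\<in>B. representation B (f b) b)"

text \<open>Expanding \<open>v\<close> in \<open>B\<close> gives one formula with two uses: for the
  identity map it is a change of basis, for a composition it is the product of two matrices.\<close>

lemma representation_endo:
  assumes f: "endo V f" and B: "finite B" "independent B" "span B = V"
    and C: "finite C" "independent C" "span C = V" and v: "v \<in> V"
  shows "representation C (f v) c = (\<Sum>b\<in>B. representation B v b * representation C (f b) c)"
proof -
  have V: "subspace V" using B(3) by auto
  have bV: "b \<in> V" if "b \<in> B" for b using that B(3) span_base by blast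
  have "f v = f (\<Sum>b\<in>B. scale (representation B v b) b)"
    using sum_representation_eq[OF B(2) _ B(1) order_refl] v B(3) by simp
  also have "\<dots> = (\<Sum>b\<in>B. scale (representation B v b) (f b))"
    by (subst endo_sum[OF f V]) (simp_all add: endo_scale[OF f] subspace_scale[OF V] bV)
  finally have "representation C (f v) c =
      representation C (\<Sum>b\<in>B. scale (representation B v b) (f b)) c" by simp
  also have "\<dots> = (\<Sum>b\<in>B. representation B v b * representation C (f b) c)"
    using C(3) V endo_in[OF f bV]
    by (subst representation_sum[OF C(2)])
      (auto intro!: sum.cong subspace_scale simp: representation_scale[OF C(2)])
  finally show ?thesis .
qed

text \<open>Expanding \<open>f b\<close> in \<open>C\<close> writes the sum as the trace of a
  product of two matrices; exchanging the two sums takes the product in the other order, which gives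
  the sum for \<open>C\<close>.\<close>

lemma trace_on_eq:
  assumes f: "endo V f" and B: "finite B" "independent B" "span B = V"
  shows "trace_on V f = (\<Sum>b\<in>B. representation B (f b) b)"
proof -
  define C where "C = (SOME B. finite B \<and> independent B \<and> span B = V)"
  have C: "finite C" "independent C" "span C = V"
    using someI[of "\<lambda>B. finite B \<and> independent B \<and> span B = V" B] B unfolding C_def by auto
  have BV: "b \<in> V" if "b \<in> B" for b using that B(3) span_base by blast
  have CV: "c \<in> V" if "c \<in> C" for c using that C(3) span_base by blast
  have "(\<Sum>b\<in>B. representation B (f b) b) =
      (\<Sum>b\<in>B. \<Sum>c\<in>C. representation C (f b) c * representation B c b)"
    by (intro sum.cong refl representation_endo[OF endo_id C B] endo_in[OF f] BV)
  also have "\<dots> = (\<Sum>c\<in>C. \<Sum>b\<in>B. representation B c b * representation C (f b) c)"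
    by (subst sum.swap) (simp add: mult.commute)
  also have "\<dots> = (\<Sum>c\<in>C. representation C (f c) c)"
    by (intro sum.cong refl representation_endo[OF f B C, symmetric] CV)
  finally show ?thesis by (simp add: trace_on_def C_def[symmetric])
qed

lemma trace_on_cong:
  assumes V: "finite_dim scale V" and fg: "endo V f" "endo V g" "\<And>x. x \<in> V \<Longrightarrow> f x = g x"
  shows "trace_on V f = trace_on V g"
proof -
  obtain B where B: "finite B" "independent B" "span B = V" using finite_dim_basis[OF V] .
  have "b \<in> V" if "b \<in> B" for b using that B(3) span_base by blast
  then show ?thesis using fg by (simp add: trace_on_eq[OF _ B])
qed

lemma trace_on_plus:
  assumes V: "finite_dim scale V" and f: "endo V f" and g: "endo V g"
  shows "trace_on V (\<lambda>x. f x + g x) = trace_on V f + trace_on V g"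
proof -
  obtain B where B: "finite B" "independent B" "span B = V" using finite_dim_basis[OF V] .
  have BV: "b \<in> V" if "b \<in> B" for b using that B(3) span_base by blast
  show ?thesis
    using endo_in[OF f BV] endo_in[OF g BV] endo_plus[OF finite_dim_imp_subspace[OF V] f g] f g
    by (simp add: trace_on_eq[OF _ B] representation_add[OF B(2)] B(3) sum.distrib)
qed

lemma trace_on_smult:
  assumes V: "finite_dim scale V" and f: "endo V f"
  shows "trace_on V (\<lambda>x. scale c (f x)) = c * trace_on V f"
proof -
  obtain B where B: "finite B" "independent B" "span B = V" using finite_dim_basis[OF V] .
  have BV: "b \<in> V" if "b \<in> B" for b using that B(3) span_base by blast
  show ?thesis
    using endo_in[OF f BV] endo_smult[OF finite_dim_imp_subspace[OF V] f] f
    by (simp add: trace_on_eq[OF _ B] representation_scale[OF B(2)] B(3) sum_distrib_left)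
qed

lemma trace_on_minus:
  assumes V: "finite_dim scale V" and f: "endo V f" and g: "endo V g"
  shows "trace_on V (\<lambda>x. f x - g x) = trace_on V f - trace_on V g"
  using trace_on_plus[OF V f endo_smult[OF finite_dim_imp_subspace[OF V] g, of "-1"]]
    trace_on_smult[OF V g, of "-1"]
  by simp

lemma trace_on_commute:
  assumes V: "finite_dim scale V" and f: "endo V f" and g: "endo V g"
  shows "trace_on V (\<lambda>x. f (g x)) = trace_on V (\<lambda>x. g (f x))"
proof -
  obtain B where B: "finite B" "independent B" "span B = V" using finite_dim_basis[OF V] .
  have BV: "b \<in> V" if "b \<in> B" for b using that B(3) span_base by blast
  have *: "trace_on V (\<lambda>x. f (g x)) =
      (\<Sum>b\<in>B. \<Sum>c\<in>B. representation B (g b) c * representation B (f c) b)"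
    if f: "endo V f" and g: "endo V g" for f g
    unfolding trace_on_eq[OF endo_comp[OF f g] B]
    by (intro sum.cong refl representation_endo[OF f B B] endo_in[OF g] BV)
  show ?thesis
    unfolding *[OF f g] *[OF g f] by (subst sum.swap) (simp add: mult.commute)
qed

lemma subspace_endo_image:
  assumes f: "endo V f" and U: "subspace U" "U \<subseteq> V" and V: "subspace V"
  shows "subspace (f ` U)"
proof (rule subspaceI)
  show "0 \<in> f ` U" using endo_zero[OF f V] subspace_0[OF U(1)] by force
  show "x + y \<in> f ` U" if xy: "x \<in> f ` U" "y \<in> f ` U" for x y
  proof -
    obtain a b where ab: "a \<in> U" "b \<in> U" "x = f a" "y = f b" using xy by blast
    then have "x + y = f (a + b)" using endo_add[OF f, of a b] U(2) by (simp add: subset_iff)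
    then show ?thesis using subspace_add[OF U(1)] ab by blast
  qed
  show "scale c x \<in> f ` U" if x: "x \<in> f ` U" for c x
  proof -
    obtain a where a: "a \<in> U" "x = f a" using x by blast
    then have "scale c x = f (scale c a)" using endo_scale[OF f, of a] U(2) by (simp add: subset_iff)
    then show ?thesis using subspace_scale[OF U(1)] a by blast
  qed
qed

text \<open>A nilpotent map has the same trace on a space and on its image, where its order is smaller.\<close>

lemma trace_on_nilpotent:
  assumes "finite_dim scale V" "endo V f" "\<And>x. x \<in> V \<Longrightarrow> (f ^^ n) x = 0"
  shows "trace_on V f = 0"
  using assms
proof (induction n arbitrary: V)
  case 0
  then have "span {} = V" using subspace_0[OF finite_dim_imp_subspace[OF 0(1)]] by auto
  then show ?case using trace_on_eq[OF 0(2), of "{}"] independent_empty by simp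
next
  case (Suc n)
  note V = finite_dim_imp_subspace[OF Suc.prems(1)]
  define W where "W = f ` V"
  have W: "subspace W" "W \<subseteq> V"
    using subspace_endo_image[OF Suc.prems(2) V order_refl V] endo_in[OF Suc.prems(2)] by (auto simp: W_def)
  have fdW: "finite_dim scale W" using finite_dim_subspace[OF Suc.prems(1) W] .
  have fW: "endo W f" using Suc.prems(2) W(2) by (auto simp: endo_def W_def)
  have tW: "trace_on W f = 0"
    using Suc.IH[OF fdW fW] Suc.prems(3) by (auto simp: W_def funpow_swap1)
  obtain C where C: "finite C" "independent C" "span C = W" using finite_dim_basis[OF fdW] .
  have "C \<subseteq> V" using C W span_superset by blast
  then obtain B where B: "C \<subseteq> B" "finite B" "independent B" "span B = V"
    using finite_dim_basis_extend[OF Suc.prems(1) C(2)] by blast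
  \<comment> \<open>All values of \<open>f\<close> lie in the span of \<open>C\<close>, so they have
    no coordinates along \<open>B - C\<close> and only the vectors of \<open>C\<close> contribute to
    the trace.\<close>
  have fb: "representation B (f b) = representation C (f b)" if "b \<in> B" for b
    using that representation_extend[OF B(3) _ B(1)] C(3) B(4) span_base[of b B]
    by (auto simp: W_def)
  have "trace_on V f = (\<Sum>b\<in>B. representation C (f b) b)"
    unfolding trace_on_eq[OF Suc.prems(2) B(2-4)] by (simp add: fb)
  also have "\<dots> = (\<Sum>b\<in>C. representation C (f b) b)"
    using B(1,2) representation_ne_zero by (intro sum.mono_neutral_right) auto
  finally show ?case using trace_on_eq[OF fW C] tW by simp
qed

end

section \<open>Direct sums\<close>

context vspace
begin

text \<open>Generation gives existence of a decomposition, by adding scaled generators to one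
  coordinate at a time. Independence gives uniqueness, because two decompositions of a vector differ
  by a finite family with sum zero.\<close>

lemma is_direct_sumI:
  fixes W :: "'i \<Rightarrow> 'b set"
  assumes V: "subspace V" and W: "\<And>i. i \<in> I \<Longrightarrow> subspace (W i)" "\<And>i. i \<in> I \<Longrightarrow> W i \<subseteq> V"
    and gen: "V \<subseteq> span (\<Union>i\<in>I. W i)"
    and ind: "\<And>J f i. \<lbrakk>finite J; J \<subseteq> I; \<And>j. j \<in> J \<Longrightarrow> f j \<in> W j; (\<Sum>j\<in>J. f j) = 0; i \<in> J\<rbrakk>
      \<Longrightarrow> f i = 0"
  shows "is_direct_sum scale V I W"
proof -
  define P where "P v f \<longleftrightarrow> (\<forall>i\<in>I. f i \<in> W i) \<and> (\<forall>i. i \<notin> I \<longrightarrow> f i = 0) \<and>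
        finite {i. f i \<noteq> 0} \<and> v = (\<Sum>i\<in>{i. f i \<noteq> 0}. f i)" for v and f :: "'i \<Rightarrow> 'b"
  have ex: "\<exists>f. P v f" if "v \<in> V" for v
  proof -
    have "v \<in> span (\<Union>i\<in>I. W i)" using that gen by blast
    then show ?thesis
    proof (induction rule: span_induct_alt)
      case base
      show ?case using W subspace_0 by (intro exI[of _ "\<lambda>_. 0"]) (auto simp: P_def)
    next
      case (step c x y)
      then obtain f i where f: "P y f" and i: "i \<in> I" "x \<in> W i" by blast
      define g where "g = f(i := f i + scale c x)"
      have fin: "finite (insert i {i. f i \<noteq> 0})" using f by (simp add: P_def)
      have "(\<Sum>j\<in>{j. g j \<noteq> 0}. g j) = (\<Sum>j\<in>insert i {i. f i \<noteq> 0}. g j)"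
        by (rule sum.mono_neutral_left[OF fin]) (auto simp: g_def)
      also have "\<dots> = (\<Sum>j\<in>insert i {i. f i \<noteq> 0}. f j + (if j = i then scale c x else 0))"
        by (intro sum.cong) (auto simp: g_def)
      also have "\<dots> = (\<Sum>j\<in>insert i {i. f i \<noteq> 0}. f j) + scale c x"
        using fin by (simp add: sum.distrib sum.delta)
      also have "(\<Sum>j\<in>insert i {i. f i \<noteq> 0}. f j) = (\<Sum>j\<in>{i. f i \<noteq> 0}. f j)"
        by (rule sum.mono_neutral_right[OF fin]) auto
      finally have "(\<Sum>j\<in>{j. g j \<noteq> 0}. g j) = scale c x + y" using f by (simp add: P_def)
      moreover have "finite {j. g j \<noteq> 0}"
        by (rule finite_subset[OF _ fin]) (auto simp: g_def)
      ultimately have "P (scale c x + y) g"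
        using f i W by (auto simp: P_def g_def intro!: subspace_add subspace_scale)
      then show ?case by blast
    qed
  qed
  have uniq: "f = g" if f: "P v f" and g: "P v g" for v f g
  proof
    fix i
    define J where "J = {i. f i \<noteq> 0} \<union> {i. g i \<noteq> 0}"
    have J: "finite J" "J \<subseteq> I" using f g by (auto simp: P_def J_def)
    have "(\<Sum>j\<in>J. f j) = v" using f J(1)
      unfolding P_def by (metis (mono_tags, lifting) J_def mem_Collect_eq
          sum.mono_neutral_right Un_iff Diff_iff Un_upper1)
    moreover have "(\<Sum>j\<in>J. g j) = v" using g J(1)
      unfolding P_def by (metis (mono_tags, lifting) J_def mem_Collect_eq
          sum.mono_neutral_right Un_iff Diff_iff Un_upper2)
    ultimately have "(\<Sum>j\<in>J. f j - g j) = 0" by (simp add: sum_subtractf)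
    moreover have "f j - g j \<in> W j" if "j \<in> J" for j
      using that J(2) f g W(1) by (auto simp: P_def intro!: subspace_diff)
    ultimately have "f i - g i = 0" if "i \<in> J" using ind[OF J, of "\<lambda>j. f j - g j"] that by blast
    then show "f i = g i" by (cases "i \<in> J") (auto simp: J_def)
  qed
  have "\<forall>v\<in>V. \<exists>!f. P v f" using ex uniq by blast
  then show ?thesis using V W unfolding is_direct_sum_def P_def by blast
qed

end

locale dsum = vspace scale for scale :: "'a::field \<Rightarrow> 'b::ab_group_add \<Rightarrow> 'b" +
  fixes V :: "'b set" and I :: "'i set" and W :: "'i \<Rightarrow> 'b set"
  assumes direct_sum: "is_direct_sum scale V I W"
begin

lemma subspace_sum_space: "subspace V"
  and subspace_summand: "i \<in> I \<Longrightarrow> subspace (W i)"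
  and summand_subset: "i \<in> I \<Longrightarrow> W i \<subseteq> V"
  using direct_sum by (auto simp: is_direct_sum_def)

definition component :: "'b \<Rightarrow> 'i \<Rightarrow> 'b" where
  "component v = (THE f. (\<forall>i\<in>I. f i \<in> W i) \<and> (\<forall>i. i \<notin> I \<longrightarrow> f i = 0) \<and>
        finite {i. f i \<noteq> 0} \<and> v = (\<Sum>i\<in>{i. f i \<noteq> 0}. f i))"

lemma component_props:
  assumes "v \<in> V"
  shows "(\<forall>i\<in>I. component v i \<in> W i) \<and> (\<forall>i. i \<notin> I \<longrightarrow> component v i = 0) \<and>
        finite {i. component v i \<noteq> 0} \<and> v = (\<Sum>i\<in>{i. component v i \<noteq> 0}. component v i)"
proof -
  have "\<exists>!f. (\<forall>i\<in>I. f i \<in> W i) \<and> (\<forall>i. i \<notin> I \<longrightarrow> f i = 0) \<and>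
        finite {i. f i \<noteq> 0} \<and> v = (\<Sum>i\<in>{i. f i \<noteq> 0}. f i)"
    using direct_sum assms unfolding is_direct_sum_def by blast
  then show ?thesis unfolding component_def by (rule theI')
qed

lemma component_in: "v \<in> V \<Longrightarrow> i \<in> I \<Longrightarrow> component v i \<in> W i"
  and component_outside: "v \<in> V \<Longrightarrow> i \<notin> I \<Longrightarrow> component v i = 0"
  and finite_components: "v \<in> V \<Longrightarrow> finite {i. component v i \<noteq> 0}"
  and sum_components: "v \<in> V \<Longrightarrow> (\<Sum>i\<in>{i. component v i \<noteq> 0}. component v i) = v"
  using component_props by auto

lemma component_mem: "v \<in> V \<Longrightarrow> component v i \<in> V"
  using component_in[of v i] component_outside[of v i] summand_subset[of i]
    subspace_0[OF subspace_sum_space]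
  by (cases "i \<in> I") auto

lemma component_unique:
  assumes J: "finite J" "J \<subseteq> I" and f: "\<And>i. i \<in> J \<Longrightarrow> f i \<in> W i"
    and v: "v = (\<Sum>i\<in>J. f i)"
  shows "component v = (\<lambda>i. if i \<in> J then f i else 0)"
proof -
  define g where "g i = (if i \<in> J then f i else 0)" for i
  have "v \<in> V" unfolding v using f J summand_subset by (intro subspace_sum subspace_sum_space) blast
  then have ex1: "\<exists>!f. (\<forall>i\<in>I. f i \<in> W i) \<and> (\<forall>i. i \<notin> I \<longrightarrow> f i = 0) \<and>
        finite {i. f i \<noteq> 0} \<and> v = (\<Sum>i\<in>{i. f i \<noteq> 0}. f i)"
    using direct_sum unfolding is_direct_sum_def by blast
  have "(\<Sum>i\<in>{i. g i \<noteq> 0}. g i) = (\<Sum>i\<in>J. g i)"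
    using J(1) by (intro sum.mono_neutral_left) (auto simp: g_def)
  also have "\<dots> = v" unfolding v by (simp add: g_def)
  finally have "(\<forall>i\<in>I. g i \<in> W i) \<and> (\<forall>i. i \<notin> I \<longrightarrow> g i = 0) \<and>
        finite {i. g i \<noteq> 0} \<and> v = (\<Sum>i\<in>{i. g i \<noteq> 0}. g i)"
    using J f subspace_0[OF subspace_summand] by (auto simp: g_def)
  then show ?thesis unfolding component_def g_def[abs_def] by (rule the1_equality[OF ex1])
qed

lemma component_homogeneous: "i \<in> I \<Longrightarrow> v \<in> W i \<Longrightarrow> component v = (\<lambda>j. if j = i then v else 0)"
  using component_unique[of "{i}" "\<lambda>_. v" v] by auto

lemma component_add:
  assumes "u \<in> V" "v \<in> V"
  shows "component (u + v) = (\<lambda>i. component u i + component v i)"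
proof -
  define J where "J = {i. component u i \<noteq> 0} \<union> {i. component v i \<noteq> 0}"
  have J: "finite J" "J \<subseteq> I"
    using finite_components component_outside assms by (auto simp: J_def)
  have "(\<Sum>i\<in>J. component u i) = u" "(\<Sum>i\<in>J. component v i) = v"
    using sum_components assms J(1) by (subst sum.mono_neutral_right; force simp: J_def)+
  then have "component (u + v) = (\<lambda>i. if i \<in> J then component u i + component v i else 0)"
    using J component_in assms
    by (intro component_unique) (auto simp: sum.distrib intro!: subspace_add subspace_summand)
  also have "\<dots> = (\<lambda>i. component u i + component v i)" by (auto simp: J_def)
  finally show ?thesis .
qed

lemma component_scale:
  assumes "v \<in> V"
  shows "component (scale c v) = (\<lambda>i. scale c (component v i))"
proof -
  define J where "J = {i. component v i \<noteq> 0}"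
  have J: "finite J" "J \<subseteq> I"
    using finite_components component_outside assms by (auto simp: J_def)
  have "(\<Sum>i\<in>J. component v i) = v" using sum_components assms by (simp add: J_def)
  then have "component (scale c v) = (\<lambda>i. if i \<in> J then scale c (component v i) else 0)"
    using J component_in assms
    by (intro component_unique) (auto simp: scale_sum_right[symmetric] intro!: subspace_scale subspace_summand)
  also have "\<dots> = (\<lambda>i. scale c (component v i))" by (auto simp: J_def)
  finally show ?thesis .
qed

lemma endo_component: "endo V (\<lambda>v. component v i)"
  by (rule endoI) (auto simp: component_mem component_add component_scale)

lemma component_eqI:
  assumes "u \<in> V" "v \<in> V" "\<And>i. i \<in> I \<Longrightarrow> component u i = component v i"
  shows "u = v"
proof -
  have "component u = component v" using assms component_outside by (metis ext)
  then show ?thesis using sum_components assms by metis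
qed

text \<open>Used with functions of the eigenvalue, where it yields the semisimple part and the
  derivation of Cartan's criterion, and with characters of \<open>G\<close>, where it yields
  automorphisms of a graded algebra.\<close>

definition diag :: "('i \<Rightarrow> 'a) \<Rightarrow> 'b \<Rightarrow> 'b" where
  "diag c v = (\<Sum>i\<in>{i. component v i \<noteq> 0}. scale (c i) (component v i))"

lemma component_diag:
  assumes v: "v \<in> V"
  shows "component (diag c v) i = scale (c i) (component v i)"
proof -
  have "component (diag c v) =
      (\<lambda>i. if i \<in> {i. component v i \<noteq> 0} then scale (c i) (component v i) else 0)"
    using component_in[OF v] component_outside[OF v] subspace_scale[OF subspace_summand]
    by (intro component_unique[OF finite_components[OF v] _ _ diag_def]) blast+
  then show ?thesis by auto
qed

lemma diag_mem: "v \<in> V \<Longrightarrow> diag c v \<in> V"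
  unfolding diag_def using component_mem subspace_sum_space
  by (intro subspace_sum subspace_scale) auto

lemma endo_diag: "endo V (diag c)"
proof (rule endoI)
  show "diag c x \<in> V" if "x \<in> V" for x using diag_mem that .
  show "diag c (x + y) = diag c x + diag c y" if "x \<in> V" "y \<in> V" for x y
    by (rule component_eqI) (use that subspace_add[OF subspace_sum_space] in
      \<open>auto simp: component_diag component_add diag_mem algebra_simps\<close>)
  show "diag c (scale k x) = scale k (diag c x)" if "x \<in> V" for k x
    by (rule component_eqI) (use that subspace_scale[OF subspace_sum_space] in
      \<open>auto simp: component_diag component_scale diag_mem mult.commute\<close>)
qed

lemma diag_homogeneous: "i \<in> I \<Longrightarrow> v \<in> W i \<Longrightarrow> diag c v = scale (c i) v"
  by (rule component_eqI) (use summand_subset subspace_scale[OF subspace_sum_space] in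
    \<open>auto simp: component_diag component_scale component_homogeneous diag_mem subset_iff\<close>)

lemma diag_compose: "v \<in> V \<Longrightarrow> diag c (diag d v) = diag (\<lambda>i. c i * d i) v"
  by (rule component_eqI) (auto simp: component_diag diag_mem)

lemma diag_eq_id: "v \<in> V \<Longrightarrow> (\<And>i. i \<in> I \<Longrightarrow> c i = 1) \<Longrightarrow> diag c v = v"
  by (rule component_eqI) (auto simp: component_diag diag_mem)

lemma span_summands: "span (\<Union>i\<in>I. W i) = V"
proof
  show "span (\<Union>i\<in>I. W i) \<subseteq> V"
    by (rule span_minimal[OF _ subspace_sum_space]) (use summand_subset in auto)
  show "V \<subseteq> span (\<Union>i\<in>I. W i)"
  proof
    fix v assume v: "v \<in> V"
    have "(\<Sum>i\<in>{i. component v i \<noteq> 0}. component v i) \<in> span (\<Union>i\<in>I. W i)"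
      using component_in[OF v] component_outside[OF v] by (intro span_sum span_base) blast
    then show "v \<in> span (\<Union>i\<in>I. W i)" using sum_components[OF v] by simp
  qed
qed

lemma homogeneous_induct [consumes 1, case_names zero add homogeneous]:
  assumes v: "v \<in> V" and 0: "P 0"
    and add: "\<And>x y. \<lbrakk>x \<in> V; y \<in> V; P x; P y\<rbrakk> \<Longrightarrow> P (x + y)"
    and hom: "\<And>i x. \<lbrakk>i \<in> I; x \<in> W i\<rbrakk> \<Longrightarrow> P x"
  shows "P v"
proof -
  have "v \<in> span (\<Union>i\<in>I. W i)" using v span_summands by simp
  then have "v \<in> V \<and> P v"
  proof (induction rule: span_induct_alt)
    case base
    then show ?case using 0 subspace_0[OF subspace_sum_space] by auto
  next
    case (step c x y)
    then obtain i where i: "i \<in> I" "x \<in> W i" by blast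
    then have "scale c x \<in> W i" using subspace_summand subspace_scale by blast
    then show ?case
      using step add hom[OF i(1)] i summand_subset subspace_add[OF subspace_sum_space] by blast
  qed
  then show ?thesis ..
qed

end

section \<open>Enlarging a direct sum by one summand\<close>

context vspace
begin

lemma is_direct_sum_extend:
  assumes ds: "is_direct_sum scale U I W" and i: "i \<notin> I"
    and A: "subspace A" "A \<inter> U = {0}" and V: "V = {u + a | u a. u \<in> U \<and> a \<in> A}"
  shows "is_direct_sum scale V (insert i I) (W(i := A))"
proof -
  interpret U: dsum scale U I W by unfold_locales (fact ds)
  note U = U.subspace_sum_space
  have sV: "subspace V" unfolding V by (rule subspace_sums[OF U A(1)])
  have UV: "U \<subseteq> V" using subspace_0[OF A(1)] by (force simp: V)
  have AV: "A \<subseteq> V" using subspace_0[OF U] by (force simp: V)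
  show ?thesis
  proof (rule is_direct_sumI[OF sV])
    show "subspace ((W(i := A)) j)" if "j \<in> insert i I" for j
      using that A(1) U.subspace_summand by auto
    show "(W(i := A)) j \<subseteq> V" if "j \<in> insert i I" for j
      using that UV AV U.summand_subset by auto
    have "span (\<Union>j\<in>I. W j) \<subseteq> span (\<Union>j\<in>insert i I. (W(i := A)) j)"
      using i by (intro span_mono) auto
    then have *: "U \<subseteq> span (\<Union>j\<in>insert i I. (W(i := A)) j)" by (simp add: U.span_summands)
    have "A \<subseteq> span (\<Union>j\<in>insert i I. (W(i := A)) j)"
      by (rule order_trans[OF _ span_superset]) auto
    with * show "V \<subseteq> span (\<Union>j\<in>insert i I. (W(i := A)) j)"
      unfolding V by (auto intro!: span_add)
  next
    fix J f k
    assume J: "finite J" "J \<subseteq> insert i I" and f: "\<And>j. j \<in> J \<Longrightarrow> f j \<in> (W(i := A)) j"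
      and 0: "(\<Sum>j\<in>J. f j) = 0" and k: "k \<in> J"
    define J' where "J' = J - {i}"
    have J': "finite J'" "J' \<subseteq> I" using J by (auto simp: J'_def)
    have fW: "f j \<in> W j" if "j \<in> J'" for j using f[of j] that by (auto simp: J'_def)
    have sU: "(\<Sum>j\<in>J'. f j) \<in> U"
      using fW J'(2) U.summand_subset by (intro subspace_sum[OF U]) blast
    have s0: "(\<Sum>j\<in>J'. f j) = 0" and fi: "i \<in> J \<Longrightarrow> f i = 0"
    proof -
      \<comment> \<open>In a vanishing sum the term from \<open>A\<close> is minus the sum of the
        others, so it lies in both \<open>A\<close> and \<open>U\<close>.\<close>
      have *: "f i = 0" "(\<Sum>j\<in>J'. f j) = 0" if iJ: "i \<in> J"
      proof -
        have eq: "f i = - (\<Sum>j\<in>J'. f j)"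
          using 0 J(1) iJ by (simp add: J'_def sum.remove eq_neg_iff_add_eq_0)
        then have "f i \<in> A \<inter> U" using f[OF iJ] subspace_neg[OF U sU] by simp
        then show "f i = 0" using A(2) by simp
        then show "(\<Sum>j\<in>J'. f j) = 0" using eq by simp
      qed
      show "i \<in> J \<Longrightarrow> f i = 0" by (rule *)
      show "(\<Sum>j\<in>J'. f j) = 0" using * 0 by (cases "i \<in> J") (auto simp: J'_def)
    qed
    have "U.component 0 k = f k" if "k \<in> J'"
      using U.component_unique[OF J' fW s0[symmetric]] that by simp
    moreover have "U.component 0 k = 0"
      using U.component_unique[of "{}" "\<lambda>_. 0" 0] by simp
    ultimately show "f k = 0" using fi k by (auto simp: J'_def)
  qed
qed

lemma is_direct_sum_empty: "is_direct_sum scale {0} {} W"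
  by (rule is_direct_sumI) auto

text \<open>Every new summand increases the dimension, so the process stops, and it can only stop at
  \<open>L\<close>. \<open>P\<close> is the invariant of the partial sums, \<open>Q\<close> the
  property wanted of the summands; both decompositions of the theorem are instances.\<close>

lemma greedy_direct_sum:
  assumes L: "finite_dim scale L" and P0: "P {0}"
    and PL: "\<And>U. P U \<Longrightarrow> subspace U \<and> U \<subseteq> L"
    and step: "\<And>U. P U \<Longrightarrow> U \<noteq> L \<Longrightarrow> \<exists>A. Q A \<and> subspace A \<and> A \<noteq> {0} \<and> A \<inter> U = {0} \<and>
      P {u + a | u a. u \<in> U \<and> a \<in> A}"
  obtains n :: nat and B where "is_direct_sum scale L {1..n} B" "\<And>i. i \<in> {1..n} \<Longrightarrow> Q (B i)"
proof -
  have "\<exists>(n::nat) B. is_direct_sum scale L {1..n} B \<and> (\<forall>i\<in>{1..n}. Q (B i))"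
    if "P U" "is_direct_sum scale U {1..m} B" "\<forall>i\<in>{1..m}. Q (B i)" for U and m :: nat and B
    using that
  proof (induction "dim L - dim U" arbitrary: U m B rule: less_induct)
    case less
    show ?case
    proof (cases "U = L")
      case True
      then show ?thesis using less.prems by blast
    next
      case False
      obtain A where A: "Q A" "subspace A" "A \<noteq> {0}" "A \<inter> U = {0}"
        and PUA: "P {u + a | u a. u \<in> U \<and> a \<in> A}" (is "P ?V")
        using step[OF less.prems(1) False] by blast
      have U: "subspace U" "U \<subseteq> L" using PL[OF less.prems(1)] by auto
      have V: "subspace ?V" "?V \<subseteq> L" using PL[OF PUA] by auto
      have UV: "U \<subseteq> ?V" using subspace_0[OF A(2)] by force
      have AV: "A \<subseteq> ?V" using subspace_0[OF U(1)] by force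
      have "U \<noteq> ?V" using A(3,4) AV subspace_0[OF A(2)] by blast
      then have "dim U < dim ?V"
        using dim_less_dim[OF finite_dim_subspace[OF L V] U(1) UV] by blast
      moreover have "dim U < dim L" using dim_less_dim[OF L U False] .
      ultimately have lt: "dim L - dim ?V < dim L - dim U" by linarith
      have "is_direct_sum scale ?V (insert (Suc m) {1..m}) (B(Suc m := A))"
        by (rule is_direct_sum_extend[OF less.prems(2) _ A(2,4) refl]) simp
      then have ds: "is_direct_sum scale ?V {1..Suc m} (B(Suc m := A))"
        by (simp add: atLeastAtMostSuc_conv)
      show ?thesis
        using less.hyps[OF lt PUA ds] less.prems(3) A(1) by auto
    qed
  qed
  from this[OF P0, of 0 "\<lambda>_. {0}"] is_direct_sum_empty
  obtain n :: nat and B where "is_direct_sum scale L {1..n} B" "\<forall>i\<in>{1..n}. Q (B i)" by auto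
  then show ?thesis using that by blast
qed

end

section \<open>Generalized eigenspaces\<close>

text \<open>The field is a vector space over the rationals, so the value 1 at \<open>a\<close>
  extends linearly. Rational values have nonnegative squares, which in Cartan's criterion takes the
  place of complex conjugation.\<close>

lemma rat_linear_functional:
  fixes a :: "'a::field_char_0"
  assumes "a \<noteq> 0"
  obtains f :: "'a \<Rightarrow> rat" where "\<And>x y. f (x + y) = f x + f y"
    "\<And>q x. f (of_rat q * x) = q * f x" "f a = 1"
proof -
  interpret q: vector_space_pair "\<lambda>q (x::'a). of_rat q * x" "(*) :: rat \<Rightarrow> rat \<Rightarrow> rat"
    by unfold_locales (auto simp: algebra_simps of_rat_add of_rat_mult)
  have ind: "q.vs1.independent {a}" using assms by simp
  define f where "f = q.construct {a} (\<lambda>_. 1)"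
  interpret f: Vector_Spaces.linear "\<lambda>q (x::'a). of_rat q * x" "(*) :: rat \<Rightarrow> rat \<Rightarrow> rat" f
    unfolding f_def by (rule q.linear_construct[OF ind])
  show ?thesis
    using that[OF f.add f.scale] q.construct_basis[OF ind, of a] by (simp add: f_def)
qed

context vspace
begin

definition gen_eig :: "'b set \<Rightarrow> ('b \<Rightarrow> 'b) \<Rightarrow> 'a \<Rightarrow> 'b set" where
  "gen_eig V T l = {v \<in> V. \<exists>n. ((\<lambda>v. T v - scale l v) ^^ n) v = 0}"

lemma endo_shift: "subspace V \<Longrightarrow> endo V T \<Longrightarrow> endo V (\<lambda>v. T v - scale l v)"
  by (intro endo_minus endo_smult endo_id)

text \<open>Induction on the exponent that kills the vector: one application of \<open>T - l\<close>
  leads to a vector with a smaller exponent. For brackets this spares the binomial expansion of a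
  power.\<close>

lemma gen_eig_induct [consumes 3, case_names zero step]:
  assumes v: "v \<in> gen_eig V T l" and T: "subspace V" "endo V T" and 0: "P 0"
    and step: "\<And>v. \<lbrakk>v \<in> gen_eig V T l; T v - scale l v \<in> gen_eig V T l; P (T v - scale l v)\<rbrakk> \<Longrightarrow> P v"
  shows "P v"
proof -
  have "P v" if "((\<lambda>v. T v - scale l v) ^^ n) v = 0" "v \<in> V" for n v
    using that
  proof (induction n arbitrary: v)
    case 0
    then show ?case using \<open>P 0\<close> by simp
  next
    case (Suc n)
    then have *: "((\<lambda>v. T v - scale l v) ^^ n) (T v - scale l v) = 0"
      by (simp only: funpow_Suc_right o_apply)
    have "T v - scale l v \<in> V" using endo_in[OF endo_shift[OF T]] Suc.prems(2) .
    then show ?case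
      using Suc.prems Suc.IH[OF *] * by (intro step[of v]) (auto simp: gen_eig_def simp del: funpow.simps)
  qed
  then show ?thesis using v by (auto simp: gen_eig_def)
qed

lemma gen_eig_stepI:
  assumes "v \<in> V" "T v - scale l v \<in> gen_eig V T l"
  shows "v \<in> gen_eig V T l"
proof -
  obtain n where "((\<lambda>v. T v - scale l v) ^^ n) (T v - scale l v) = 0"
    using assms(2) by (auto simp: gen_eig_def)
  then have "((\<lambda>v. T v - scale l v) ^^ Suc n) v = 0" by (simp only: funpow_Suc_right o_apply)
  then show ?thesis using assms(1) unfolding gen_eig_def by blast
qed

lemma zero_in_gen_eig: "subspace V \<Longrightarrow> 0 \<in> gen_eig V T l"
  unfolding gen_eig_def using subspace_0 by (auto intro!: exI[of _ 0])

lemma gen_eig_subset: "gen_eig V T l \<subseteq> V"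
  by (auto simp: gen_eig_def)

lemma subspace_gen_eig:
  assumes V: "subspace V" and T: "endo V T"
  shows "subspace (gen_eig V T l)"
proof -
  let ?S = "\<lambda>v. T v - scale l v"
  have S: "endo V (?S ^^ n)" for n by (intro endo_funpow endo_shift V T)
  have mono: "(?S ^^ (m + n)) v = 0" if "v \<in> V" "(?S ^^ n) v = 0" for m n v
    using that endo_zero[OF S V, of m] by (simp add: funpow_add)
  show ?thesis
  proof (rule subspaceI)
    show "0 \<in> gen_eig V T l" using zero_in_gen_eig V .
    show "x + y \<in> gen_eig V T l" if xy: "x \<in> gen_eig V T l" "y \<in> gen_eig V T l" for x y
    proof -
      obtain m n where "(?S ^^ m) x = 0" "(?S ^^ n) y = 0" and V': "x \<in> V" "y \<in> V"
        using xy by (auto simp: gen_eig_def)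
      then have "(?S ^^ (m + n)) x = 0" "(?S ^^ (m + n)) y = 0"
        using mono[of x m n] mono[of y n m] by (simp_all add: add.commute)
      then have "(?S ^^ (m + n)) (x + y) = 0" using endo_add[OF S V'] by simp
      then show ?thesis using V' V subspace_add unfolding gen_eig_def by blast
    qed
    show "scale c x \<in> gen_eig V T l" if x: "x \<in> gen_eig V T l" for c x
    proof -
      obtain m where m: "(?S ^^ m) x = 0" "x \<in> V" using x by (auto simp: gen_eig_def)
      then have "(?S ^^ m) (scale c x) = 0" using endo_scale[OF S] by simp
      then show ?thesis using m V subspace_scale unfolding gen_eig_def by blast
    qed
  qed
qed

lemma gen_eig_commuting:
  assumes v: "v \<in> gen_eig V T l" and T: "subspace V" "endo V T" and R: "endo V R"
    and comm: "\<And>v. v \<in> V \<Longrightarrow> R (T v) = T (R v)"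
  shows "R v \<in> gen_eig V T l"
  using v T
proof (induction rule: gen_eig_induct)
  case zero
  then show ?case using zero_in_gen_eig endo_zero R T by metis
next
  case (step v)
  have v: "v \<in> V" using step(1) gen_eig_subset by blast
  then have "T (R v) - scale l (R v) = R (T v - scale l v)"
    using endo_diff[OF R T(1)] endo_in[OF T(2)] subspace_scale[OF T(1)] comm endo_scale[OF R]
    by simp
  then show ?case using gen_eig_stepI[of "R v" V T l] step(3) v endo_in[OF R] by simp
qed

text \<open>On this space \<open>T - l\<close> is the nonzero scalar \<open>m - l\<close> plus a
  locally nilpotent map. The inverse is found recursively: if \<open>w\<close> is a preimage of
  \<open>T u - m u\<close>, then \<open>(u - w) / (m - l)\<close> is a preimage of
  \<open>u\<close>.\<close>

lemma gen_eig_shift_surj: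
  assumes u: "u \<in> gen_eig V T m" and T: "subspace V" "endo V T" and ne: "m \<noteq> l"
  shows "\<exists>w\<in>gen_eig V T m. T w - scale l w = u"
  using u T
proof (induction rule: gen_eig_induct)
  case zero
  then show ?case using zero_in_gen_eig[OF T(1)] endo_zero[OF T(2,1)] by (intro bexI[of _ 0]) auto
next
  case (step u)
  then obtain w where w: "w \<in> gen_eig V T m" "T w - scale l w = T u - scale m u" by blast
  have uw: "u \<in> V" "w \<in> V" "u - w \<in> V"
    using w(1) step(1) gen_eig_subset T(1) subspace_diff by blast+
  define z where "z = scale (1 / (m - l)) (u - w)"
  have "z \<in> gen_eig V T m" unfolding z_def
    using w(1) step(1) subspace_gen_eig[OF T] subspace_diff subspace_scale by blast
  moreover have "T z - scale l z = u"
  proof -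
    have "T z - scale l z = scale (1 / (m - l)) (T (u - w) - scale l (u - w))"
      using endo_scale[OF T(2) uw(3)] by (simp add: z_def scale_right_diff_distrib mult.commute)
    also have "T (u - w) - scale l (u - w) = (T u - scale l u) - (T w - scale l w)"
      using endo_diff[OF T(2,1) uw(1,2)] by (simp add: algebra_simps)
    also have "\<dots> = scale (m - l) u" unfolding w(2) by (simp add: algebra_simps)
    finally show ?thesis using ne by simp
  qed
  ultimately show ?case by blast
qed

text \<open>On a true eigenvector for \<open>l\<close>, the map \<open>T - m\<close> is
  multiplication by \<open>l - m\<close>, and no power of a nonzero scalar kills a nonzero
  vector.\<close>

lemma gen_eig_shift_inj:
  assumes "u \<in> gen_eig V T m" "T u = scale l u" and T: "subspace V" "endo V T" and ne: "m \<noteq> l"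
  shows "u = 0"
proof -
  have u: "u \<in> V" using assms(1) gen_eig_subset by blast
  have "((\<lambda>v. T v - scale m v) ^^ n) u = scale ((l - m) ^ n) u" for n
  proof (induction n)
    case (Suc n)
    then show ?case
      using assms(2) endo_scale[OF T(2) u]
      by (simp add: algebra_simps)
  qed simp
  then show ?thesis using assms(1) ne by (auto simp: gen_eig_def)
qed

text \<open>A power of \<open>T - l\<close> removes the term for \<open>l\<close> and keeps the
  others in their generalized eigenspaces, where induction makes them vanish. As
  \<open>T - l\<close> is injective on those spaces, the original terms vanish too.\<close>

lemma gen_eig_independent:
  assumes T: "subspace V" "endo V T" and J: "finite J"
    and f: "\<And>j. j \<in> J \<Longrightarrow> f j \<in> gen_eig V T j" and sum: "(\<Sum>j\<in>J. f j) = 0" and i: "i \<in> J"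
  shows "f i = 0"
  using J f sum i
proof (induction J arbitrary: f i rule: finite_induct)
  case (insert l J)
  let ?S = "\<lambda>v. T v - scale l v"
  have S: "endo V (?S ^^ n)" for n by (intro endo_funpow endo_shift T)
  have fV: "f j \<in> V" if "j \<in> insert l J" for j using insert.prems(1)[OF that] gen_eig_subset by blast
  obtain n where n: "(?S ^^ n) (f l) = 0" using insert.prems(1)[of l] by (auto simp: gen_eig_def)
  have Sn: "(?S ^^ n) (f j) \<in> gen_eig V T j" if "j \<in> insert l J" for n j
  proof (induction n)
    case 0
    then show ?case using insert.prems(1)[OF that] by simp
  next
    case (Suc n)
    have "?S ((?S ^^ n) (f j)) \<in> gen_eig V T j"
      by (rule gen_eig_commuting[OF Suc T endo_shift[OF T]])
        (simp add: endo_diff[OF T(2,1)] endo_scale[OF T(2)] endo_in[OF T(2)] subspace_scale[OF T(1)])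
    then show ?case by simp
  qed
  have "(\<Sum>j\<in>insert l J. (?S ^^ n) (f j)) = 0"
    using endo_sum[OF S T(1), of "insert l J" f] fV insert.prems(2) endo_zero[OF S T(1)] by simp
  then have "(\<Sum>j\<in>J. (?S ^^ n) (f j)) = 0" using insert.hyps n by simp
  then have z: "(?S ^^ n) (f j) = 0" if "j \<in> J" for j
    using insert.IH[of "\<lambda>j. (?S ^^ n) (f j)"] Sn that by blast
  have "f j = 0" if j: "j \<in> J" for j
  proof -
    have "(?S ^^ k) (f j) = 0 \<Longrightarrow> f j = 0" for k
    proof (induction k)
      case (Suc k)
      have "T ((?S ^^ k) (f j)) = scale l ((?S ^^ k) (f j))" using Suc.prems by simp
      then have "(?S ^^ k) (f j) = 0"
        using gen_eig_shift_inj[OF Sn _ T] j insert.hyps(2) by blast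
      then show ?case by (rule Suc.IH)
    qed simp
    then show ?thesis using z[OF j] by blast
  qed
  then show ?case using insert by auto
qed simp

section \<open>Horner evaluation of polynomials at an endomorphism\<close>

definition poly_endo :: "('b \<Rightarrow> 'b) \<Rightarrow> 'a poly \<Rightarrow> 'b \<Rightarrow> 'b" where
  "poly_endo T p v = fold_coeffs (\<lambda>a w. scale a v + T w) p 0"

context
  fixes V T assumes V: "subspace V" and T: "endo V T"
begin

lemma poly_endo_0: "poly_endo T 0 v = 0"
  by (simp add: poly_endo_def)

lemma poly_endo_pCons: "poly_endo T (pCons a p) v = scale a v + T (poly_endo T p v)"
  using endo_zero[OF T V] by (cases "p = 0 \<and> a = 0") (auto simp: poly_endo_def)

lemma poly_endo_in: "v \<in> V \<Longrightarrow> poly_endo T p v \<in> V"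
  by (induction p) (auto simp: poly_endo_0 poly_endo_pCons subspace_0[OF V]
      intro!: subspace_add[OF V] subspace_scale[OF V] endo_in[OF T])

lemma poly_endo_add: "v \<in> V \<Longrightarrow> poly_endo T (p + q) v = poly_endo T p v + poly_endo T q v"
  by (induction p q rule: poly_induct2)
    (auto simp: poly_endo_0 poly_endo_pCons poly_endo_in endo_add[OF T] algebra_simps)

lemma poly_endo_smult: "v \<in> V \<Longrightarrow> poly_endo T (smult c p) v = scale c (poly_endo T p v)"
  by (induction p) (auto simp: poly_endo_0 poly_endo_pCons poly_endo_in endo_scale[OF T] algebra_simps)

lemma poly_endo_monom: "poly_endo T (monom 1 n) v = (T ^^ n) v"
  by (induction n) (auto simp: poly_endo_0 poly_endo_pCons monom_0 monom_Suc endo_zero[OF T V])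

lemma poly_endo_commute:
  assumes R: "endo V R" and comm: "\<And>v. v \<in> V \<Longrightarrow> R (T v) = T (R v)" and v: "v \<in> V"
  shows "poly_endo T p (R v) = R (poly_endo T p v)"
  using v
  by (induction p) (auto simp: poly_endo_0 poly_endo_pCons endo_zero[OF R V] comm
      endo_add[OF R] endo_scale[OF R] subspace_scale[OF V] poly_endo_in endo_in[OF T])

text \<open>The linear factor is applied to the vector first. If the product annihilates
  \<open>v\<close>, then \<open>p\<close>, of smaller degree, annihilates \<open>T v - l v\<close>,
  which drives the induction on the degree in \<open>gen_eig_direct_sum\<close>.\<close>

lemma poly_endo_linear_factor:
  assumes v: "v \<in> V"
  shows "poly_endo T ([:- l, 1:] * p) v = poly_endo T p (T v - scale l v)"
proof -
  have "[:- l, 1:] * p = pCons 0 p + smult (- l) p" by simp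
  then have "poly_endo T ([:- l, 1:] * p) v = T (poly_endo T p v) - scale l (poly_endo T p v)"
    by (simp only: poly_endo_add[OF v] poly_endo_smult[OF v] poly_endo_pCons) simp
  also have "\<dots> = poly_endo T p (T v - scale l v)"
    by (rule poly_endo_commute[symmetric, OF endo_shift[OF V T] _ v])
      (simp add: endo_diff[OF T V] endo_scale[OF T] endo_in[OF T] subspace_scale[OF V])
  finally show ?thesis .
qed

text \<open>The vectors \<open>v\<close>, \<open>T v\<close>, \<open>T (T v)\<close>, ... cannot
  stay independent, and a dependence among them is a polynomial that kills \<open>v\<close>. Working
  with one vector at a time avoids determinants and the characteristic polynomial.\<close>

lemma annihilating_poly:
  assumes fd: "finite_dim scale V" and v: "v \<in> V"
  obtains p where "p \<noteq> 0" "poly_endo T p v = 0"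
proof -
  define W where "W n = span ((\<lambda>i. (T ^^ i) v) ` {..<n})" for n :: nat
  have TV: "(T ^^ n) v \<in> V" for n using endo_in[OF endo_funpow[OF T] v] .
  obtain n where n: "(T ^^ n) v \<in> W n"
  proof (rule ccontr)
    assume "\<not> thesis"
    then have notin: "(T ^^ n) v \<notin> W n" for n using that by blast
    have ind: "independent ((\<lambda>i. (T ^^ i) v) ` {..<n}) \<and> card ((\<lambda>i. (T ^^ i) v) ` {..<n}) = n" for n
    proof (induction n)
      case (Suc n)
      have "(T ^^ n) v \<notin> (\<lambda>i. (T ^^ i) v) ` {..<n}"
        using notin[of n] unfolding W_def by (rule contrapos_nn) (rule span_base)
      then show ?case
        using Suc notin[of n] by (simp add: lessThan_Suc independent_insert W_def)
    qed (simp add: independent_empty)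
    obtain S where S: "finite S" "span S = V" using fd by (auto simp: finite_dim_def)
    have "card ((\<lambda>i. (T ^^ i) v) ` {..<Suc (card S)}) \<le> card S"
      using independent_span_bound[OF S(1), of "(\<lambda>i. (T ^^ i) v) ` {..<Suc (card S)}"]
        ind[of "Suc (card S)"] S(2) TV by blast
    then show False using ind[of "Suc (card S)"] by simp
  qed
  have "\<exists>q. (q = 0 \<or> degree q < n) \<and> poly_endo T q v = w" if "w \<in> W n" for w
    using that unfolding W_def
  proof (induction rule: span_induct_alt)
    case base
    then show ?case using poly_endo_0 by blast
  next
    case (step c x y)
    then obtain q i where q: "q = 0 \<or> degree q < n" "poly_endo T q v = y"
      and i: "i < n" "x = (T ^^ i) v" by auto
    have "poly_endo T (smult c (monom 1 i) + q) v = scale c x + y"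
      using q i by (simp add: poly_endo_add poly_endo_smult poly_endo_monom v)
    moreover have "degree (smult c (monom 1 i) + q) < n"
      using q(1) i(1) by (intro degree_add_less)
          (auto simp: degree_monom_eq intro: le_less_trans[OF degree_smult_le])
    ultimately show ?case by blast
  qed
  then obtain q where q: "q = 0 \<or> degree q < n" "poly_endo T q v = (T ^^ n) v" using n by blast
  have "coeff (monom 1 n + smult (-1) q) n = 1" using q(1) by (auto simp: coeff_eq_0)
  then have "monom 1 n + smult (-1) q \<noteq> 0" by (metis coeff_0 zero_neq_one)
  moreover have "poly_endo T (monom 1 n + smult (-1) q) v = 0"
    using q(2) by (simp only: poly_endo_add[OF v] poly_endo_smult[OF v] poly_endo_monom) simp
  ultimately show ?thesis using that by blast
qed

end

text \<open>
  If \<open>T v - l v\<close> is a sum of generalized eigenvectors, then so is \<open>v\<close>: the terms for eigenvalues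
  other than \<open>l\<close> are in the image of \<open>T - l\<close>, which reduces to the case of a single term for \<open>l\<close>.
\<close>

lemma span_gen_eig_stepI:
  assumes T: "subspace V" "endo V T" and v: "v \<in> V"
    and w: "T v - scale l v \<in> span (\<Union>m. gen_eig V T m)"
  shows "v \<in> span (\<Union>m. gen_eig V T m)"
proof -
  let ?E = "span (\<Union>m. gen_eig V T m)"
  have EV: "?E \<subseteq> V" by (rule span_minimal[OF UN_least[OF gen_eig_subset] T(1)])
  have "\<exists>u\<in>?E. x - (T u - scale l u) \<in> gen_eig V T l" if "x \<in> ?E" for x
    using that
  proof (induction rule: span_induct_alt)
    case base
    then show ?case
      using span_zero endo_zero[OF T(2,1)] zero_in_gen_eig[OF T(1)] by (intro bexI[of _ 0]) auto
  next
    case (step c x y)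
    then obtain m u where x: "x \<in> gen_eig V T m"
      and u: "u \<in> ?E" "y - (T u - scale l u) \<in> gen_eig V T l" by blast
    have "\<exists>z\<in>?E. scale c x - (T z - scale l z) \<in> gen_eig V T l"
    proof (cases "m = l")
      case True
      then show ?thesis
        using x subspace_scale[OF subspace_gen_eig[OF T]] span_zero endo_zero[OF T(2,1)]
        by (intro bexI[of _ 0]) auto
    next
      case False
      obtain z where "z \<in> gen_eig V T m" "T z - scale l z = scale c x"
        using gen_eig_shift_surj[OF _ T False] subspace_scale[OF subspace_gen_eig[OF T] x] by blast
      then show ?thesis using zero_in_gen_eig[OF T(1)] by (intro bexI[of _ z]) (auto intro: span_base)
    qed
    then obtain z where z: "z \<in> ?E" "scale c x - (T z - scale l z) \<in> gen_eig V T l" by blast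
    have "z \<in> V" "u \<in> V" using z(1) u(1) EV by auto
    then have "scale c x + y - (T (z + u) - scale l (z + u)) =
        (scale c x - (T z - scale l z)) + (y - (T u - scale l u))"
      by (simp add: endo_add[OF T(2)] algebra_simps)
    also have "\<dots> \<in> gen_eig V T l"
      by (rule subspace_add[OF subspace_gen_eig[OF T] z(2) u(2)])
    finally show ?case using span_add[OF z(1) u(1)] by blast
  qed
  then obtain u where u: "u \<in> ?E" "T v - scale l v - (T u - scale l u) \<in> gen_eig V T l"
    using w by blast
  have uV: "u \<in> V" using u(1) EV by blast
  have "T (v - u) - scale l (v - u) = T v - scale l v - (T u - scale l u)"
    by (simp add: endo_diff[OF T(2,1) v uV] algebra_simps)
  then have "v - u \<in> gen_eig V T l"
    using gen_eig_stepI[of "v - u" V T l] u(2) subspace_diff[OF T(1) v uV] by simp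
  then have "v - u \<in> ?E" by (intro span_base UN_I) auto
  from span_add[OF this u(1)] show ?thesis by simp
qed

end

text \<open>An annihilating polynomial of \<open>v\<close> has a root \<open>l\<close>, and the
  cofactor annihilates \<open>T v - l v\<close>. By induction on the degree that vector is a sum of
  generalized eigenvectors, and then so is \<open>v\<close>. The lemma stands outside the locale
  because it restricts the type of scalars.\<close>

lemma gen_eig_direct_sum:
  fixes scale :: "'f::alg_closed_field \<Rightarrow> 'v::ab_group_add \<Rightarrow> 'v"
  assumes "vspace scale" and fd: "finite_dim scale V" and T: "vspace.endo scale V T"
  shows "is_direct_sum scale V UNIV (vspace.gen_eig scale V T)"
proof -
  interpret vspace scale by fact
  note V = finite_dim_imp_subspace[OF fd]
  let ?E = "span (\<Union>m. gen_eig V T m)"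
  have "v \<in> ?E" if "p \<noteq> 0" "poly_endo T p v = 0" "v \<in> V" for p v
    using that
  proof (induction "degree p" arbitrary: p v)
    case 0
    then obtain a where "p = [:a:]" "a \<noteq> 0" by (metis degree_eq_zeroE pCons_0_0)
    then have "v = 0"
      using 0 endo_zero[OF T V] by (simp add: poly_endo_pCons[OF V T] poly_endo_0[OF V T])
    then show ?case using span_zero by simp
  next
    case (Suc d)
    then obtain l where "poly p l = 0" using alg_closed_imp_poly_has_root[of p] by auto
    then obtain q where q: "p = [:- l, 1:] * q" by (auto simp: poly_eq_0_iff_dvd dvd_def)
    have "q \<noteq> 0" using Suc q by auto
    then have "degree p = Suc (degree q)" unfolding q by (subst degree_mult_eq) auto
    then have "T v - scale l v \<in> ?E"
      using Suc q \<open>q \<noteq> 0\<close> poly_endo_linear_factor[OF V T] endo_in[OF endo_shift[OF V T]]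
      by (intro Suc.hyps(1)[of q]) auto
    then show ?case using span_gen_eig_stepI[OF V T] Suc by blast
  qed
  then have "V \<subseteq> ?E" using annihilating_poly[OF V T fd] by blast
  then show ?thesis
    using V subspace_gen_eig[OF V T] gen_eig_subset gen_eig_independent[OF V T]
    by (intro is_direct_sumI) auto
qed

section \<open>Injective and locally nilpotent endomorphisms\<close>

context vspace
begin

lemma endo_inj_imp_surj:
  assumes fd: "finite_dim scale V" and f: "endo V f" and inj: "\<And>x. x \<in> V \<Longrightarrow> f x = 0 \<Longrightarrow> x = 0"
    and v: "v \<in> V"
  shows "\<exists>u\<in>V. f u = v"
proof -
  note V = finite_dim_imp_subspace[OF fd]
  obtain B where B: "finite B" "independent B" "span B = V" using finite_dim_basis[OF fd] .
  have BV: "b \<in> V" if "b \<in> B" for b using that B(3) span_base by blast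
  have lin: "f (\<Sum>b\<in>B. scale (g b) b) = (\<Sum>b\<in>B. scale (g b) (f b))" for g
    using endo_sum[OF f V, of B "\<lambda>b. scale (g b) b"] endo_scale[OF f BV] subspace_scale[OF V BV]
    by simp
  have injB: "inj_on f B"
  proof (rule inj_onI)
    fix a b assume ab: "a \<in> B" "b \<in> B" "f a = f b"
    then have "f (a - b) = 0" using endo_diff[OF f V BV BV] by simp
    then show "a = b" using inj[of "a - b"] subspace_diff[OF V BV BV] ab by simp
  qed
  have "independent (f ` B)"
  proof (rule independent_if_scalars_zero)
    show "finite (f ` B)" using B(1) by simp
    fix g x assume "(\<Sum>x\<in>f ` B. scale (g x) x) = 0" and x: "x \<in> f ` B"
    then have "f (\<Sum>b\<in>B. scale (g (f b)) b) = 0"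
      using lin[of "\<lambda>b. g (f b)"] by (simp add: sum.reindex[OF injB])
    then have "(\<Sum>b\<in>B. scale (g (f b)) b) = 0"
      by (rule inj[rotated]) (intro subspace_sum[OF V] subspace_scale[OF V] BV)
    then show "g x = 0"
      using independentD[OF B(2,1) order_refl, of "\<lambda>b. g (f b)"] x by auto
  qed
  moreover have "f ` B \<subseteq> V" using endo_in[OF f BV] by blast
  moreover have "dim V \<le> card (f ` B)"
    using card_image[OF injB] dim_span_eq_card_independent[OF B(2)] B(3) by simp
  ultimately have "span (f ` B) = V" by (rule independent_card_dim_span[OF fd])
  moreover have "span (f ` B) \<subseteq> f ` V"
    using BV by (intro span_minimal subspace_endo_image[OF f V order_refl V]) auto
  ultimately show ?thesis using v by auto
qed

text \<open>The exponents of the finitely many basis vectors add up to a common one.\<close>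

lemma uniformly_nilpotent:
  assumes fd: "finite_dim scale V" and f: "endo V f" and nil: "\<And>v. v \<in> V \<Longrightarrow> \<exists>n. (f ^^ n) v = 0"
  shows "\<exists>n. \<forall>v\<in>V. (f ^^ n) v = 0"
proof -
  note V = finite_dim_imp_subspace[OF fd]
  obtain B where B: "finite B" "independent B" "span B = V" using finite_dim_basis[OF fd] .
  have BV: "B \<subseteq> V" using B(3) span_base by blast
  obtain e where e: "\<And>b. b \<in> B \<Longrightarrow> (f ^^ e b) b = 0" using nil BV by (metis subsetD)
  have "(f ^^ (\<Sum>b\<in>B. e b)) b = 0" if b: "b \<in> B" for b
  proof -
    have "(\<Sum>b\<in>B. e b) = (\<Sum>b\<in>B - {b}. e b) + e b" using b B(1) by (simp add: sum.remove)
    then have "(f ^^ (\<Sum>b\<in>B. e b)) b = (f ^^ (\<Sum>b\<in>B - {b}. e b)) ((f ^^ e b) b)"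
      by (simp add: funpow_add)
    then show ?thesis using e[OF b] endo_zero[OF endo_funpow[OF f] V] by simp
  qed
  then have "\<forall>v\<in>V. (f ^^ (\<Sum>b\<in>B. e b)) v = 0"
    using endo_eq_0_on_span[OF endo_funpow[OF f] V BV] B(3) by blast
  then show ?thesis ..
qed

end

section \<open>Lie algebras\<close>

sublocale lie_algebra \<subseteq> vspace scale
  by unfold_locales

context lie_algebra
begin

lemmas L_zero = subspace_0[OF subspace_L]
  and L_add = subspace_add[OF subspace_L]
  and L_scale = subspace_scale[OF subspace_L]
  and L_diff = subspace_diff[OF subspace_L]

lemma endo_ad: "x \<in> L \<Longrightarrow> endo L (br x)"
  by (intro endoI br_closed br_add_right br_scale_right)

lemma endo_ad_left: "x \<in> L \<Longrightarrow> endo L (\<lambda>y. br y x)"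
  by (intro endoI br_closed br_add_left br_scale_left)

lemma br_zero: "x \<in> L \<Longrightarrow> br x 0 = 0" "x \<in> L \<Longrightarrow> br 0 x = 0"
  using endo_zero[OF endo_ad subspace_L] endo_zero[OF endo_ad_left subspace_L] by auto

lemma br_diff_right: "\<lbrakk>x \<in> L; y \<in> L; z \<in> L\<rbrakk> \<Longrightarrow> br x (y - z) = br x y - br x z"
  by (rule endo_diff[OF endo_ad subspace_L])

lemma br_diff_left: "\<lbrakk>x \<in> L; y \<in> L; z \<in> L\<rbrakk> \<Longrightarrow> br (x - y) z = br x z - br y z"
  by (rule endo_diff[OF endo_ad_left subspace_L])

lemma br_anti:
  assumes "x \<in> L" "y \<in> L" shows "br x y = - br y x"
proof -
  have "0 = br (x + y) (x + y)" using br_self[OF L_add[OF assms]] by simp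
  also have "\<dots> = br x x + br x y + (br y x + br y y)"
    using assms by (simp add: br_add_left br_add_right L_add)
  also have "\<dots> = br x y + br y x" using assms by (simp add: br_self)
  finally show ?thesis by (simp add: eq_neg_iff_add_eq_0)
qed

text \<open>The Jacobi identity in the form in which it is used below: ad x is a derivation.\<close>

lemma br_leibniz:
  assumes "x \<in> L" "y \<in> L" "z \<in> L"
  shows "br x (br y z) = br (br x y) z + br y (br x z)"
proof -
  have "br y (br z x) = - br y (br x z)"
    using br_anti[of z x] br_scale_right[of y "br x z" "-1"] assms br_closed by simp
  moreover have "br z (br x y) = - br (br x y) z"
    using br_anti assms br_closed by blast
  ultimately have "br x (br y z) - br y (br x z) - br (br x y) z = 0"
    using jacobi[OF assms] by simp
  then show ?thesis by (simp add: algebra_simps)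
qed

lemma lie_ideal_D:
  assumes "lie_ideal scale br L I"
  shows "subspace I" "I \<subseteq> L" "\<And>x y. \<lbrakk>x \<in> L; y \<in> I\<rbrakk> \<Longrightarrow> br x y \<in> I"
    "\<And>x y. \<lbrakk>x \<in> I; y \<in> L\<rbrakk> \<Longrightarrow> br x y \<in> I"
proof -
  show *: "subspace I" "I \<subseteq> L" "\<And>x y. \<lbrakk>x \<in> L; y \<in> I\<rbrakk> \<Longrightarrow> br x y \<in> I"
    using assms by (auto simp: lie_ideal_def)
  show "br x y \<in> I" if "x \<in> I" "y \<in> L" for x y
    using that * br_anti[of x y] subspace_neg[OF *(1)] by auto
qed

lemma lie_ideal_L: "lie_ideal scale br L L"
  by (auto simp: lie_ideal_def subspace_L br_closed)

lemma lie_ideal_0: "lie_ideal scale br L {0}"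
  using br_zero L_zero by (auto simp: lie_ideal_def)

lemma lie_ideal_inter:
  "lie_ideal scale br L I \<Longrightarrow> lie_ideal scale br L J \<Longrightarrow> lie_ideal scale br L (I \<inter> J)"
  by (auto simp: lie_ideal_def subspace_inter)

lemma lie_ideal_sum:
  assumes I: "lie_ideal scale br L I" and J: "lie_ideal scale br L J"
  shows "lie_ideal scale br L {x + y | x y. x \<in> I \<and> y \<in> J}"
proof -
  note I = lie_ideal_D[OF I] and J = lie_ideal_D[OF J]
  have "br x (y + z) \<in> {x + y | x y. x \<in> I \<and> y \<in> J}" if "x \<in> L" "y \<in> I" "z \<in> J" for x y z
  proof -
    have "br x (y + z) = br x y + br x z" using that I(2) J(2) by (intro br_add_right) auto
    then show ?thesis using I(3) J(3) that by blast
  qed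
  moreover have "{x + y | x y. x \<in> I \<and> y \<in> J} \<subseteq> L" using I(2) J(2) by (auto intro!: L_add)
  ultimately show ?thesis
    unfolding lie_ideal_def using subspace_sums[OF I(1) J(1)] by fastforce
qed

lemma lie_ideal_span:
  assumes S: "S \<subseteq> L" and br: "\<And>x y. x \<in> L \<Longrightarrow> y \<in> S \<Longrightarrow> br x y \<in> span S"
  shows "lie_ideal scale br L (span S)"
proof -
  have "y \<in> L \<and> br x y \<in> span S" if x: "x \<in> L" and y: "y \<in> span S" for x y
    using y
  proof (induction rule: span_induct_alt)
    case base
    then show ?case using L_zero br_zero(1)[OF x] span_zero by simp
  next
    case (step c s y)
    then have s: "s \<in> L" "scale c s \<in> L" using S L_scale by auto
    have "br x (scale c s + y) = scale c (br x s) + br x y"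
      using s x step by (simp add: br_add_right br_scale_right)
    then show ?case
      using step s br[OF x] by (auto intro: L_add span_add span_scale)
  qed
  then show ?thesis
    unfolding lie_ideal_def using span_minimal[OF S subspace_L] by auto
qed

lemma lie_prod_eq_0_iff: "lie_prod scale br V W = {0} \<longleftrightarrow> (\<forall>x\<in>V. \<forall>y\<in>W. br x y = 0)"
proof
  assume *: "lie_prod scale br V W = {0}"
  show "\<forall>x\<in>V. \<forall>y\<in>W. br x y = 0"
  proof (intro ballI)
    fix x y assume "x \<in> V" "y \<in> W"
    then have "br x y \<in> lie_prod scale br V W"
      unfolding lie_prod_def by (intro span_base) blast
    then show "br x y = 0" using * by blast
  qed
next
  assume "\<forall>x\<in>V. \<forall>y\<in>W. br x y = 0"
  then have "lie_prod scale br V W \<subseteq> {0}"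
    unfolding lie_prod_def by (intro span_minimal subspace_single_0) auto
  moreover have "0 \<in> lie_prod scale br V W" unfolding lie_prod_def by (rule span_zero)
  ultimately show "lie_prod scale br V W = {0}" by blast
qed

lemma lie_ideal_prod:
  assumes I: "lie_ideal scale br L I" and J: "lie_ideal scale br L J"
  shows "lie_ideal scale br L (lie_prod scale br I J)"
  unfolding lie_prod_def
proof (rule lie_ideal_span)
  note I = lie_ideal_D[OF I] and J = lie_ideal_D[OF J]
  show "{br x y |x y. x \<in> I \<and> y \<in> J} \<subseteq> L" using I(2) J(2) br_closed by blast
  fix z w assume z: "z \<in> L" and "w \<in> {br x y |x y. x \<in> I \<and> y \<in> J}"
  then obtain x y where xy: "x \<in> I" "y \<in> J" "w = br x y" by blast
  then have "br z w = br (br z x) y + br x (br z y)" using z I(2) J(2) br_leibniz by blast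
  also have "\<dots> \<in> span {br x y |x y. x \<in> I \<and> y \<in> J}"
    using xy z I(3) J(3) by (intro span_add span_base) blast+
  finally show "br z w \<in> span {br x y |x y. x \<in> I \<and> y \<in> J}" .
qed

lemma abelian_ideal_eq_0:
  assumes ss: "lie_semisimple scale br L" and I: "lie_ideal scale br L I"
    and ab: "\<And>x y. x \<in> I \<Longrightarrow> y \<in> I \<Longrightarrow> br x y = 0"
  shows "I = {0}"
proof -
  have "derived_series scale br I 1 = {0}" using ab lie_prod_eq_0_iff by simp
  then have "lie_solvable scale br I" unfolding lie_solvable_def by blast
  then show ?thesis using ss I unfolding lie_semisimple_def by blast
qed

definition centralizer :: "'v set \<Rightarrow> 'v set" where
  "centralizer I = {x \<in> L. \<forall>y\<in>I. br x y = 0}"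

lemma lie_ideal_centralizer:
  assumes "lie_ideal scale br L I"
  shows "lie_ideal scale br L (centralizer I)"
proof -
  note I = lie_ideal_D[OF assms]
  have "subspace (centralizer I)"
    using I(2) by (intro subspaceI)
      (auto simp: centralizer_def L_zero L_add L_scale br_zero br_add_left br_scale_left subset_iff)
  moreover have "br x c \<in> centralizer I" if x: "x \<in> L" and c: "c \<in> centralizer I" for x c
  proof -
    have "br (br x c) y = 0" if y: "y \<in> I" for y
      using br_leibniz[of x c y] x y c I(2) I(3)[OF x y] br_zero(1)[OF x]
      by (auto simp: centralizer_def)
    then show ?thesis using x c br_closed by (auto simp: centralizer_def)
  qed
  ultimately show ?thesis unfolding lie_ideal_def by (auto simp: centralizer_def)
qed

text \<open>The intersection is an abelian ideal.\<close>

lemma inter_centralizer: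
  assumes "lie_semisimple scale br L" "lie_ideal scale br L I"
  shows "I \<inter> centralizer I = {0}"
  by (rule abelian_ideal_eq_0[OF assms(1) lie_ideal_inter[OF assms(2) lie_ideal_centralizer[OF assms(2)]]])
    (auto simp: centralizer_def)

subsection \<open>Engel's theorem\<close>

text \<open>Engel's theorem for the action of a subalgebra \<open>M\<close> on the quotient of
  \<open>W\<close> by \<open>U\<close>: some nonzero class is killed by all of \<open>M\<close>. The
  pair of subspaces stands for the quotient, so the induction can also be applied to a subalgebra
  \<open>N\<close> acting on \<open>M\<close> modulo \<open>N\<close>.\<close>

lemma engel:
  assumes fd: "finite_dim scale L"
    and "subspace M" "M \<subseteq> L" "\<And>x y. x \<in> M \<Longrightarrow> y \<in> M \<Longrightarrow> br x y \<in> M"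
    and "\<And>x v. x \<in> M \<Longrightarrow> v \<in> L \<Longrightarrow> \<exists>n. (br x ^^ n) v = 0"
    and "subspace U" "subspace W" "U \<subset> W" "W \<subseteq> L"
    and "\<And>x u. x \<in> M \<Longrightarrow> u \<in> U \<Longrightarrow> br x u \<in> U"
    and "\<And>x w. x \<in> M \<Longrightarrow> w \<in> W \<Longrightarrow> br x w \<in> W"
  shows "\<exists>w\<in>W - U. \<forall>x\<in>M. br x w \<in> U"
  using assms(2-)
proof (induction "dim M" arbitrary: M U W rule: less_induct)
  case less
  note M = less.prems(1-3) and nil = less.prems(4) and U = less.prems(5) and W = less.prems(6)
    and UW = less.prems(7) and WL = less.prems(8) and brU = less.prems(9) and brW = less.prems(10)
  show ?case
  proof (cases "M = {0}")
    case True
    obtain w where w: "w \<in> W - U" using UW by blast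
    then have "br 0 w \<in> U" using WL br_zero(2)[of w] subspace_0[OF U] by auto
    then show ?thesis using True w by blast
  next
    case False
    have fdM: "finite_dim scale M" using finite_dim_subspace[OF fd M(1,2)] .
    define Q where "Q N \<longleftrightarrow> subspace N \<and> N \<subset> M \<and> (\<forall>x\<in>N. \<forall>y\<in>N. br x y \<in> N)" for N
    have dimQ: "dim N < dim M" if "Q N" for N using that dim_less_dim[OF fdM] unfolding Q_def by blast
    have "Q {0}" using False subspace_0[OF M(1)] br_zero L_zero by (auto simp: Q_def)
    then obtain N where N: "Q N" and max: "\<And>N'. Q N' \<Longrightarrow> dim N' \<le> dim N"
      using ex_has_greatest_nat[of Q "{0}" dim "dim M"] dimQ less_imp_le by metis
    have N': "subspace N" "N \<subset> M" "N \<subseteq> L" "\<And>x y. x \<in> N \<Longrightarrow> y \<in> N \<Longrightarrow> br x y \<in> N"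
      using N M(2) by (auto simp: Q_def)
    have nilN: "\<And>x v. x \<in> N \<Longrightarrow> v \<in> L \<Longrightarrow> \<exists>n. (br x ^^ n) v = 0" using nil N'(2) by blast
    \<comment> \<open>Induction for \<open>N\<close> acting on \<open>M\<close> modulo
      \<open>N\<close>: the resulting \<open>y\<close> normalizes \<open>N\<close> without belonging
      to it.\<close>
    have "\<exists>y\<in>M - N. \<forall>x\<in>N. br x y \<in> N"
      using N' M nilN by (intro less.hyps[OF dimQ[OF N]]) blast+
    then obtain y where y: "y \<in> M" "y \<notin> N" "\<And>x. x \<in> N \<Longrightarrow> br x y \<in> N" by blast
    \<comment> \<open>Adjoining \<open>y\<close> to \<open>N\<close> gives a subalgebra properly
      containing \<open>N\<close>; by maximality of \<open>N\<close> it is all of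
      \<open>M\<close>.\<close>
    define N1 where "N1 = {x + z | x z. x \<in> N \<and> z \<in> span {y}}"
    have sN1: "subspace N1" unfolding N1_def by (intro subspace_sums N'(1) subspace_span)
    have N1_iff: "m \<in> N1 \<longleftrightarrow> (\<exists>x\<in>N. \<exists>c. m = x + scale c y)" for m
      by (auto simp: N1_def span_singleton)
    have N1M: "N1 \<subseteq> M"
      using N'(2) y(1) by (auto simp: N1_iff intro!: subspace_add[OF M(1)] subspace_scale[OF M(1)])
    have NN1: "N \<subseteq> N1" unfolding N1_def using span_zero by force
    have "y \<in> N1" using subspace_0[OF N'(1)] by (auto simp: N1_iff intro!: bexI[of _ 0] exI[of _ 1])
    then have "N \<noteq> N1" using y(2) by blast
    then have "dim N < dim N1"
      using dim_less_dim[OF finite_dim_subspace[OF fd sN1] N'(1) NN1] N1M M(2) by blast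
    moreover have "br a b \<in> N1" if ab: "a \<in> N1" "b \<in> N1" for a b
    proof -
      obtain u c v d where u: "u \<in> N" "a = u + scale c y" and v: "v \<in> N" "b = v + scale d y"
        using ab by (auto simp: N1_iff)
      have in_L: "u \<in> L" "v \<in> L" "y \<in> L" using u v y N'(3) M(2) by auto
      have "br y v = - br v y" using br_anti in_L by blast
      then have "br a b = br u v + scale d (br u y) + scale c (- br v y)"
        using in_L by (simp add: u v br_add_left br_add_right br_scale_left br_scale_right br_self
            L_add L_scale br_closed)
      also have "\<dots> \<in> N"
        using u v y N'(4) by (intro subspace_add[OF N'(1)] subspace_scale[OF N'(1)] subspace_neg[OF N'(1)]) auto
      finally show ?thesis using NN1 by blast
    qed
    ultimately have "N1 = M" using max[of N1] sN1 N1M unfolding Q_def by (metis not_le psubsetI)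
    then have M_iff: "m \<in> M \<longleftrightarrow> (\<exists>x\<in>N. \<exists>c. m = x + scale c y)" for m using N1_iff by simp
    have "\<exists>w\<in>W - U. \<forall>x\<in>N. br x w \<in> U"
      using N' nilN U W UW WL brU brW by (intro less.hyps[OF dimQ[OF N]]) blast+
    then obtain w where w: "w \<in> W" "w \<notin> U" "\<And>x. x \<in> N \<Longrightarrow> br x w \<in> U" by blast
    have yL: "y \<in> L" using y(1) M(2) by blast
    \<comment> \<open>The vectors of \<open>W\<close> that \<open>N\<close> sends into
      \<open>U\<close> are stable under ad y, since \<open>y\<close> normalizes
      \<open>N\<close>.\<close>
    have pow: "(br y ^^ k) w \<in> W \<and> (\<forall>x\<in>N. br x ((br y ^^ k) w) \<in> U)" for k
    proof (induction k)
      case 0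
      then show ?case using w by simp
    next
      case (Suc k)
      let ?u = "(br y ^^ k) w"
      have uL: "?u \<in> L" using Suc WL by blast
      have "br x (br y ?u) \<in> U" if x: "x \<in> N" for x
      proof -
        have "br x (br y ?u) = br (br x y) ?u + br y (br x ?u)"
          using br_leibniz x N'(3) yL uL by blast
        then show ?thesis
          using Suc x y brU by (auto intro!: subspace_add[OF U])
      qed
      then show ?case using Suc brW y(1) by simp
    qed
    obtain n where "(br y ^^ n) w = 0" using nil y(1) w(1) WL by blast
    then have ex: "\<exists>n. (br y ^^ n) w \<in> U" using subspace_0[OF U] by metis
    \<comment> \<open>The last power of ad y that keeps \<open>w\<close> outside \<open>U\<close>,
      the one before \<open>k\<close>, gives a vector sent into \<open>U\<close> by \<open>N\<close>
      and by \<open>y\<close>, hence by \<open>M\<close>.\<close>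
    define k where "k = (LEAST n. (br y ^^ n) w \<in> U)"
    have k: "(br y ^^ k) w \<in> U" unfolding k_def by (rule LeastI_ex[OF ex])
    have "k \<noteq> 0" using k w(2) by (intro notI) simp
    then obtain j where j: "k = Suc j" by (cases k) auto
    have nj: "(br y ^^ j) w \<notin> U"
      using not_less_Least[of j "\<lambda>n. (br y ^^ n) w \<in> U"] j k_def by simp
    let ?u = "(br y ^^ j) w"
    have uL: "?u \<in> L" using pow[of j] WL by blast
    have "br x ?u \<in> U" if x: "x \<in> M" for x
    proof -
      obtain z c where z: "z \<in> N" "x = z + scale c y" using x M_iff by blast
      have "z \<in> L" using z(1) N'(3) by blast
      then have "br x ?u = br z ?u + scale c (br y ?u)"
        unfolding z(2) using uL yL by (simp only: br_add_left br_scale_left L_scale)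
      then show ?thesis
        using pow[of j] z(1) k j by (auto intro!: subspace_add[OF U] subspace_scale[OF U])
    qed
    then show ?thesis using nj pow[of j] by blast
  qed
qed

text \<open>Engel's theorem for \<open>K\<close> acting on itself produces a nonzero element of the
  centre of \<open>K\<close>, whereas \<open>K\<close> meets its centralizer trivially.\<close>

lemma ad_nilpotent_ideal_eq_0:
  assumes fd: "finite_dim scale L" and ss: "lie_semisimple scale br L"
    and K: "lie_ideal scale br L K"
    and nil: "\<And>x v. x \<in> K \<Longrightarrow> v \<in> L \<Longrightarrow> \<exists>n. (br x ^^ n) v = 0"
  shows "K = {0}"
proof (rule ccontr)
  assume "K \<noteq> {0}"
  note K' = lie_ideal_D[OF K]
  have "\<exists>w\<in>K - {0}. \<forall>x\<in>K. br x w \<in> {0}"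
    using K' nil \<open>K \<noteq> {0}\<close> subspace_0[OF K'(1)] br_zero(1)
    by (intro engel[OF fd]) (auto simp: subset_iff)
  then obtain w where w: "w \<in> K" "w \<noteq> 0" "\<And>x. x \<in> K \<Longrightarrow> br x w = 0" by auto
  then have "w \<in> K \<inter> centralizer K"
    using K'(2) br_anti[of w] by (auto simp: centralizer_def subset_iff)
  then show False using inter_centralizer[OF ss K] w(2) by blast
qed

subsection \<open>The Killing form\<close>

definition killing :: "'v \<Rightarrow> 'v \<Rightarrow> 'f" where
  "killing x y = trace_on L (\<lambda>v. br x (br y v))"

context
  assumes fd: "finite_dim scale L"
begin

lemma endo_ad_comp: "x \<in> L \<Longrightarrow> y \<in> L \<Longrightarrow> endo L (\<lambda>v. br x (br y v))"
  by (rule endo_comp[OF endo_ad endo_ad])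

lemma killing_commute: "x \<in> L \<Longrightarrow> y \<in> L \<Longrightarrow> killing x y = killing y x"
  unfolding killing_def by (rule trace_on_commute[OF fd endo_ad endo_ad])

lemma killing_add_left:
  assumes "x \<in> L" "y \<in> L" "z \<in> L"
  shows "killing (x + y) z = killing x z + killing y z"
  unfolding killing_def
  by (subst trace_on_plus[OF fd endo_ad_comp endo_ad_comp, symmetric])
    (use assms in \<open>auto intro!: trace_on_cong[OF fd] endo_plus[OF subspace_L] endo_ad_comp L_add
      simp: br_add_left br_closed\<close>)

lemma killing_scale_left:
  assumes "x \<in> L" "z \<in> L"
  shows "killing (scale c x) z = c * killing x z"
  unfolding killing_def
  by (subst trace_on_smult[OF fd endo_ad_comp, symmetric])
    (use assms in \<open>auto intro!: trace_on_cong[OF fd] endo_smult[OF subspace_L] endo_ad_comp L_scale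
      simp: br_scale_left br_closed\<close>)

text \<open>Write ad of a bracket as a commutator; the two sides then differ by moving ad z
  cyclically under the trace.\<close>

lemma killing_invariant:
  assumes "x \<in> L" "y \<in> L" "z \<in> L"
  shows "killing (br z x) y = killing x (br y z)"
proof -
  have e: "endo L (\<lambda>v. br a (br b (br c v)))" if "a \<in> L" "b \<in> L" "c \<in> L" for a b c
    using that by (intro endo_comp[OF endo_ad endo_ad_comp])
  have "killing (br z x) y = trace_on L (\<lambda>v. br z (br x (br y v)) - br x (br z (br y v)))"
    unfolding killing_def using assms
    by (intro trace_on_cong[OF fd] endo_ad_comp endo_minus[OF subspace_L] e)
      (auto simp: br_closed br_leibniz[of z x])
  also have "\<dots> = trace_on L (\<lambda>v. br x (br y (br z v))) - trace_on L (\<lambda>v. br x (br z (br y v)))"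
    using assms
    by (simp add: trace_on_minus[OF fd] e trace_on_commute[OF fd endo_ad endo_ad_comp])
  also have "\<dots> = trace_on L (\<lambda>v. br x (br y (br z v)) - br x (br z (br y v)))"
    using assms by (simp add: trace_on_minus[OF fd] e)
  also have "\<dots> = killing x (br y z)"
    unfolding killing_def using assms
    by (intro trace_on_cong[OF fd] endo_ad_comp endo_minus[OF subspace_L] e)
      (auto simp: br_closed br_leibniz[of y z] br_add_right)
  finally show ?thesis .
qed

lemma lie_ideal_killing_orthogonal:
  assumes "lie_ideal scale br L I"
  shows "lie_ideal scale br L {x \<in> L. \<forall>y\<in>I. killing x y = 0}"
proof -
  note I = lie_ideal_D[OF assms]
  have 0: "killing 0 y = 0" if "y \<in> L" for y using killing_scale_left[of 0 y 0] L_zero that by simp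
  show ?thesis
    unfolding lie_ideal_def using I
    by (auto intro!: subspaceI simp: L_zero L_add L_scale br_closed 0 killing_add_left
        killing_scale_left killing_invariant subset_iff)
qed

end

subsection \<open>Weight spaces of a single element\<close>

text \<open>Since ad x is a derivation, \<open>ad x - (l + m)\<close> maps the bracket of
  \<open>u\<close> and \<open>w\<close> to the sum of the two brackets in which
  \<open>ad x - l\<close> is applied to \<open>u\<close> or \<open>ad x - m\<close> to
  \<open>w\<close>. A nested induction handles both terms.\<close>

lemma gen_eig_bracket:
  assumes x: "x \<in> L" and u: "u \<in> gen_eig L (br x) l" and w: "w \<in> gen_eig L (br x) m"
  shows "br u w \<in> gen_eig L (br x) (l + m)"
proof -
  note T = subspace_L endo_ad[OF x]
  have "\<forall>w\<in>gen_eig L (br x) m. br u w \<in> gen_eig L (br x) (l + m)"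
    using u T
  proof (induction rule: gen_eig_induct)
    case zero
    then show ?case using gen_eig_subset br_zero(2) zero_in_gen_eig[OF subspace_L] by fastforce
  next
    case (step u)
    show ?case
    proof
      fix w assume "w \<in> gen_eig L (br x) m"
      then show "br u w \<in> gen_eig L (br x) (l + m)" using T
      proof (induction rule: gen_eig_induct)
        case zero
        then show ?case using step(1) gen_eig_subset br_zero(1) zero_in_gen_eig[OF subspace_L]
          by fastforce
      next
        case (step w)
        have uw: "u \<in> L" "w \<in> L" using \<open>u \<in> _\<close> \<open>w \<in> _\<close> gen_eig_subset by auto
        have "br x (br u w) - scale (l + m) (br u w) =
            br (br x u - scale l u) w + br u (br x w - scale m w)"
          using uw x by (simp add: br_leibniz[of x u w] br_diff_left br_diff_right br_scale_left
              br_scale_right br_closed L_scale algebra_simps)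
        also have "\<dots> \<in> gen_eig L (br x) (l + m)"
          using step \<open>\<forall>w\<in>_. br (br x u - _) w \<in> _\<close>
          by (intro subspace_add[OF subspace_gen_eig[OF T]]) auto
        finally show ?case using gen_eig_stepI br_closed[OF uw] by blast
      qed
    qed
  qed
  then show ?thesis using w by blast
qed

text \<open>As \<open>x\<close> lies in \<open>K\<close>, ad x maps \<open>L\<close> into
  \<open>K\<close>. If \<open>br x v - scale l v\<close> is in \<open>K\<close> as well, then so is
  \<open>scale l v\<close>, and \<open>l\<close> can be divided out.\<close>

lemma gen_eig_subset_ideal:
  assumes K: "lie_ideal scale br L K" and x: "x \<in> K" and l: "l \<noteq> 0"
  shows "gen_eig L (br x) l \<subseteq> K"
proof
  note K' = lie_ideal_D[OF K]
  have xL: "x \<in> L" using x K'(2) by blast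
  fix v assume "v \<in> gen_eig L (br x) l"
  then show "v \<in> K" using subspace_L endo_ad[OF xL]
  proof (induction rule: gen_eig_induct)
    case zero
    then show ?case using subspace_0[OF K'(1)] .
  next
    case (step v)
    have "v \<in> L" using step(1) gen_eig_subset by blast
    then have "br x v - (br x v - scale l v) \<in> K" using step K'(4)[OF x] subspace_diff[OF K'(1)] by blast
    then have "scale l v \<in> K" by simp
    then have "scale (1 / l) (scale l v) \<in> K" by (rule subspace_scale[OF K'(1)])
    then show ?case using l by simp
  qed
qed

end

subsection \<open>Cartan's criterion\<close>

locale fd_lie_algebra = lie_algebra scale br L
  for scale :: "'f::{alg_closed_field, field_char_0} \<Rightarrow> 'v::ab_group_add \<Rightarrow> 'v"
    and br :: "'v \<Rightarrow> 'v \<Rightarrow> 'v" and L :: "'v set" +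
  assumes fd: "finite_dim scale L"
begin

text \<open>
  The derivation \<open>D\<close> acts on the generalized eigenspace of \<open>ad x\<close> for \<open>l\<close> as \<open>f l\<close>, where \<open>f\<close> is
  \<open>\<rat>\<close>-linear and rational-valued. It maps \<open>L\<close> into \<open>K\<close>, so \<open>ad u \<circ> D\<close> has trace zero for \<open>u\<close> in
  \<open>[K, K]\<close>. For \<open>u = x\<close> the trace is the sum of the \<open>l * f l\<close> over all eigenvalues, and applying
  \<open>f\<close> turns it into a sum of squares of rational numbers.
\<close>

lemma cartan_nilpotent:
  assumes K: "lie_ideal scale br L K"
    and kil: "\<And>x y. x \<in> K \<Longrightarrow> y \<in> K \<Longrightarrow> killing x y = 0"
    and x: "x \<in> K" "x \<in> lie_prod scale br K K" and v: "v \<in> L"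
  shows "\<exists>n. (br x ^^ n) v = 0"
proof -
  note K' = lie_ideal_D[OF K]
  have xL: "x \<in> L" using x(1) K'(2) by blast
  note T = subspace_L endo_ad[OF xL]
  interpret T: dsum scale L UNIV "gen_eig L (br x)"
    using gen_eig_direct_sum[OF _ fd endo_ad[OF xL]] vspace_axioms by unfold_locales
  have eig0: "gen_eig L (br x) l = {0}" if l: "l \<noteq> 0" for l
  proof (rule ccontr)
    assume "gen_eig L (br x) l \<noteq> {0}"
    then obtain v0 where v0: "v0 \<in> gen_eig L (br x) l" "v0 \<noteq> 0"
      using zero_in_gen_eig[OF subspace_L] by blast
    obtain f :: "'f \<Rightarrow> rat" where f: "\<And>x y. f (x + y) = f x + f y"
      "\<And>q x. f (of_rat q * x) = q * f x" "f l = 1"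
      using rat_linear_functional[OF l] by blast
    have f0: "f 0 = 0" using f(2)[of 0 0] by simp
    have fsum: "f (\<Sum>a\<in>A. g a) = (\<Sum>a\<in>A. f (g a))" for A and g :: "'v \<Rightarrow> 'f"
      by (induction A rule: infinite_finite_induct) (auto simp: f f0)
    \<comment> \<open>The rational values are embedded back into the field so that they can act as
      scalars.\<close>
    define c :: "'f \<Rightarrow> 'f" where "c m = of_rat (f m)" for m
    define D where "D = T.diag c"
    \<comment> \<open>The semisimple part of ad x.\<close>
    define S where "S = T.diag (\<lambda>m. m)"
    have D: "endo L D" and S: "endo L S" by (auto simp: D_def S_def T.endo_diag)
    have D_hom: "D u = scale (c m) u" and S_hom: "S u = scale m u" if "u \<in> gen_eig L (br x) m" for u m
      using T.diag_homogeneous[OF UNIV_I that] by (simp_all add: D_def S_def)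
    have eL: "gen_eig L (br x) m \<subseteq> L" for m by (rule gen_eig_subset)
    \<comment> \<open>Eigenvalues add under the bracket, and \<open>f\<close> is additive.\<close>
    have deriv: "D (br u w) = br (D u) w + br u (D w)" if "u \<in> L" "w \<in> L" for u w
    proof -
      have *: "D (br u w) = br (D u) w + br u (D w)" if "u \<in> gen_eig L (br x) a" "w \<in> L" for u a w
        using that(2)
      proof (induction rule: T.homogeneous_induct)
        case zero
        then show ?case using that eL endo_zero[OF D subspace_L] endo_in[OF D] br_zero(1) by force
      next
        case (add y z)
        have uL: "u \<in> L" using that eL by blast
        have "D u \<in> L" "D y \<in> L" "D z \<in> L" using endo_in[OF D] uL add by auto
        with add uL show ?case
          by (simp add: br_add_right br_closed endo_add[OF D] algebra_simps)
      next
        case (homogeneous b w)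
        have "u \<in> L" "w \<in> L" using that homogeneous eL by blast+
        then show ?case
          using D_hom[OF gen_eig_bracket[OF xL that(1) homogeneous(2)]] D_hom[OF that(1)]
            D_hom[OF homogeneous(2)]
          by (simp add: br_scale_left br_scale_right c_def f(1) of_rat_add scale_left_distrib)
      qed
      show ?thesis using \<open>u \<in> L\<close>
      proof (induction rule: T.homogeneous_induct)
        case zero
        then show ?case using that endo_zero[OF D subspace_L] endo_in[OF D] br_zero(2) by force
      next
        case (add y z)
        have "D w \<in> L" "D y \<in> L" "D z \<in> L" using endo_in[OF D] that add by auto
        with add that show ?case
          by (simp add: br_add_left br_closed endo_add[OF D] algebra_simps)
      next
        case (homogeneous b u)
        then show ?case using * that by blast
      qed
    qed
    \<comment> \<open>\<open>D\<close> vanishes on the space for the eigenvalue 0 because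
      \<open>f 0 = 0\<close>; the spaces for the other eigenvalues lie in \<open>K\<close>.\<close>
    have DK: "D u \<in> K" if "u \<in> L" for u
      using that
    proof (induction rule: T.homogeneous_induct)
      case zero
      then show ?case using endo_zero[OF D subspace_L] subspace_0[OF K'(1)] by simp
    next
      case (add y z)
      then show ?case using endo_add[OF D] subspace_add[OF K'(1)] by simp
    next
      case (homogeneous m u)
      then show ?case
        using D_hom gen_eig_subset_ideal[OF K x(1), of m] subspace_scale[OF K'(1)]
          subspace_0[OF K'(1)] f0
        by (cases "m = 0") (auto simp: c_def)
    qed
    have endo_adD: "endo L (\<lambda>v. br u (D v))" and endo_Dad: "endo L (\<lambda>v. D (br u v))" if "u \<in> L" for u
      using endo_comp[OF endo_ad[OF that] D] endo_comp[OF D endo_ad[OF that]] by auto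
    \<comment> \<open>The commutator of \<open>D\<close> with ad z is ad of \<open>D z\<close>.
      Cyclicity of the trace therefore turns this trace into minus the Killing form of
      \<open>y\<close> and \<open>D z\<close>, two elements of \<open>K\<close>.\<close>
    have tr_br: "trace_on L (\<lambda>v. br (br y z) (D v)) = 0" if yz: "y \<in> K" "z \<in> K" for y z
    proof -
      have L: "y \<in> L" "z \<in> L" "br y z \<in> L" "D z \<in> L"
        using yz K'(2) br_closed endo_in[OF D] by blast+
      have e: "endo L (\<lambda>v. br y (br z (D v)))" "endo L (\<lambda>v. br z (br y (D v)))"
        "endo L (\<lambda>v. br y (D (br z v)))"
        using L endo_comp[OF endo_ad endo_adD] endo_comp[OF endo_ad endo_Dad] by auto
      have "trace_on L (\<lambda>v. br (br y z) (D v)) =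
          trace_on L (\<lambda>v. br y (br z (D v)) - br z (br y (D v)))"
        using L endo_in[OF D]
        by (intro trace_on_cong[OF fd] endo_adD endo_minus[OF subspace_L] e)
          (auto simp: br_leibniz[of y z] br_closed)
      also have "\<dots> = trace_on L (\<lambda>v. br y (br z (D v))) - trace_on L (\<lambda>v. br y (D (br z v)))"
        using trace_on_commute[OF fd endo_ad[OF L(2)] endo_adD[OF L(1)]] e
        by (simp add: trace_on_minus[OF fd])
      also have "\<dots> = trace_on L (\<lambda>v. br y (br z (D v)) - br y (D (br z v)))"
        using e by (simp add: trace_on_minus[OF fd])
      also have "\<dots> = trace_on L (\<lambda>v. scale (-1) (br y (br (D z) v)))"
        using L endo_in[OF D]
        by (intro trace_on_cong[OF fd] endo_minus[OF subspace_L] e endo_smult[OF subspace_L]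
            endo_ad_comp[OF fd])
          (auto simp: deriv br_closed br_add_right)
      also have "\<dots> = - killing y (D z)"
        using trace_on_smult[OF fd endo_ad_comp[OF fd L(1,4)], of "-1"] by (simp add: killing_def)
      also have "\<dots> = 0" using kil yz(1) DK[OF L(2)] by simp
      finally show ?thesis .
    qed
    have "u \<in> L \<and> trace_on L (\<lambda>v. br u (D v)) = 0" if "u \<in> lie_prod scale br K K" for u
      using that unfolding lie_prod_def
    proof (induction rule: span_induct_alt)
      case base
      have "trace_on L (\<lambda>v. br 0 (D v)) = trace_on L (\<lambda>v. scale 0 v)"
        using endo_in[OF D] L_zero
        by (intro trace_on_cong[OF fd] endo_adD endo_smult[OF subspace_L] endo_id) (auto simp: br_zero)
      then show ?case using trace_on_smult[OF fd endo_id, of 0] L_zero by simp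
    next
      case (step a w u)
      then obtain y z where w: "w = br y z" "y \<in> K" "z \<in> K" by blast
      have L: "w \<in> L" "scale a w \<in> L" "u \<in> L" using w K'(2) br_closed L_scale step by blast+
      have "trace_on L (\<lambda>v. br (scale a w + u) (D v)) =
          trace_on L (\<lambda>v. scale a (br w (D v)) + br u (D v))"
        using L endo_in[OF D]
        by (intro trace_on_cong[OF fd] endo_adD endo_plus[OF subspace_L] endo_smult[OF subspace_L])
          (auto simp: L_add br_add_left br_scale_left)
      also have "\<dots> = 0"
        using L step tr_br[OF w(2,3)] w(1)
        by (simp add: trace_on_plus[OF fd] trace_on_smult[OF fd] endo_adD endo_smult[OF subspace_L])
      finally show ?case using L L_add by blast
    qed
    then have tr0: "trace_on L (\<lambda>v. br x (D v)) = 0" using x(2) by blast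

    \<comment> \<open>On the generalized eigenspace for \<open>m\<close> this is the scalar
      \<open>c m\<close> times \<open>ad x - m\<close>, hence nilpotent. It has trace zero, so ad x
      may be replaced by \<open>S\<close> in the trace.\<close>
    define N where "N v = br x (D v) - S (D v)" for v
    have N: "endo L N"
      unfolding N_def using endo_minus[OF subspace_L endo_adD[OF xL] endo_comp[OF S D]] .
    have nilN: "u \<in> gen_eig L N 0" if "u \<in> L" for u
      using that
    proof (induction rule: T.homogeneous_induct)
      case zero
      then show ?case by (rule zero_in_gen_eig[OF subspace_L])
    next
      case (add y z)
      then show ?case by (intro subspace_add[OF subspace_gen_eig[OF subspace_L N]])
    next
      case (homogeneous m u)
      from homogeneous(2) T show ?case
      proof (induction rule: gen_eig_induct)
        case zero
        then show ?case by (rule zero_in_gen_eig[OF subspace_L])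
      next
        case (step u)
        have u: "u \<in> L" using step(1) eL by blast
        have "scale (c m) u \<in> gen_eig L (br x) m"
          using step(1) subspace_scale[OF subspace_gen_eig[OF T]] by blast
        then have "N u - scale 0 u = scale (c m) (br x u - scale m u)"
          using u xL by (simp add: N_def D_hom[OF step(1)] S_hom br_scale_right scale_right_diff_distrib)
        then have "N u - scale 0 u \<in> gen_eig L N 0"
          using step(3) subspace_scale[OF subspace_gen_eig[OF subspace_L N]] by simp
        then show ?case using gen_eig_stepI[OF u] by blast
      qed
    qed
    have "\<exists>n. (N ^^ n) u = 0" if "u \<in> L" for u
      using nilN[OF that] by (simp add: gen_eig_def)
    then obtain n where "\<And>u. u \<in> L \<Longrightarrow> (N ^^ n) u = 0" using uniformly_nilpotent[OF fd N] by blast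
    then have trN: "trace_on L N = 0" by (rule trace_on_nilpotent[OF fd N])
    have "trace_on L (\<lambda>v. br x (D v)) = trace_on L (\<lambda>v. N v + S (D v))"
      by (intro trace_on_cong[OF fd] endo_adD[OF xL] endo_plus[OF subspace_L N] endo_comp[OF S D])
        (simp add: N_def)
    also have "\<dots> = trace_on L (\<lambda>v. S (D v))"
      by (simp add: trace_on_plus[OF fd N endo_comp[OF S D]] trN)
    finally have trSD: "trace_on L (\<lambda>v. S (D v)) = 0" using tr0 by simp

    \<comment> \<open>A basis of generalized eigenvectors, in which the composition of
      \<open>S\<close> and \<open>D\<close> is diagonal.\<close>
    obtain B where B: "B \<subseteq> (\<Union>m. gen_eig L (br x) m)" "independent B"
      "(\<Union>m. gen_eig L (br x) m) \<subseteq> span B"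
      by (rule maximal_independent_subset)
    have spB: "span B = L"
      using B(1,3) T.span_summands by (metis span_eq span_superset subset_trans span_minimal subspace_span)
    obtain S0 where "finite S0" "span S0 = L" using fd by (auto simp: finite_dim_def)
    then have finB: "finite B" using independent_span_bound[of S0 B] B(2) spB span_superset by blast
    have BL: "B \<subseteq> L" using spB span_superset by blast
    obtain e where e: "\<And>b. b \<in> B \<Longrightarrow> b \<in> gen_eig L (br x) (e b)" using B(1) by (metis UN_E subsetD)
    have "representation B (S (D b)) b = c (e b) * e b" if b: "b \<in> B" for b
    proof -
      have "scale (c (e b)) b \<in> gen_eig L (br x) (e b)"
        using e[OF b] subspace_scale[OF subspace_gen_eig[OF T]] by blast
      then have "S (D b) = scale (c (e b) * e b) b"
        using D_hom[OF e[OF b]] S_hom by (simp add: mult.commute)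
      then show ?thesis
        using representation_scale[OF B(2)] representation_basis[OF B(2) b] span_base[OF b] by simp
    qed
    then have "(\<Sum>b\<in>B. c (e b) * e b) = 0"
      using trSD trace_on_eq[OF endo_comp[OF S D] finB B(2) spB] by simp
    \<comment> \<open>The values of \<open>c\<close> are rational, so they come out of
      \<open>f\<close>, which sends \<open>c m * m\<close> to the square of
      \<open>f m\<close>.\<close>
    then have "(\<Sum>b\<in>B. f (c (e b) * e b)) = 0" using fsum[of "\<lambda>b. c (e b) * e b" B] f0 by simp
    then have "(\<Sum>b\<in>B. (f (e b))\<^sup>2) = 0" by (simp add: c_def f(2) power2_eq_square)
    then have "f (e b) = 0" if "b \<in> B" for b using that finB by (simp add: sum_nonneg_eq_0_iff)
    then have "D b = 0" if "b \<in> B" for b using that D_hom[OF e] by (simp add: c_def)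
    \<comment> \<open>This contradicts the normalization \<open>f l = 1\<close>, by which
      \<open>D\<close> fixes \<open>v0\<close>.\<close>
    then have "D v0 = 0"
      using endo_eq_0_on_span[OF D subspace_L BL] v0(1) eL spB by blast
    then show False using D_hom[OF v0(1)] v0(2) f(3) by (simp add: c_def)
  qed
  have "v \<in> gen_eig L (br x) 0"
    using v
  proof (induction rule: T.homogeneous_induct)
    case (homogeneous m u)
    then show ?case using eig0[of m] zero_in_gen_eig[OF subspace_L] by (cases "m = 0") auto
  qed (auto intro: zero_in_gen_eig subspace_L subspace_add[OF subspace_gen_eig[OF T]])
  then show ?thesis by (simp add: gen_eig_def)
qed

text \<open>By \<open>cartan_nilpotent\<close> the elements of the derived ideal of \<open>K\<close>
  act nilpotently on \<open>L\<close>, so Engel's theorem makes that ideal zero. Then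
  \<open>K\<close> is an abelian ideal.\<close>

lemma killing_isotropic_ideal_eq_0:
  assumes ss: "lie_semisimple scale br L" and K: "lie_ideal scale br L K"
    and kil: "\<And>x y. x \<in> K \<Longrightarrow> y \<in> K \<Longrightarrow> killing x y = 0"
  shows "K = {0}"
proof -
  note K' = lie_ideal_D[OF K]
  have sub: "lie_prod scale br K K \<subseteq> K"
    unfolding lie_prod_def using K'(2,3) by (intro span_minimal K'(1)) blast
  have "lie_prod scale br K K = {0}"
    using cartan_nilpotent[OF K kil] sub
    by (intro ad_nilpotent_ideal_eq_0[OF fd ss lie_ideal_prod[OF K K]]) blast
  then show ?thesis
    using abelian_ideal_eq_0[OF ss K] lie_prod_eq_0_iff by simp
qed

text \<open>The centralizer of \<open>I\<close> contains its orthogonal complement for the Killing form.\<close>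

lemma ideal_plus_centralizer:
  assumes ss: "lie_semisimple scale br L" and I: "lie_ideal scale br L I" and x: "x \<in> L"
  shows "\<exists>y\<in>I. x - y \<in> centralizer I"
proof -
  note I' = lie_ideal_D[OF I]
  define J where "J = {x \<in> L. \<forall>y\<in>I. killing x y = 0}"
  have J: "lie_ideal scale br L J" unfolding J_def by (rule lie_ideal_killing_orthogonal[OF fd I])
  have IJ: "I \<inter> J = {0}"
    by (rule killing_isotropic_ideal_eq_0[OF ss lie_ideal_inter[OF I J]]) (auto simp: J_def)
  have JC: "J \<subseteq> centralizer I"
  proof
    fix z assume z: "z \<in> J"
    then have zL: "z \<in> L" by (simp add: J_def)
    have "br z y \<in> I \<inter> J" if "y \<in> I" for y
      using that z zL I' lie_ideal_D(4)[OF J] by blast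
    then show "z \<in> centralizer I" using IJ zL by (auto simp: centralizer_def)
  qed
  have fdI: "finite_dim scale I" using finite_dim_subspace[OF fd I'(1,2)] .
  obtain B where B: "finite B" "independent B" "span B = I" using finite_dim_basis[OF fdI] .
  have BI: "B \<subseteq> I" using B(3) span_superset by blast
  have BL: "b \<in> L" if "b \<in> B" for b using that BI I'(2) by blast
  \<comment> \<open>The functional of pairing with \<open>y\<close>, encoded by its values on
    \<open>B\<close> as an element of \<open>I\<close>. Its kernel is the intersection of
    \<open>I\<close> and \<open>J\<close>, so \<open>\<phi>\<close> is injective and hence
    surjective; thus some \<open>y\<close> in \<open>I\<close> pairs with \<open>B\<close> as
    \<open>x\<close> does.\<close>
  define \<phi> where "\<phi> y = (\<Sum>b\<in>B. scale (killing y b) b)" for y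
  have \<phi>: "endo I \<phi>"
  proof (rule endoI)
    show "\<phi> y \<in> I" for y
      unfolding \<phi>_def using BI by (intro subspace_sum[OF I'(1)] subspace_scale[OF I'(1)]) blast
    show "\<phi> (y + z) = \<phi> y + \<phi> z" if "y \<in> I" "z \<in> I" for y z
      using that I'(2) BL
      by (simp add: \<phi>_def killing_add_left[OF fd] subset_iff scale_left_distrib sum.distrib)
    show "\<phi> (scale a y) = scale a (\<phi> y)" if "y \<in> I" for a y
      using that I'(2) BL by (simp add: \<phi>_def killing_scale_left[OF fd] subset_iff scale_sum_right)
  qed
  have ortho: "z \<in> J" if z: "z \<in> L" and 0: "\<And>b. b \<in> B \<Longrightarrow> killing z b = 0" for z
  proof -
    have "killing z y = 0" if "y \<in> I" for y
    proof -
      have "y \<in> L \<and> killing y z = 0" using that unfolding B(3)[symmetric]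
      proof (induction rule: span_induct_alt)
        case base
        then show ?case using killing_scale_left[OF fd z z, of 0] L_zero by simp
      next
        case (step a b y)
        then show ?case
          using z 0 BL[OF step(1)] killing_commute[OF fd z BL[OF step(1)]]
          by (simp add: killing_add_left[OF fd] killing_scale_left[OF fd] L_add L_scale)
      qed
      then show ?thesis using killing_commute[OF fd z] by simp
    qed
    then show ?thesis using z by (simp add: J_def)
  qed
  have "y = 0" if y: "y \<in> I" "\<phi> y = 0" for y
  proof -
    have "killing y b = 0" if "b \<in> B" for b
      using independentD[OF B(2,1) order_refl] y(2) that unfolding \<phi>_def by blast
    then show ?thesis using ortho[of y] y(1) I'(2) IJ by blast
  qed
  moreover have "(\<Sum>b\<in>B. scale (killing x b) b) \<in> I"
    using BI by (intro subspace_sum[OF I'(1)] subspace_scale[OF I'(1)]) blast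
  ultimately obtain y where y: "y \<in> I" "\<phi> y = (\<Sum>b\<in>B. scale (killing x b) b)"
    using endo_inj_imp_surj[OF fdI \<phi>] by blast
  have yL: "y \<in> L" using y(1) I'(2) by blast
  have kb: "killing (x - y) b = killing x b - killing y b" if "b \<in> B" for b
    using killing_add_left[OF fd x _ BL[OF that], of "scale (-1) y"]
      killing_scale_left[OF fd yL BL[OF that], of "-1"] yL L_scale[OF yL, of "-1"] by simp
  have "(\<Sum>b\<in>B. scale (killing x b - killing y b) b) = 0"
    using y(2) by (simp add: \<phi>_def scale_left_diff_distrib sum_subtractf)
  then have "killing x b - killing y b = 0" if "b \<in> B" for b
    using independentD[OF B(2,1) order_refl, of "\<lambda>b. killing x b - killing y b"] that by blast
  then have "x - y \<in> J" using ortho[OF L_diff[OF x yL]] kb by simp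
  then show ?thesis using y(1) JC by blast
qed

end

section \<open>Graded Lie algebras\<close>

context dsum
begin

lemma summand_inter:
  assumes "i \<in> I" "j \<in> I" "i \<noteq> j" "x \<in> W i" "x \<in> W j"
  shows "x = 0"
  using component_homogeneous[OF assms(1,4)] component_homogeneous[OF assms(2,5)] assms(3)
  by metis

lemma sum_eq_0D:
  assumes "finite J" "J \<subseteq> I" "\<And>j. j \<in> J \<Longrightarrow> f j \<in> W j" "(\<Sum>j\<in>J. f j) = 0" "i \<in> J"
  shows "f i = 0"
proof -
  have "component 0 i = f i" using component_unique[OF assms(1-3) assms(4)[symmetric]] assms(5) by simp
  moreover have "component 0 i = 0" using component_unique[of "{}" "\<lambda>_. 0" 0] by simp
  ultimately show ?thesis by simp
qed

end

sublocale graded_lie_algebra \<subseteq> deg: dsum scale L "carrier G" gr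
  by unfold_locales (rule direct_sum_gr)

context graded_lie_algebra
begin

lemma graded_subspace_iff:
  "graded_subspace scale G gr V \<longleftrightarrow>
     subspace V \<and> V \<subseteq> L \<and> (\<forall>v\<in>V. \<forall>g\<in>carrier G. deg.component v g \<in> V)"
proof
  assume "graded_subspace scale G gr V"
  then interpret V: dsum scale V "carrier G" "restrict_grading gr V"
    by unfold_locales (simp add: graded_subspace_def)
  have V: "subspace V" by (rule V.subspace_sum_space)
  have "span (\<Union>g\<in>carrier G. restrict_grading gr V g) \<subseteq> L"
    using deg.summand_subset by (intro span_minimal subspace_L) (auto simp: restrict_grading_def)
  then have VL: "V \<subseteq> L" by (simp add: V.span_summands)
  have "deg.component v g \<in> V" if v: "v \<in> V" and g: "g \<in> carrier G" for v g
  proof -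
    define f where "f = V.component v"
    have "deg.component v = (\<lambda>i. if i \<in> {i. f i \<noteq> 0} then f i else 0)"
      using V.component_in[OF v] V.component_outside[OF v] V.finite_components[OF v]
        V.sum_components[OF v]
      by (intro deg.component_unique) (auto simp: f_def restrict_grading_def)
    then have "deg.component v g = f g" by simp
    then show ?thesis using V.component_in[OF v g] by (simp add: f_def restrict_grading_def)
  qed
  then show "subspace V \<and> V \<subseteq> L \<and> (\<forall>v\<in>V. \<forall>g\<in>carrier G. deg.component v g \<in> V)"
    using V VL by blast
next
  assume *: "subspace V \<and> V \<subseteq> L \<and> (\<forall>v\<in>V. \<forall>g\<in>carrier G. deg.component v g \<in> V)"
  show "graded_subspace scale G gr V"
    unfolding graded_subspace_def
  proof (rule is_direct_sumI)
    show "V \<subseteq> span (\<Union>g\<in>carrier G. restrict_grading gr V g)"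
    proof
      fix v assume v: "v \<in> V"
      then have vL: "v \<in> L" using * by blast
      have "(\<Sum>g\<in>{g. deg.component v g \<noteq> 0}. deg.component v g)
          \<in> span (\<Union>g\<in>carrier G. restrict_grading gr V g)"
      proof (intro span_sum span_base)
        fix g assume "g \<in> {g. deg.component v g \<noteq> 0}"
        then have "g \<in> carrier G" using deg.component_outside[OF vL] by blast
        then show "deg.component v g \<in> (\<Union>g\<in>carrier G. restrict_grading gr V g)"
          using v * deg.component_in[OF vL] by (auto simp: restrict_grading_def)
      qed
      then show "v \<in> span (\<Union>g\<in>carrier G. restrict_grading gr V g)"
        using deg.sum_components[OF vL] by simp
    qed
  next
    fix J f i
    assume J: "finite J" "J \<subseteq> carrier G" and f: "\<And>j. j \<in> J \<Longrightarrow> f j \<in> restrict_grading gr V j"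
      and 0: "(\<Sum>j\<in>J. f j) = 0" and i: "i \<in> J"
    show "f i = 0"
      by (rule deg.sum_eq_0D[OF J _ 0 i]) (use f in \<open>auto simp: restrict_grading_def\<close>)
  qed (use * in \<open>auto simp: restrict_grading_def intro!: subspace_inter deg.subspace_summand\<close>)
qed

lemma graded_ideal_iff:
  "graded_ideal scale br L G gr I \<longleftrightarrow>
     lie_ideal scale br L I \<and> (\<forall>v\<in>I. \<forall>g\<in>carrier G. deg.component v g \<in> I)"
  unfolding graded_ideal_def graded_subspace_iff by (auto simp: lie_ideal_def)

text \<open>Projection to degree \<open>g\<close> keeps the terms of that degree in a linear
  combination and drops the others. The lemma shows that a span is graded and also bounds its
  components.\<close>

lemma component_span_homogeneous:
  assumes S: "\<And>s. s \<in> S \<Longrightarrow> \<exists>g\<in>carrier G. s \<in> gr g" and v: "v \<in> span S" and g: "g \<in> carrier G"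
  shows "deg.component v g \<in> span (S \<inter> gr g)"
proof -
  have "v \<in> L \<and> deg.component v g \<in> span (S \<inter> gr g)"
    using v
  proof (induction rule: span_induct_alt)
    case base
    then show ?case
      using deg.component_homogeneous[OF g subspace_0[OF deg.subspace_summand[OF g]]]
        L_zero span_zero by simp
  next
    case (step c s v)
    obtain h where h: "h \<in> carrier G" "s \<in> gr h" using S step(1) by blast
    then have sL: "s \<in> L" using deg.summand_subset by blast
    have "deg.component s g \<in> span (S \<inter> gr g)"
      using deg.component_homogeneous[OF h] step(1) h(2) span_zero by (auto intro: span_base)
    then show ?case
      using sL step by (auto simp: deg.component_add deg.component_scale L_scale L_add
          intro!: span_add span_scale)
  qed
  then show ?thesis ..
qed

text \<open>
  Fix \<open>h\<close> in the support. The homogeneous elements whose degree commutes with \<open>h\<close> and which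
  annihilate all components of degree not commuting with \<open>h\<close> span a graded ideal containing the
  component of degree \<open>h\<close>.
\<close>

lemma graded_simple_commutative_supp:
  assumes gs: "graded_simple scale br L G gr"
  shows "commutative_subset G (grading_supp G gr)"
proof -
  have "h \<otimes> k = k \<otimes> h" if h: "h \<in> grading_supp G gr" and k: "k \<in> grading_supp G gr" for h k
  proof (rule ccontr)
    assume ne: "h \<otimes> k \<noteq> k \<otimes> h"
    have hG: "h \<in> carrier G" and kG: "k \<in> carrier G" using h k by (auto simp: grading_supp_def)
    have "0 \<in> gr h" "0 \<in> gr k" using subspace_0 deg.subspace_summand hG kG by blast+
    then obtain y x where y: "y \<in> gr h" "y \<noteq> 0" and x: "x \<in> gr k" "x \<noteq> 0"
      using h k by (auto simp: grading_supp_def)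
    define C where "C = {g \<in> carrier G. g \<otimes> h = h \<otimes> g}"
    have C_mult: "a \<otimes> b \<in> C" if "a \<in> C" "b \<in> C" for a b
      using that hG by (auto simp: C_def m_assoc) (metis m_assoc)
    \<comment> \<open>Left multiplication by the centralizer \<open>C\<close> of \<open>h\<close>
      preserves the complement of \<open>C\<close>. This makes the annihilator condition in
      \<open>S\<close> stable under brackets.\<close>
    have C_notin: "a \<otimes> b \<notin> C" if "a \<in> C" "b \<in> carrier G - C" for a b
    proof
      assume ab: "a \<otimes> b \<in> C"
      have "a \<otimes> (b \<otimes> h) = h \<otimes> (a \<otimes> b)" using ab that hG by (auto simp: C_def m_assoc)
      also have "\<dots> = (h \<otimes> a) \<otimes> b" using that hG by (auto simp: C_def m_assoc)
      also have "\<dots> = (a \<otimes> h) \<otimes> b" using that hG by (auto simp: C_def)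
      also have "\<dots> = a \<otimes> (h \<otimes> b)" using that hG by (intro m_assoc) (auto simp: C_def)
      finally show False using that hG by (auto simp: C_def)
    qed
    define S where "S = {u. \<exists>g\<in>C. u \<in> gr g \<and> (\<forall>j\<in>carrier G - C. \<forall>z\<in>gr j. br u z = 0)}"
    have grL: "gr g \<subseteq> L" if "g \<in> carrier G" for g using deg.summand_subset that .
    have SL: "S \<subseteq> L" using grL by (auto simp: S_def C_def)
    have ideal: "lie_ideal scale br L (span S)"
    proof (rule lie_ideal_span[OF SL])
      fix a u assume a: "a \<in> L" and u: "u \<in> S"
      have uL: "u \<in> L" using SL u by blast
      obtain g where g: "g \<in> C" "u \<in> gr g" "\<And>j z. j \<in> carrier G - C \<Longrightarrow> z \<in> gr j \<Longrightarrow> br u z = 0"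
        using u by (auto simp: S_def)
      have gG: "g \<in> carrier G" using g(1) by (simp add: C_def)
      show "br a u \<in> span S"
        using a
      proof (induction rule: deg.homogeneous_induct)
        case zero
        then show ?case using br_zero(2)[OF uL] span_zero by simp
      next
        case (add a b)
        then show ?case using uL by (simp add: br_add_left span_add)
      next
        case (homogeneous j a)
        have aL: "a \<in> L" using grL homogeneous by blast
        show ?case
        proof (cases "j \<in> C")
          case False
          then show ?thesis using g(3)[of j a] homogeneous br_anti[OF aL uL] span_zero by simp
        next
          case True
          have "br (br a u) z = 0" if i: "i \<in> carrier G - C" and z: "z \<in> gr i" for i z
          proof -
            have zL: "z \<in> L" using i z grL by blast
            have "br a z \<in> gr (j \<otimes> i)" using br_gr homogeneous i z by blast
            moreover have "j \<otimes> i \<in> carrier G - C" using C_notin[OF True i] homogeneous i by blast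
            ultimately have "br u (br a z) = 0" by (rule g(3)[rotated])
            moreover have "br u z = 0" using g(3) i z by blast
            ultimately show ?thesis using br_leibniz[OF aL uL zL] br_zero(1)[OF aL] by simp
          qed
          then have "br a u \<in> S"
            unfolding S_def using C_mult[OF True g(1)] br_gr[OF homogeneous(1) gG homogeneous(2) g(2)]
            by blast
          then show ?thesis by (rule span_base)
        qed
      qed
    qed
    have hom: "\<exists>g\<in>carrier G. s \<in> gr g" if "s \<in> S" for s using that by (auto simp: S_def C_def)
    have "graded_ideal scale br L G gr (span S)"
      unfolding graded_ideal_iff using ideal component_span_homogeneous[OF hom]
        span_mono[OF Int_lower1] by blast
    moreover have "y \<in> S"
    proof -
      \<comment> \<open>Up to sign the two orders of the bracket agree, so it is homogeneous of
        degrees \<open>h \<otimes> j\<close> and \<open>j \<otimes> h\<close> at once. These differ,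
        hence it vanishes.\<close>
      have "br y z = 0" if j: "j \<in> carrier G - C" and z: "z \<in> gr j" for j z
      proof (rule deg.summand_inter)
        have "z \<in> L" "y \<in> L" using grL j z y hG by blast+
        then have "br y z = - br z y" by (rule br_anti[rotated])
        moreover have "br z y \<in> gr (j \<otimes> h)" using br_gr j z y hG by blast
        ultimately show "br y z \<in> gr (j \<otimes> h)"
          using subspace_neg[OF deg.subspace_summand] j hG by simp
        show "br y z \<in> gr (h \<otimes> j)" using br_gr j z y hG by blast
        show "j \<otimes> h \<noteq> h \<otimes> j" using j by (auto simp: C_def)
      qed (use j hG in auto)
      then show ?thesis using y hG by (auto simp: S_def C_def)
    qed
    ultimately have "span S = L"
      using gs y(2) span_base[of y S] unfolding graded_simple_def by blast
    then have "deg.component x k \<in> span (S \<inter> gr k)"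
      using component_span_homogeneous[where S = S and v = x, OF hom _ kG] x grL[OF kG] by blast
    \<comment> \<open>All degrees in \<open>S\<close> commute with \<open>h\<close>, while
      \<open>k\<close> does not; yet \<open>span S = L\<close> contains the nonzero \<open>x\<close>
      of degree \<open>k\<close>.\<close>
    moreover have "S \<inter> gr k \<subseteq> {0}"
    proof
      fix s assume s: "s \<in> S \<inter> gr k"
      then obtain g where g: "g \<in> C" "s \<in> gr g" by (auto simp: S_def)
      have "k \<noteq> g" using g ne by (auto simp: C_def)
      then show "s \<in> {0}" using deg.summand_inter[OF kG, of g s] s g by (auto simp: C_def)
    qed
    ultimately have "deg.component x k = 0"
      using span_minimal[OF _ subspace_single_0, of "S \<inter> gr k"] by blast
    then show False using deg.component_homogeneous[OF kG x(1)] x(2) by simp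
  qed
  then show ?thesis by (auto simp: commutative_subset_def grading_supp_def)
qed

text \<open>Right multiplication by \<open>h\<close> is injective on \<open>G\<close>, so different
  components of \<open>x\<close> contribute to different degrees.\<close>

lemma component_br_homogeneous:
  assumes x: "x \<in> L" and y: "h \<in> carrier G" "y \<in> gr h" and g: "g \<in> carrier G"
  shows "deg.component (br x y) (g \<otimes> h) = br (deg.component x g) y"
proof -
  have yL: "y \<in> L" using y deg.summand_subset by blast
  have component_0: "deg.component 0 i = 0" for i
    using endo_zero[OF deg.endo_component subspace_L] .
  show ?thesis
    using x
  proof (induction rule: deg.homogeneous_induct)
    case zero
    then show ?case using br_zero(2)[OF yL] component_0 by simp
  next
    case (add a b)
    then show ?case
      using yL by (simp add: br_add_left deg.component_add br_closed deg.component_mem)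
  next
    case (homogeneous k a)
    have "deg.component (br a y) = (\<lambda>j. if j = k \<otimes> h then br a y else 0)"
      using deg.component_homogeneous br_gr homogeneous y by blast
    moreover have "g \<otimes> h = k \<otimes> h \<longleftrightarrow> g = k" using homogeneous(1) y(1) g by simp
    ultimately show ?case
      using deg.component_homogeneous[OF homogeneous] br_zero(2)[OF yL] by simp
  qed
qed

text \<open>For homogeneous \<open>y\<close> in \<open>I\<close>, the components of
  \<open>br x y\<close> are the brackets of the components of \<open>x\<close> with
  \<open>y\<close>, so they vanish one by one. Arbitrary elements of \<open>I\<close> are sums of
  homogeneous ones in \<open>I\<close>.\<close>

lemma graded_ideal_centralizer:
  assumes I: "graded_ideal scale br L G gr I"
  shows "graded_ideal scale br L G gr (centralizer I)"
proof -
  have I': "lie_ideal scale br L I" "\<And>v g. v \<in> I \<Longrightarrow> g \<in> carrier G \<Longrightarrow> deg.component v g \<in> I"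
    using I by (auto simp: graded_ideal_iff)
  note IL = lie_ideal_D(2)[OF I'(1)]
  have "deg.component x g \<in> centralizer I" if x: "x \<in> centralizer I" and g: "g \<in> carrier G" for x g
  proof -
    have xL: "x \<in> L" using x by (simp add: centralizer_def)
    note cL = deg.component_mem[OF xL, of g]
    have hom: "br (deg.component x g) (deg.component y h) = 0" if y: "y \<in> I" for y h
    proof (cases "h \<in> carrier G")
      case True
      have "br x (deg.component y h) = 0" using x I'(2)[OF y True] by (simp add: centralizer_def)
      moreover have "deg.component y h \<in> gr h" using deg.component_in True y IL by blast
      ultimately show ?thesis
        using component_br_homogeneous[OF xL True _ g] endo_zero[OF deg.endo_component subspace_L]
        by metis
    next
      case False
      then show ?thesis using deg.component_outside y IL br_zero(1)[OF cL] by auto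
    qed
    have "br (deg.component x g) y = 0" if y: "y \<in> I" for y
    proof -
      have yL: "y \<in> L" using y IL by blast
      have "br (deg.component x g) y =
          br (deg.component x g) (\<Sum>h\<in>{h. deg.component y h \<noteq> 0}. deg.component y h)"
        using deg.sum_components[OF yL] by simp
      also have "\<dots> = (\<Sum>h\<in>{h. deg.component y h \<noteq> 0}. br (deg.component x g) (deg.component y h))"
        by (rule endo_sum[OF endo_ad[OF cL] subspace_L]) (rule deg.component_mem[OF yL])
      finally show ?thesis using hom[OF y] by simp
    qed
    then show ?thesis using cL by (simp add: centralizer_def)
  qed
  then show ?thesis using lie_ideal_centralizer[OF I'(1)] by (simp add: graded_ideal_iff)
qed

lemma graded_ideal_sum:
  assumes I: "graded_ideal scale br L G gr I" and J: "graded_ideal scale br L G gr J"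
  shows "graded_ideal scale br L G gr {x + y | x y. x \<in> I \<and> y \<in> J}"
proof -
  have "I \<subseteq> L" "J \<subseteq> L" using I J by (auto simp: graded_ideal_iff lie_ideal_def)
  then have "deg.component (x + y) g = deg.component x g + deg.component y g"
    if "x \<in> I" "y \<in> J" for x y g
    using that deg.component_add[of x y] by (simp add: subset_iff)
  then show ?thesis
    using I J lie_ideal_sum unfolding graded_ideal_iff by fastforce
qed

lemma graded_ideal_0: "graded_ideal scale br L G gr {0}"
  using lie_ideal_0 endo_zero[OF deg.endo_component subspace_L] by (simp add: graded_ideal_iff)

end

section \<open>Decomposition of semisimple graded algebras\<close>

locale fd_graded_lie_algebra = graded_lie_algebra scale br L G gr + fd_lie_algebra scale br L
  for scale :: "'f::{alg_closed_field, field_char_0} \<Rightarrow> 'v::ab_group_add \<Rightarrow> 'v"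
    and br :: "'v \<Rightarrow> 'v \<Rightarrow> 'v" and L :: "'v set" and G :: "('g, 'm) monoid_scheme" (structure)
    and gr :: "'g \<Rightarrow> 'v set"
begin

text \<open>\<open>L\<close> is the sum of \<open>A\<close> and its centralizer, which acts as zero
  on \<open>A\<close>. Hence every graded ideal of \<open>A\<close> is one of \<open>L\<close>, and
  minimality applies.\<close>

lemma minimal_graded_ideal_simple_component:
  assumes ss: "lie_semisimple scale br L" and A: "graded_ideal scale br L G gr A" "A \<noteq> {0}"
    and min: "\<And>J. \<lbrakk>graded_ideal scale br L G gr J; J \<subseteq> A\<rbrakk> \<Longrightarrow> J = {0} \<or> J = A"
  shows "graded_simple_component scale br L G gr A"
proof -
  have idA: "lie_ideal scale br L A" using A by (simp add: graded_ideal_def)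
  note A' = lie_ideal_D[OF idA]
  have "lie_prod scale br A A \<noteq> {0}"
    using abelian_ideal_eq_0[OF ss idA] A(2) by (auto simp: lie_prod_eq_0_iff)
  moreover have "J = {0} \<or> J = A" if J: "graded_ideal scale br A G (restrict_grading gr A) J" for J
  proof -
    have J': "subspace J" "J \<subseteq> A" "\<And>x y. x \<in> A \<Longrightarrow> y \<in> J \<Longrightarrow> br x y \<in> J"
      using J by (auto simp: graded_ideal_def lie_ideal_def)
    have "br x y \<in> J" if x: "x \<in> L" and y: "y \<in> J" for x y
    proof -
      obtain a where a: "a \<in> A" "x - a \<in> centralizer A"
        using ideal_plus_centralizer[OF ss idA x] by blast
      have L: "y \<in> L" "a \<in> L" "x - a \<in> L" using J'(2) A'(2) y a x L_diff by auto
      have "br x y = br (a + (x - a)) y" by simp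
      also have "\<dots> = br a y + br (x - a) y" by (rule br_add_left[OF L(2,3,1)])
      also have "br (x - a) y = 0" using a y J'(2) by (auto simp: centralizer_def)
      finally show ?thesis using J'(3) a y by simp
    qed
    moreover have "restrict_grading (restrict_grading gr A) J = restrict_grading gr J"
      using J'(2) by (auto simp: restrict_grading_def)
    ultimately have "graded_ideal scale br L G gr J"
      using J J' A'(2) unfolding graded_ideal_def graded_subspace_def lie_ideal_def by auto
    then show ?thesis using min J'(2) by blast
  qed
  ultimately show ?thesis
    using A by (simp add: graded_simple_component_def graded_simple_def)
qed

text \<open>The next summand is a minimal graded ideal inside the centralizer of the partial sum
  \<open>U\<close>. This centralizer is nonzero as long as \<open>U\<close> is proper, and it meets
  \<open>U\<close> trivially.\<close>

lemma semisimple_graded_decomposition: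
  assumes ss: "lie_semisimple scale br L"
  obtains m :: nat and A where "is_direct_sum scale L {1..m} A"
    "\<And>i. i \<in> {1..m} \<Longrightarrow> graded_simple_component scale br L G gr (A i)"
proof (rule greedy_direct_sum[OF fd, where P = "graded_ideal scale br L G gr"
      and Q = "graded_simple_component scale br L G gr"])
  show "graded_ideal scale br L G gr {0}" by (rule graded_ideal_0)
  show "subspace U \<and> U \<subseteq> L" if "graded_ideal scale br L G gr U" for U
    using that by (auto simp: graded_ideal_def lie_ideal_def)
next
  fix U assume U: "graded_ideal scale br L G gr U" and ne: "U \<noteq> L"
  have idU: "lie_ideal scale br L U" using U by (simp add: graded_ideal_def)
  note U' = lie_ideal_D[OF idU]
  have "centralizer U \<noteq> {0}"
  proof
    assume "centralizer U = {0}"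
    then have "L \<subseteq> U" using ideal_plus_centralizer[OF ss idU] by fastforce
    then show False using ne U'(2) by blast
  qed
  moreover define R where "R J \<longleftrightarrow> graded_ideal scale br L G gr J \<and> J \<noteq> {0} \<and> J \<subseteq> centralizer U" for J
  ultimately have "R (centralizer U)" using graded_ideal_centralizer[OF U] by simp
  then obtain A where A: "R A" "\<And>J. R J \<Longrightarrow> dim A \<le> dim J"
    using ex_has_least_nat[of R "centralizer U" dim] by blast
  have A': "subspace A" "A \<subseteq> L"
    using A(1) by (auto simp: R_def graded_ideal_def lie_ideal_def)
  have "J = {0} \<or> J = A" if J: "graded_ideal scale br L G gr J" "J \<subseteq> A" for J
  proof (rule ccontr)
    assume *: "\<not> (J = {0} \<or> J = A)"
    then have "R J" using J A(1) by (auto simp: R_def)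
    moreover have "dim J < dim A"
      using dim_less_dim[OF finite_dim_subspace[OF fd A'], of J] J *
      by (auto simp: graded_ideal_def lie_ideal_def)
    ultimately show False using A(2) by fastforce
  qed
  then have "graded_simple_component scale br L G gr A"
    using minimal_graded_ideal_simple_component[OF ss] A(1) by (simp add: R_def)
  moreover have "A \<inter> U = {0}"
    using inter_centralizer[OF ss idU] A(1) subspace_0[OF A'(1)] subspace_0[OF U'(1)]
    by (auto simp: R_def)
  moreover have "graded_ideal scale br L G gr {u + a | u a. u \<in> U \<and> a \<in> A}"
    using graded_ideal_sum U A(1) by (simp add: R_def)
  ultimately show "\<exists>A. graded_simple_component scale br L G gr A \<and> subspace A \<and> A \<noteq> {0} \<and>
      A \<inter> U = {0} \<and> graded_ideal scale br L G gr {u + a | u a. u \<in> U \<and> a \<in> A}"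
    using A(1) A'(1) by (auto simp: R_def)
qed (use that in blast)

lemma graded_simple_component_commutative_supp:
  assumes "graded_simple_component scale br L G gr A"
  shows "commutative_subset G (grading_supp G (restrict_grading gr A))"
proof -
  interpret A: graded_lie_algebra scale br A G "restrict_grading gr A"
    using assms by (intro graded_lie_algebra_ideal) (simp add: graded_simple_component_def)
  show ?thesis
    using assms by (intro A.graded_simple_commutative_supp) (simp add: graded_simple_component_def)
qed

end

section \<open>Characters of abelian groups\<close>

text \<open>The centralizer of an element is a subgroup. Used first for elements of \<open>S\<close>
  and then for arbitrary elements, this carries commutation from the generators to the whole
  group.\<close>

lemma (in group) comm_group_if_generated_by_commutative:
  assumes S: "commutative_subset G S" and gen: "generate G S = carrier G"
  shows "comm_group G"
proof -
  have sub: "subgroup {g \<in> carrier G. g \<otimes> s = s \<otimes> g} G" if s: "s \<in> carrier G" for s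
  proof (rule subgroup.intro)
    fix x assume x: "x \<in> {g \<in> carrier G. g \<otimes> s = s \<otimes> g}"
    then have xG: "x \<in> carrier G" and xs: "x \<otimes> s = s \<otimes> x" by auto
    have "inv x \<otimes> s = inv x \<otimes> (s \<otimes> x) \<otimes> inv x" using xG s by (simp add: m_assoc)
    also have "\<dots> = inv x \<otimes> (x \<otimes> s) \<otimes> inv x" using xs by simp
    also have "\<dots> = s \<otimes> inv x" using xG s by (simp add: m_assoc[symmetric])
    finally show "inv x \<in> {g \<in> carrier G. g \<otimes> s = s \<otimes> g}" using x by simp
  next
    fix x y assume xy: "x \<in> {g \<in> carrier G. g \<otimes> s = s \<otimes> g}" "y \<in> {g \<in> carrier G. g \<otimes> s = s \<otimes> g}"
    have "x \<otimes> y \<otimes> s = x \<otimes> (s \<otimes> y)" using xy s by (simp add: m_assoc)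
    also have "\<dots> = x \<otimes> s \<otimes> y" using xy s by (intro m_assoc[symmetric]) auto
    also have "\<dots> = s \<otimes> (x \<otimes> y)" using xy s by (simp add: m_assoc)
    finally show "x \<otimes> y \<in> {g \<in> carrier G. g \<otimes> s = s \<otimes> g}" using xy by simp
  qed (use s in auto)
  have S': "S \<subseteq> carrier G" "\<And>s t. s \<in> S \<Longrightarrow> t \<in> S \<Longrightarrow> s \<otimes> t = t \<otimes> s"
    using S by (auto simp: commutative_subset_def)
  have 1: "g \<otimes> s = s \<otimes> g" if "g \<in> carrier G" "s \<in> S" for g s
    using generate_subgroup_incl[OF _ sub, of S s] S' that gen by blast
  have "g \<otimes> h = h \<otimes> g" if "g \<in> carrier G" "h \<in> carrier G" for g h
    using generate_subgroup_incl[OF _ sub, of S h] S' that gen 1[OF that(2)] by fastforce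
  then show ?thesis by (rule group_comm_groupI)
qed

definition (in group) is_character :: "'a set \<Rightarrow> ('a \<Rightarrow> 'f::field) \<Rightarrow> bool" where
  "is_character H \<chi> \<longleftrightarrow>
     (\<forall>h\<in>H. \<chi> h \<noteq> 0) \<and> (\<forall>g\<in>H. \<forall>h\<in>H. \<chi> (g \<otimes> h) = \<chi> g * \<chi> h)"

context group
begin

lemma character_one:
  assumes "is_character H \<chi>" "subgroup H G"
  shows "\<chi> \<one> = 1"
proof -
  have "\<chi> (\<one> \<otimes> \<one>) = \<chi> \<one> * \<chi> \<one>" "\<chi> \<one> \<noteq> 0"
    using assms(1) subgroup.one_closed[OF assms(2)] unfolding is_character_def by blast+
  then show ?thesis by simp
qed

lemma character_inv:
  assumes \<chi>: "is_character H \<chi>" and H: "subgroup H G" and h: "h \<in> H"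
  shows "\<chi> (inv h) = inverse (\<chi> h)"
proof -
  have hG: "h \<in> carrier G" using subgroup.mem_carrier[OF H h] .
  have "\<chi> h * \<chi> (inv h) = \<chi> (h \<otimes> inv h)"
    using \<chi> h subgroup.m_inv_closed[OF H h] by (simp add: is_character_def)
  also have "\<dots> = 1" using hG character_one[OF \<chi> H] by simp
  finally show ?thesis by (metis inverse_unique)
qed

lemma character_int_pow:
  assumes \<chi>: "is_character H \<chi>" and H: "subgroup H G" and h: "h \<in> H"
  shows "\<chi> (h [^] (n::int)) = \<chi> h powi n"
proof -
  have nat: "h [^] (k::nat) \<in> H \<and> \<chi> (h [^] k) = \<chi> h ^ k" for k
    using h \<chi> subgroup.m_closed[OF H] subgroup.one_closed[OF H]
    by (induction k) (auto simp: character_one[OF \<chi> H] is_character_def)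
  show ?thesis
  proof (cases n rule: int_cases2)
    case (nonneg k)
    then show ?thesis using nat[of k] by (simp add: int_pow_int)
  next
    case (nonpos k)
    then show ?thesis
      using nat[of k] character_inv[OF \<chi> H, of "h [^] k"] subgroup.mem_carrier[OF H h]
      by (simp add: int_pow_neg_int power_int_minus)
  qed
qed

end

section \<open>Extension and separation properties of characters\<close>

context comm_group
begin

text \<open>On the subgroup generated by \<open>H\<close> and \<open>a\<close> the extension is
  forced to be \<open>\<chi> h * c powi n\<close> at \<open>h \<otimes> a [^] n\<close>. Agreement
  on the powers of \<open>a\<close> in \<open>H\<close> is what makes this independent of the
  representation.\<close>

lemma character_extend_value:
  assumes H: "subgroup H G" and \<chi>: "is_character H \<chi>" and a: "a \<in> carrier G" and c: "c \<noteq> 0"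
    and val: "\<And>n::int. a [^] n \<in> H \<Longrightarrow> \<chi> (a [^] n) = c powi n"
  shows "\<exists>H' \<chi>'. subgroup H' G \<and> is_character H' \<chi>' \<and> H \<subseteq> H' \<and> a \<in> H' \<and>
    (\<forall>h\<in>H. \<chi>' h = \<chi> h) \<and> \<chi>' a = c"
proof -
  have HG: "h \<in> carrier G" if "h \<in> H" for h using subgroup.mem_carrier[OF H that] .
  have mult: "(h \<otimes> a [^] n) \<otimes> (k \<otimes> a [^] m) = (h \<otimes> k) \<otimes> a [^] (n + m)"
    if "h \<in> H" "k \<in> H" for h k and n m :: int
    using HG that a by (simp add: int_pow_mult m_ac)
  have well: "\<chi> h * c powi n = \<chi> k * c powi m"
    if hk: "h \<in> H" "k \<in> H" and eq: "h \<otimes> a [^] n = k \<otimes> a [^] m" for h k and n m :: int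
  proof -
    have "a [^] (n - m) = inv h \<otimes> (h \<otimes> a [^] n) \<otimes> inv (a [^] m)"
      using HG[OF hk(1)] a by (simp add: int_pow_diff m_assoc[symmetric])
    also have "\<dots> = inv h \<otimes> k" unfolding eq using HG hk a by (simp add: m_assoc)
    finally have p: "a [^] (n - m) = inv h \<otimes> k" .
    moreover have "inv h \<in> H" using subgroup.m_inv_closed[OF H hk(1)] .
    ultimately have "\<chi> (a [^] (n - m)) = inverse (\<chi> h) * \<chi> k" "a [^] (n - m) \<in> H"
      using \<chi> hk subgroup.m_closed[OF H] character_inv[OF \<chi> H] by (auto simp: is_character_def)
    then have "c powi (n - m) = inverse (\<chi> h) * \<chi> k" using val by simp
    then show ?thesis
      using \<chi> hk c by (auto simp: is_character_def power_int_diff field_simps)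
  qed
  define H' where "H' = {h \<otimes> a [^] n | h (n::int). h \<in> H}"
  define \<chi>' where "\<chi>' g = (SOME z. \<exists>h\<in>H. \<exists>n::int. g = h \<otimes> a [^] n \<and> z = \<chi> h * c powi n)" for g
  have \<chi>': "\<chi>' (h \<otimes> a [^] n) = \<chi> h * c powi n" if "h \<in> H" for h and n :: int
    unfolding \<chi>'_def
  proof (rule some_equality)
    show "\<exists>k\<in>H. \<exists>m::int. h \<otimes> a [^] n = k \<otimes> a [^] m \<and> \<chi> h * c powi n = \<chi> k * c powi m"
      using that by blast
    show "z = \<chi> h * c powi n"
      if "\<exists>k\<in>H. \<exists>m::int. h \<otimes> a [^] n = k \<otimes> a [^] m \<and> z = \<chi> k * c powi m" for z
      using that well[OF _ \<open>h \<in> H\<close>] by metis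
  qed
  have "subgroup H' G"
  proof (rule subgroup.intro)
    show "H' \<subseteq> carrier G" using HG a by (auto simp: H'_def)
    show "x \<otimes> y \<in> H'" if "x \<in> H'" "y \<in> H'" for x y
      using that mult subgroup.m_closed[OF H] unfolding H'_def by blast
    have "\<one> = \<one> \<otimes> a [^] (0::int)" by simp
    then show "\<one> \<in> H'" using subgroup.one_closed[OF H] unfolding H'_def by blast
    show "inv x \<in> H'" if x: "x \<in> H'" for x
    proof -
      obtain h n where "h \<in> H" "x = h \<otimes> a [^] (n::int)" using x by (auto simp: H'_def)
      then have "inv x = inv h \<otimes> a [^] (- n)" "inv h \<in> H"
        using HG a subgroup.m_inv_closed[OF H] by (auto simp: inv_mult int_pow_neg)
      then show ?thesis unfolding H'_def by blast
    qed
  qed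
  moreover have "is_character H' \<chi>'"
    using \<chi> c subgroup.m_closed[OF H]
    by (auto simp: is_character_def H'_def \<chi>' mult power_int_add)
  moreover have H_eq: "h = h \<otimes> a [^] (0::int)" if "h \<in> H" for h using HG that by simp
  then have "H \<subseteq> H'" unfolding H'_def by blast
  moreover have "\<chi>' h = \<chi> h" if "h \<in> H" for h using H_eq[OF that] \<chi>'[OF that, of 0] by simp
  moreover have a_eq: "a = \<one> \<otimes> a [^] (1::int)" using a by simp
  then have "a \<in> H'" using subgroup.one_closed[OF H] unfolding H'_def by blast
  moreover have "\<chi>' a = c"
    using a_eq \<chi>'[OF subgroup.one_closed[OF H], of 1] character_one[OF \<chi> H] by simp
  ultimately show ?thesis by blast
qed

text \<open>If a least positive power \<open>d\<close> of \<open>a\<close> lies in \<open>H\<close>,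
  any \<open>d\<close>-th root of the value there is consistent. The last clause serves separation:
  over the trivial subgroup a nontrivial value must be found.\<close>

lemma character_value_exists:
  fixes \<chi> :: "'a \<Rightarrow> 'f::{alg_closed_field, field_char_0}"
  assumes H: "subgroup H G" and \<chi>: "is_character H \<chi>" and a: "a \<in> carrier G"
  shows "\<exists>c. c \<noteq> 0 \<and> (\<forall>n::int. a [^] n \<in> H \<longrightarrow> \<chi> (a [^] n) = c powi n) \<and>
    (H = {\<one>} \<and> a \<noteq> \<one> \<longrightarrow> c \<noteq> 1)"
proof (cases "\<exists>d::nat. 0 < d \<and> a [^] d \<in> H")
  case False
  have "n = 0" if n: "a [^] n \<in> H" for n :: int
  proof (rule ccontr)
    assume "n \<noteq> 0"
    have "a [^] (- n) \<in> H" using subgroup.m_inv_closed[OF H n] int_pow_neg[OF a, of n] by simp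
    then have "a [^] int (nat \<bar>n\<bar>) \<in> H" using n by (cases "n \<ge> 0") simp_all
    then have "a [^] nat \<bar>n\<bar> \<in> H" by (simp only: int_pow_int)
    moreover have "0 < nat \<bar>n\<bar>" using \<open>n \<noteq> 0\<close> by simp
    ultimately show False using False by blast
  qed
  \<comment> \<open>Only the exponent 0 has to be matched, so any nonzero value is consistent; 2
    differs from both 0 and 1.\<close>
  then have "\<forall>n::int. a [^] n \<in> H \<longrightarrow> \<chi> (a [^] n) = 2 powi n"
    using character_one[OF \<chi> H] by force
  then show ?thesis by (intro exI[of _ 2]) auto
next
  case True
  define d where "d = (LEAST d::nat. 0 < d \<and> a [^] d \<in> H)"
  have d: "0 < d" "a [^] d \<in> H" using LeastI_ex[OF True] by (auto simp: d_def)
  have least: "d \<le> k" if "0 < k" "a [^] k \<in> H" for k :: nat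
    unfolding d_def using that by (intro Least_le) simp
  have val: "\<chi> (a [^] n) = c powi n" if n: "a [^] n \<in> H" and c: "c ^ d = \<chi> (a [^] d)" for n :: int and c
  proof -
    \<comment> \<open>Division with remainder: by minimality of \<open>d\<close>, the exponents of
      powers of \<open>a\<close> in \<open>H\<close> are multiples of \<open>d\<close>.\<close>
    define q r where "q = n div int d" and "r = nat (n mod int d)"
    have n_eq: "n = int d * q + int r" and r: "r < d"
      using d(1) by (auto simp: q_def r_def nat_less_iff)
    have dq: "a [^] (int d * q) = (a [^] d) [^] q"
      using a by (simp add: int_pow_pow[symmetric] int_pow_int)
    have dqH: "(a [^] d) [^] q \<in> H"
      using d(2) by (metis H subgroup_int_pow_closed)
    have "a [^] r = inv ((a [^] d) [^] q) \<otimes> a [^] n"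
      unfolding n_eq using a by (simp add: int_pow_mult dq int_pow_int m_assoc[symmetric])
    then have "a [^] r \<in> H"
      using n dqH subgroup.m_closed[OF H] subgroup.m_inv_closed[OF H] by simp
    then have "r = 0" using least[of r] r by fastforce
    then have "n = int d * q" using n_eq by simp
    have "\<chi> (a [^] n) = \<chi> (a [^] d) powi q"
      using dq character_int_pow[OF \<chi> H d(2)] \<open>n = int d * q\<close> by simp
    also have "\<dots> = c powi n" unfolding c[symmetric] \<open>n = int d * q\<close> by (rule power_int_power)
    finally show ?thesis .
  qed
  have ne: "c \<noteq> 0" if "c ^ d = \<chi> (a [^] d)" for c
    using that \<chi> d by (auto simp: is_character_def zero_power)
  show ?thesis
  proof (cases "H = {\<one>} \<and> a \<noteq> \<one>")
    case False
    obtain c where "c ^ d = \<chi> (a [^] d)" using nth_root_exists[OF d(1)] by blast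
    then show ?thesis using False ne val by (intro exI[of _ c]) auto
  next
    case True
    have "d \<noteq> 1" using True d(2) a by (intro notI) simp
    then obtain e where e: "d = Suc e" "0 < e" using d(1) by (cases d) auto
    \<comment> \<open>A root of \<open>1 + c + ... + c ^ e\<close> with \<open>d = e + 1\<close> is
      a \<open>d\<close>-th root of unity. It is not 1, since at 1 the sum is \<open>e + 1\<close>,
      nonzero in characteristic zero.\<close>
    obtain c :: 'f where c: "(\<Sum>k\<le>e. 1 * c ^ k) = 0"
      using alg_closed[OF e(2), of "\<lambda>_. 1"] by auto
    have "c ^ d - 1 = (c - 1) * (\<Sum>k<d. c ^ k)" by (rule power_diff_1_eq)
    then have "c ^ d = \<chi> (a [^] d)"
      using c True d(2) character_one[OF \<chi> H] by (simp add: e(1) lessThan_Suc_atMost)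
    moreover have "c \<noteq> 1"
    proof
      assume "c = 1"
      then have "of_nat (Suc e) = (0::'f)" using c by simp
      then show False by (simp only: of_nat_eq_0_iff)
    qed
    ultimately show ?thesis using ne val by (intro exI[of _ c]) auto
  qed
qed

lemma character_extend:
  fixes \<chi> :: "'a \<Rightarrow> 'f::{alg_closed_field, field_char_0}"
  assumes "finite S" "S \<subseteq> carrier G" and H: "subgroup H G" and \<chi>: "is_character H \<chi>"
  shows "\<exists>H' \<chi>'. subgroup H' G \<and> is_character H' \<chi>' \<and> H \<subseteq> H' \<and> S \<subseteq> H' \<and> (\<forall>h\<in>H. \<chi>' h = \<chi> h)"
  using assms(1,2)
proof (induction S rule: finite_induct)
  case empty
  then show ?case using H \<chi> by blast
next
  case (insert a S)
  then obtain H1 \<chi>1 where 1: "subgroup H1 G" "is_character H1 \<chi>1" "H \<subseteq> H1" "S \<subseteq> H1"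
    "\<forall>h\<in>H. \<chi>1 h = \<chi> h" by auto
  have a: "a \<in> carrier G" using insert by blast
  obtain c where c: "c \<noteq> 0" "\<And>n::int. a [^] n \<in> H1 \<Longrightarrow> \<chi>1 (a [^] n) = c powi n"
    using character_value_exists[OF 1(1,2) a] by blast
  obtain H2 \<chi>2 where "subgroup H2 G" "is_character H2 \<chi>2" "H1 \<subseteq> H2" "a \<in> H2"
    "\<forall>h\<in>H1. \<chi>2 h = \<chi>1 h"
    using character_extend_value[OF 1(1,2) a c] by blast
  then show ?case using 1 by (intro exI[of _ H2] exI[of _ \<chi>2]) auto
qed

text \<open>The trivial character of the trivial subgroup is first given a value other than 1 at the
  quotient of \<open>g\<close> and \<open>h\<close>, then extended over the finitely many
  generators.\<close>

lemma characters_separate: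
  assumes S: "finite S" "S \<subseteq> carrier G" "generate G S = carrier G"
    and g: "g \<in> carrier G" and h: "h \<in> carrier G" and ne: "g \<noteq> h"
  obtains \<chi> :: "'a \<Rightarrow> 'f::{alg_closed_field, field_char_0}"
  where "is_character (carrier G) \<chi>" "\<chi> g \<noteq> \<chi> h"
proof -
  define k where "k = g \<otimes> inv h"
  have k: "k \<in> carrier G" "g = k \<otimes> h" using g h by (auto simp: k_def m_assoc)
  then have "k \<noteq> \<one>" using ne h by auto
  have H: "subgroup {\<one>} G" by (rule triv_subgroup)
  have \<chi>: "is_character {\<one>} (\<lambda>_. 1::'f)" by (simp add: is_character_def)
  obtain c :: 'f where c: "c \<noteq> 0" "c \<noteq> 1" "\<And>n::int. k [^] n \<in> {\<one>} \<Longrightarrow> 1 = c powi n"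
    using character_value_exists[OF H \<chi> k(1)] \<open>k \<noteq> \<one>\<close> by blast
  obtain H1 and \<chi>1 :: "'a \<Rightarrow> 'f" where 1: "subgroup H1 G" "is_character H1 \<chi>1" "k \<in> H1" "\<chi>1 k = c"
    using character_extend_value[OF H \<chi> k(1) c(1,3)] by blast
  obtain H2 and \<chi>2 :: "'a \<Rightarrow> 'f" where 2: "subgroup H2 G" "is_character H2 \<chi>2" "H1 \<subseteq> H2" "S \<subseteq> H2"
    "\<forall>h\<in>H1. \<chi>2 h = \<chi>1 h"
    using character_extend[OF S(1,2) 1(1,2)] by blast
  have H2: "H2 = carrier G"
    using generate_subgroup_incl[OF 2(4,1)] S(3) subgroup.subset[OF 2(1)] by blast
  have "\<chi>2 g = \<chi>2 k * \<chi>2 h" "\<chi>2 h \<noteq> 0" using 2(2) k h by (auto simp: is_character_def H2)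
  moreover have "\<chi>2 k = c" using 1 2 by simp
  ultimately have "\<chi>2 g \<noteq> \<chi>2 h" using c by simp
  then show ?thesis using that 2(2) H2 by simp
qed

end

section \<open>The action of the characters on a graded Lie algebra\<close>

context graded_lie_algebra
begin

text \<open>In a degree where every member of a finite spanning set has zero component, the
  projection vanishes on all of \<open>L\<close>.\<close>

lemma finite_supp:
  assumes fd: "finite_dim scale L"
  shows "finite (grading_supp G gr)"
proof -
  obtain S where S: "finite S" "span S = L" using fd by (auto simp: finite_dim_def)
  have SL: "S \<subseteq> L" using S(2) span_superset by blast
  have "grading_supp G gr \<subseteq> (\<Union>s\<in>S. {g. deg.component s g \<noteq> 0})"
  proof
    fix g assume "g \<in> grading_supp G gr"
    then have g: "g \<in> carrier G" "gr g \<noteq> {0}" by (auto simp: grading_supp_def)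
    then obtain x where x: "x \<in> gr g" "x \<noteq> 0"
      using subspace_0[OF deg.subspace_summand[OF g(1)]] by blast
    show "g \<in> (\<Union>s\<in>S. {g. deg.component s g \<noteq> 0})"
    proof (rule ccontr)
      assume "g \<notin> (\<Union>s\<in>S. {g. deg.component s g \<noteq> 0})"
      then have "deg.component x g = 0"
        using endo_eq_0_on_span[OF deg.endo_component subspace_L SL, of g x] x(1)
          deg.summand_subset[OF g(1)] S(2) by auto
      then show False using deg.component_homogeneous[OF g(1) x(1)] x(2) by simp
    qed
  qed
  then show ?thesis
    by (rule finite_subset) (use S(1) SL deg.finite_components in blast)
qed

lemma is_character_inverse:
  "is_character H \<chi> \<Longrightarrow> is_character H (\<lambda>g. inverse (\<chi> g))"
  by (auto simp: is_character_def)

lemma is_character_mult: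
  "is_character H \<chi> \<Longrightarrow> is_character H \<psi> \<Longrightarrow> is_character H (\<lambda>g. \<chi> g * \<psi> g)"
  by (auto simp: is_character_def)

lemma diag_character_inverse:
  assumes "is_character (carrier G) \<chi>" "v \<in> L"
  shows "deg.diag (\<lambda>g. inverse (\<chi> g)) (deg.diag \<chi> v) = v"
    and "deg.diag \<chi> (deg.diag (\<lambda>g. inverse (\<chi> g)) v) = v"
  using assms by (auto simp: deg.diag_compose is_character_def intro!: deg.diag_eq_id)

lemma diag_character_br:
  assumes \<chi>: "is_character (carrier G) \<chi>" and xy: "x \<in> L" "y \<in> L"
  shows "deg.diag \<chi> (br x y) = br (deg.diag \<chi> x) (deg.diag \<chi> y)"
proof -
  note D = deg.endo_diag[of \<chi>]
  note D0 = endo_zero[OF D subspace_L]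
  have DL: "deg.diag \<chi> v \<in> L" if "v \<in> L" for v using deg.diag_mem that .
  have *: "deg.diag \<chi> (br x y) = br (deg.diag \<chi> x) (deg.diag \<chi> y)"
    if g: "g \<in> carrier G" "x \<in> gr g" and "y \<in> L" for x y g
  proof -
    have xL: "x \<in> L" using g deg.summand_subset by blast
    show ?thesis
      using \<open>y \<in> L\<close>
    proof (induction rule: deg.homogeneous_induct)
      case zero
      then show ?case using br_zero(1)[OF xL] br_zero(1)[OF DL[OF xL]] D0 by simp
    next
      case (add y z)
      then show ?case using xL by (simp add: br_add_right br_closed endo_add[OF D] DL)
    next
      case (homogeneous h y)
      have "y \<in> L" using homogeneous deg.summand_subset by blast
      moreover have gh: "g \<otimes> h \<in> carrier G" "br x y \<in> gr (g \<otimes> h)" "\<chi> (g \<otimes> h) = \<chi> g * \<chi> h"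
        using g homogeneous br_gr \<chi> by (auto simp: is_character_def)
      ultimately show ?case
        using xL deg.diag_homogeneous[OF gh(1,2), of \<chi>] deg.diag_homogeneous[OF g, of \<chi>]
          deg.diag_homogeneous[OF homogeneous, of \<chi>]
        by (simp add: br_scale_left br_scale_right L_scale mult.commute)
    qed
  qed
  show ?thesis
    using xy(1)
  proof (induction rule: deg.homogeneous_induct)
    case zero
    then show ?case using br_zero(2)[OF xy(2)] br_zero(2)[OF DL[OF xy(2)]] D0 by simp
  next
    case (add x z)
    then show ?case using xy(2) by (simp add: br_add_left br_closed endo_add[OF D] DL)
  next
    case (homogeneous g x)
    then show ?case using * xy(2) by blast
  qed
qed

lemma lie_ideal_character_image:
  assumes \<chi>: "is_character (carrier G) \<chi>" and I: "lie_ideal scale br L I"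
  shows "lie_ideal scale br L (deg.diag \<chi> ` I)"
proof -
  note I' = lie_ideal_D[OF I]
  have "subspace (deg.diag \<chi> ` I)"
    by (rule subspace_endo_image[OF deg.endo_diag I'(1,2) subspace_L])
  moreover have "br x (deg.diag \<chi> y) \<in> deg.diag \<chi> ` I" if "x \<in> L" "y \<in> I" for x y
  proof -
    define z where "z = deg.diag (\<lambda>g. inverse (\<chi> g)) x"
    have z: "z \<in> L" "deg.diag \<chi> z = x"
      using deg.diag_mem that diag_character_inverse[OF \<chi>] by (auto simp: z_def)
    then have "br x (deg.diag \<chi> y) = deg.diag \<chi> (br z y)"
      using diag_character_br[OF \<chi> z(1), of y] that(2) I'(2) by auto
    then show ?thesis using I'(3)[OF z(1) that(2)] by blast
  qed
  ultimately show ?thesis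
    unfolding lie_ideal_def using deg.diag_mem I'(2) by auto
qed

text \<open>Subtracting \<open>\<chi> g\<close> times \<open>v\<close> from the image of
  \<open>v\<close> under \<open>\<chi>\<close> deletes the component of degree \<open>g\<close> and
  multiplies the one of degree \<open>h\<close> by the nonzero \<open>\<chi> h - \<chi> g\<close>.
  Repetition isolates degree \<open>h\<close>.\<close>

lemma character_invariant_imp_graded:
  assumes V: "subspace V" "V \<subseteq> L"
    and inv: "\<And>\<chi> v. is_character (carrier G) \<chi> \<Longrightarrow> v \<in> V \<Longrightarrow> deg.diag \<chi> v \<in> V"
    and sep: "\<And>g h. \<lbrakk>g \<in> carrier G; h \<in> carrier G; g \<noteq> h\<rbrakk> \<Longrightarrow>
      \<exists>\<chi>. is_character (carrier G) \<chi> \<and> (\<chi> g :: 'f) \<noteq> \<chi> h"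
    and v: "v \<in> V" and h: "h \<in> carrier G"
  shows "deg.component v h \<in> V"
  using v
proof (induction "card {g. deg.component v g \<noteq> 0}" arbitrary: v rule: less_induct)
  case less
  have vL: "v \<in> L" using less.prems V(2) by blast
  show ?case
  proof (cases "\<exists>g. g \<noteq> h \<and> deg.component v g \<noteq> 0")
    case False
    have "deg.component v h \<in> gr h" using deg.component_in[OF vL h] .
    then have "v = deg.component v h"
      by (intro deg.component_eqI[OF vL deg.component_mem[OF vL]])
        (use False deg.component_homogeneous[OF h] in auto)
    then show ?thesis using less.prems by simp
  next
    case True
    then obtain g where g: "g \<noteq> h" "deg.component v g \<noteq> 0" by blast
    then have gG: "g \<in> carrier G" using deg.component_outside[OF vL] by blast
    obtain \<chi> :: "'g \<Rightarrow> 'f" where \<chi>: "is_character (carrier G) \<chi>" "\<chi> g \<noteq> \<chi> h"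
      using sep[OF gG h g(1)] by blast
    define w where "w = deg.diag \<chi> v - scale (\<chi> g) v"
    have wV: "w \<in> V"
      unfolding w_def using inv[OF \<chi>(1)] less.prems V(1) subspace_diff subspace_scale by blast
    have comp: "deg.component w k = scale (\<chi> k - \<chi> g) (deg.component v k)" for k
      using endo_diff[OF deg.endo_component subspace_L deg.diag_mem[OF vL] L_scale[OF vL]]
      by (simp add: w_def deg.component_diag[OF vL] deg.component_scale[OF vL] scale_left_diff_distrib)
    have "{k. deg.component w k \<noteq> 0} \<subset> {k. deg.component v k \<noteq> 0}"
      using g(2) by (auto simp: comp)
    then have "card {k. deg.component w k \<noteq> 0} < card {k. deg.component v k \<noteq> 0}"
      by (rule psubset_card_mono[OF deg.finite_components[OF vL]])
    then have "deg.component w h \<in> V" using less.hyps wV by blast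
    then have "scale (1 / (\<chi> h - \<chi> g)) (deg.component w h) \<in> V" using V(1) subspace_scale by blast
    then show ?thesis using \<chi>(2) by (simp add: comp)
  qed
qed

end

section \<open>Direct sums of simple ideals\<close>

text \<open>The summands are assumed minimal among the ideals of \<open>L\<close>, which is what
  images of a minimal ideal provide; their simplicity is derived in
  \<open>lie_simple_summand\<close>.\<close>

locale simple_ideal_sum = lie_algebra scale br L + B: dsum scale L J B
  for scale :: "'f::field \<Rightarrow> 'v::ab_group_add \<Rightarrow> 'v"
    and br :: "'v \<Rightarrow> 'v \<Rightarrow> 'v" and L :: "'v set" and J :: "'j set" and B :: "'j \<Rightarrow> 'v set" +
  assumes ideal: "j \<in> J \<Longrightarrow> lie_ideal scale br L (B j)"
    and minimal: "\<lbrakk>j \<in> J; lie_ideal scale br L I; I \<subseteq> B j\<rbrakk> \<Longrightarrow> I = {0} \<or> I = B j"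
    and nonabelian: "j \<in> J \<Longrightarrow> lie_prod scale br (B j) (B j) \<noteq> {0}"
begin

text \<open>Brackets of \<open>I\<close> with a summand lie in the intersection of both. An ideal
  that misses every summand is thus central.\<close>

lemma br_disjoint_ideal:
  assumes I: "lie_ideal scale br L I" and x: "x \<in> I" and y: "y \<in> L"
    and disj: "\<And>j. j \<in> J \<Longrightarrow> I \<inter> B j = {0}"
  shows "br x y = 0"
  using y
proof (induction rule: B.homogeneous_induct)
  case zero
  then show ?case using br_zero(1) x lie_ideal_D(2)[OF I] by blast
next
  case (add y z)
  then show ?case using br_add_right[of x y z] x lie_ideal_D(2)[OF I] by auto
next
  case (homogeneous j y)
  then have "br x y \<in> I \<inter> B j"
    using lie_ideal_D[OF I] lie_ideal_D[OF ideal[OF homogeneous(1)]] x by blast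
  then show ?case using disj homogeneous(1) by blast
qed

lemma ideal_inter_cases:
  assumes "lie_ideal scale br L I" "j \<in> J"
  shows "I \<inter> B j = {0} \<or> B j \<subseteq> I"
  using minimal[OF assms(2) lie_ideal_inter[OF assms(1) ideal[OF assms(2)]]] by blast

text \<open>Different summands annihilate each other, so an ideal of \<open>B j\<close> is an ideal
  of \<open>L\<close>.\<close>

lemma lie_simple_summand:
  assumes j: "j \<in> J"
  shows "lie_simple scale br (B j)"
proof -
  have "I = {0} \<or> I = B j" if I: "lie_ideal scale br (B j) I" for I
  proof -
    have I': "subspace I" "I \<subseteq> B j" "\<And>x y. x \<in> B j \<Longrightarrow> y \<in> I \<Longrightarrow> br x y \<in> I"
      using I by (auto simp: lie_ideal_def)
    have IL: "I \<subseteq> L" using I'(2) lie_ideal_D(2)[OF ideal[OF j]] by blast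
    have "br x y \<in> I" if x: "x \<in> L" and y: "y \<in> I" for x y
      using x
    proof (induction rule: B.homogeneous_induct)
      case zero
      then show ?case using br_zero(2) y IL subspace_0[OF I'(1)] by auto
    next
      case (add x z)
      then show ?case using br_add_left[of x z y] y IL subspace_add[OF I'(1)] by auto
    next
      case (homogeneous k x)
      show ?case
      proof (cases "k = j")
        case True
        then show ?thesis using homogeneous I'(3) y by blast
      next
        case False
        have "y \<in> L" "x \<in> L" using y IL homogeneous(2) lie_ideal_D(2)[OF ideal[OF homogeneous(1)]] by auto
        then have "br x y \<in> B k" "br x y \<in> B j"
          using lie_ideal_D(4)[OF ideal[OF homogeneous(1)] homogeneous(2)]
            lie_ideal_D(3)[OF ideal[OF j]] y I'(2) by blast+
        then have "br x y = 0" by (rule B.summand_inter[OF homogeneous(1) j False])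
        then show ?thesis using subspace_0[OF I'(1)] by simp
      qed
    qed
    then have "lie_ideal scale br L I" using I'(1) IL by (simp add: lie_ideal_def)
    then show ?thesis using minimal[OF j] I'(2) by blast
  qed
  then show ?thesis using nonabelian[OF j] by (simp add: lie_simple_def)
qed

text \<open>A simple ideal is not central, so it meets some summand. Minimality of the summand puts
  it inside the ideal, and simplicity of the ideal makes them equal.\<close>

lemma simple_components_eq: "B ` J = {I. simple_component scale br L I}"
proof
  show "B ` J \<subseteq> {I. simple_component scale br L I}"
    using ideal lie_simple_summand by (auto simp: simple_component_def)
  show "{I. simple_component scale br L I} \<subseteq> B ` J"
  proof
    fix I assume "I \<in> {I. simple_component scale br L I}"
    then have I: "lie_ideal scale br L I" "lie_simple scale br I" by (auto simp: simple_component_def)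
    then obtain x y where xy: "x \<in> I" "y \<in> I" "br x y \<noteq> 0"
      by (auto simp: lie_simple_def lie_prod_eq_0_iff)
    then obtain j where j: "j \<in> J" "I \<inter> B j \<noteq> {0}"
      using br_disjoint_ideal[OF I(1)] lie_ideal_D(2)[OF I(1)] by blast
    then have sub: "B j \<subseteq> I" using ideal_inter_cases[OF I(1)] by blast
    note Bj = lie_ideal_D[OF ideal[OF j(1)]]
    have "lie_ideal scale br I (B j)"
      using Bj sub lie_ideal_D(2)[OF I(1)] by (auto simp: lie_ideal_def)
    then have "B j = {0} \<or> B j = I" using I(2) by (simp add: lie_simple_def)
    moreover have "B j \<noteq> {0}" using j(2) lie_ideal_D(1)[OF I(1)] subspace_0 by auto
    ultimately show "I \<in> B ` J" using j(1) by blast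
  qed
qed

lemma lie_prod_summand:
  assumes j: "j \<in> J"
  shows "lie_prod scale br (B j) (B j) = B j"
proof -
  have "lie_prod scale br (B j) (B j) \<subseteq> B j"
    unfolding lie_prod_def using lie_ideal_D[OF ideal[OF j]] by (intro span_minimal) auto
  then show ?thesis
    using minimal[OF j lie_ideal_prod[OF ideal[OF j] ideal[OF j]]] nonabelian[OF j] by blast
qed

text \<open>Each summand is perfect and therefore survives in the derived series of any ideal
  containing it. A solvable ideal thus meets every summand trivially and is central.\<close>

lemma semisimple:
  assumes center: "centralizer L = {0}"
  shows "lie_semisimple scale br L"
  unfolding lie_semisimple_def
proof (intro allI impI)
  fix I assume "lie_ideal scale br L I \<and> lie_solvable scale br I"
  then obtain n where I: "lie_ideal scale br L I" and n: "derived_series scale br I n = {0}"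
    by (auto simp: lie_solvable_def)
  have "I \<inter> B j = {0}" if j: "j \<in> J" for j
  proof (rule ccontr)
    assume "I \<inter> B j \<noteq> {0}"
    then have sub: "B j \<subseteq> I" using ideal_inter_cases[OF I j] by blast
    have "B j \<subseteq> derived_series scale br I k" for k
    proof (induction k)
      case 0
      then show ?case using sub by simp
    next
      case (Suc k)
      then have "lie_prod scale br (B j) (B j) \<subseteq> derived_series scale br I (Suc k)"
        unfolding lie_prod_def derived_series.simps by (intro span_mono) blast
      then show ?case using lie_prod_summand[OF j] by simp
    qed
    then have "B j \<subseteq> {0}" using n by metis
    then show False
      using \<open>I \<inter> B j \<noteq> {0}\<close> subspace_0 lie_ideal_D(1)[OF I] lie_ideal_D(1)[OF ideal[OF j]] by auto
  qed
  then have "I \<subseteq> centralizer L"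
    using br_disjoint_ideal[OF I] lie_ideal_D(2)[OF I] by (auto simp: centralizer_def)
  then show "I = {0}" using center subspace_0[OF lie_ideal_D(1)[OF I]] by blast
qed

end

section \<open>Structure of graded simple algebras\<close>

context fd_graded_lie_algebra
begin

text \<open>
  The images of a minimal ideal under the characters are minimal ideals. Their span is graded, hence
  all of \<open>L\<close>.
\<close>

lemma graded_simple_structure:
  assumes gs: "graded_simple scale br L G gr"
    and gen: "generate G (grading_supp G gr) = carrier G"
  shows "comm_group G" and "lie_semisimple scale br L"
    and "\<exists>(n::nat) B. is_direct_sum scale L {1..n} B \<and>
      B ` {1..n} = {I. simple_component scale br L I} \<and>
      (\<forall>i\<in>{1..n}. \<forall>j\<in>{1..n}. lie_isomorphic scale br (B i) (B j))"
proof -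
  show cg: "comm_group G"
    using comm_group_if_generated_by_commutative[OF graded_simple_commutative_supp[OF gs] gen] .
  interpret comm_group G by (rule cg)
  have LL: "lie_prod scale br L L \<noteq> {0}" using gs by (simp add: graded_simple_def)
  have L0: "L \<noteq> {0}" using LL br_zero L_zero by (auto simp: lie_prod_eq_0_iff)
  define X where "X = {\<chi> :: 'g \<Rightarrow> 'f. is_character (carrier G) \<chi>}"
  have sep: "\<exists>\<chi>. is_character (carrier G) \<chi> \<and> (\<chi> g :: 'f) \<noteq> \<chi> h"
    if "g \<in> carrier G" "h \<in> carrier G" "g \<noteq> h" for g h
    using characters_separate[OF finite_supp[OF fd] _ gen that] by (auto simp: grading_supp_def)
  have XD: "is_character (carrier G) \<chi>" if "\<chi> \<in> X" for \<chi> using that by (simp add: X_def)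
  have diagL: "deg.diag \<chi> v \<in> L" if "v \<in> L" for \<chi> v using deg.diag_mem that .

  define R where "R I \<longleftrightarrow> lie_ideal scale br L I \<and> I \<noteq> {0}" for I
  obtain I where "R I" and I_min: "\<And>J. R J \<Longrightarrow> dim I \<le> dim J"
    using ex_has_least_nat[of R L dim] lie_ideal_L L0 by (auto simp: R_def)
  then have I: "lie_ideal scale br L I" "I \<noteq> {0}" by (auto simp: R_def)
  note I' = lie_ideal_D[OF I(1)]
  have min: "J = {0} \<or> J = I" if J: "lie_ideal scale br L J" "J \<subseteq> I" for J
  proof (rule ccontr)
    assume *: "\<not> (J = {0} \<or> J = I)"
    then have "dim J < dim I"
      using dim_less_dim[OF finite_dim_subspace[OF fd I'(1,2)] lie_ideal_D(1)[OF J(1)] J(2)] by blast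
    then show False using I_min[of J] J * by (auto simp: R_def)
  qed
  \<comment> \<open>The inverse character carries an ideal inside the image back to an ideal inside
    \<open>I\<close>.\<close>
  have min_image: "J = {0} \<or> J = deg.diag \<chi> ` I"
    if \<chi>: "\<chi> \<in> X" and J: "lie_ideal scale br L J" "J \<subseteq> deg.diag \<chi> ` I" for \<chi> J
  proof -
    let ?inv = "deg.diag (\<lambda>g. inverse (\<chi> g))"
    have "?inv ` J \<subseteq> ?inv ` deg.diag \<chi> ` I" using J(2) by (rule image_mono)
    also have "\<dots> = I"
      using diag_character_inverse(1)[OF XD[OF \<chi>]] I'(2) by (force simp: image_image)
    finally have "?inv ` J = {0} \<or> ?inv ` J = I"
      using min lie_ideal_character_image[OF is_character_inverse[OF XD[OF \<chi>]] J(1)] by blast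
    moreover have "deg.diag \<chi> ` ?inv ` J = J"
      using diag_character_inverse(2)[OF XD[OF \<chi>]] lie_ideal_D(2)[OF J(1)]
      by (force simp: image_image)
    ultimately show ?thesis using endo_zero[OF deg.endo_diag subspace_L] by (metis image_empty image_insert)
  qed

  define S where "S = (\<Union>\<chi>\<in>X. deg.diag \<chi> ` I)"
  have SL: "S \<subseteq> L" using I'(2) diagL by (auto simp: S_def)
  have idS: "lie_ideal scale br L (span S)"
  proof (rule lie_ideal_span[OF SL])
    fix x y assume x: "x \<in> L" and "y \<in> S"
    then obtain \<chi> where \<chi>: "\<chi> \<in> X" "y \<in> deg.diag \<chi> ` I" by (auto simp: S_def)
    then have "br x y \<in> deg.diag \<chi> ` I"
      using lie_ideal_D(3)[OF lie_ideal_character_image[OF XD[OF \<chi>(1)] I(1)] x] by blast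
    then have "br x y \<in> S" unfolding S_def using \<chi>(1) by blast
    then show "br x y \<in> span S" by (rule span_base)
  qed
  have "deg.diag \<psi> v \<in> span S" if \<psi>: "is_character (carrier G) \<psi>" and v: "v \<in> span S" for \<psi> v
  proof -
    have "v \<in> L \<and> deg.diag \<psi> v \<in> span S"
      using v
    proof (induction rule: span_induct_alt)
      case base
      then show ?case using endo_zero[OF deg.endo_diag subspace_L] L_zero span_zero by simp
    next
      case (step c s v)
      then obtain \<chi> x where x: "\<chi> \<in> X" "x \<in> I" "s = deg.diag \<chi> x" by (auto simp: S_def)
      then have sL: "s \<in> L" using I'(2) diagL by blast
      \<comment> \<open>A product of characters is a character, so \<open>\<psi>\<close> maps images
        of \<open>I\<close> to images of \<open>I\<close>.\<close>
      have "deg.diag \<psi> s = deg.diag (\<lambda>g. \<psi> g * \<chi> g) x"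
        using x I'(2) by (auto simp: deg.diag_compose)
      then have "deg.diag \<psi> s \<in> S"
        using is_character_mult[OF \<psi> XD[OF x(1)]] x(2) by (auto simp: S_def X_def)
      then have "scale c (deg.diag \<psi> s) + deg.diag \<psi> v \<in> span S"
        using step by (intro span_add span_scale) (auto intro: span_base)
      then show ?case
        using step sL by (simp add: endo_add[OF deg.endo_diag] endo_scale[OF deg.endo_diag] L_scale L_add)
    qed
    then show ?thesis ..
  qed
  then have "graded_ideal scale br L G gr (span S)"
    unfolding graded_ideal_iff
    using idS character_invariant_imp_graded[OF _ _ _ sep] lie_ideal_D[OF idS] by blast
  moreover have "I \<subseteq> span S"
  proof
    fix x assume x: "x \<in> I"
    have "(\<lambda>_. 1) \<in> X" by (simp add: X_def is_character_def)
    moreover have "deg.diag (\<lambda>_. 1) x = x" using x I'(2) by (intro deg.diag_eq_id) auto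
    ultimately have "x \<in> S" unfolding S_def using x by (metis UN_I image_eqI)
    then show "x \<in> span S" by (rule span_base)
  qed
  ultimately have spS: "span S = L"
    using gs I(2) subspace_0[OF I'(1)] unfolding graded_simple_def by blast

  obtain n :: nat and B where ds: "is_direct_sum scale L {1..n} B"
    and B: "\<And>i. i \<in> {1..n} \<Longrightarrow> \<exists>\<chi>\<in>X. B i = deg.diag \<chi> ` I"
  proof (rule greedy_direct_sum[OF fd, where P = "lie_ideal scale br L"
        and Q = "\<lambda>A. \<exists>\<chi>\<in>X. A = deg.diag \<chi> ` I"])
    show "lie_ideal scale br L {0}" by (rule lie_ideal_0)
    show "subspace U \<and> U \<subseteq> L" if "lie_ideal scale br L U" for U using lie_ideal_D[OF that] by blast
  next
    fix U assume U: "lie_ideal scale br L U" and ne: "U \<noteq> L"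
    note U' = lie_ideal_D[OF U]
    \<comment> \<open>The images span \<open>L\<close>, so a proper ideal misses one of them; by
      minimality that image meets it trivially.\<close>
    have "\<not> S \<subseteq> U" using span_minimal[of S U] U'(1,2) spS ne by blast
    then obtain \<chi> where \<chi>: "\<chi> \<in> X" "\<not> deg.diag \<chi> ` I \<subseteq> U" by (auto simp: S_def)
    define A where "A = deg.diag \<chi> ` I"
    have A: "lie_ideal scale br L A"
      unfolding A_def by (rule lie_ideal_character_image[OF XD[OF \<chi>(1)] I(1)])
    have "A \<inter> U = {0}"
      using min_image[OF \<chi>(1) lie_ideal_inter[OF A U]] \<chi>(2) by (auto simp: A_def)
    moreover have "A \<noteq> {0}" using \<chi>(2)[folded A_def] subspace_0[OF U'(1)] by auto
    ultimately show "\<exists>A. (\<exists>\<chi>\<in>X. A = deg.diag \<chi> ` I) \<and> subspace A \<and> A \<noteq> {0} \<and> A \<inter> U = {0} \<and>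
        lie_ideal scale br L {u + a | u a. u \<in> U \<and> a \<in> A}"
      using \<chi>(1) lie_ideal_D(1)[OF A] lie_ideal_sum[OF U A] by (intro exI[of _ A]) (auto simp: A_def)
  qed (use that in blast)

  interpret B: dsum scale L "{1..n}" B by unfold_locales (rule ds)
  have idB: "lie_ideal scale br L (B i)" if "i \<in> {1..n}" for i
    using B[OF that] lie_ideal_character_image[OF XD I(1)] by auto
  \<comment> \<open>If one summand is abelian, then so are \<open>I\<close> and all its images.
    Different summands commute anyway, so every bracket in \<open>L\<close> would vanish.\<close>
  have nonab: "lie_prod scale br (B i) (B i) \<noteq> {0}" if i: "i \<in> {1..n}" for i
  proof
    assume ab: "lie_prod scale br (B i) (B i) = {0}"
    obtain \<chi> where \<chi>: "\<chi> \<in> X" "B i = deg.diag \<chi> ` I" using B[OF i] by blast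
    have abI: "br x y = 0" if xy: "x \<in> I" "y \<in> I" for x y
    proof -
      have "deg.diag \<chi> (br x y) = 0"
        using ab \<chi>(2) xy diag_character_br[OF XD[OF \<chi>(1)], of x y] I'(2)
        by (auto simp: lie_prod_eq_0_iff)
      then show ?thesis
        using diag_character_inverse(1)[OF XD[OF \<chi>(1)], of "br x y"] br_closed xy I'(2)
          endo_zero[OF deg.endo_diag subspace_L] by auto
    qed
    have br0: "br x y = 0" if jk: "j \<in> {1..n}" "k \<in> {1..n}" and xy: "x \<in> B j" "y \<in> B k" for j k x y
    proof (cases "j = k")
      case True
      obtain \<psi> where "\<psi> \<in> X" "B j = deg.diag \<psi> ` I" using B[OF jk(1)] by blast
      then obtain a b where ab: "a \<in> I" "b \<in> I" "x = deg.diag \<psi> a" "y = deg.diag \<psi> b" "\<psi> \<in> X"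
        using xy True by auto
      then have "br x y = deg.diag \<psi> (br a b)"
          using diag_character_br[OF XD, of \<psi> a b] I'(2) by (simp add: subset_iff)
      then show ?thesis using abI[OF ab(1,2)] endo_zero[OF deg.endo_diag subspace_L] by simp
    next
      case False
      have "x \<in> L" "y \<in> L" using xy jk B.summand_subset by blast+
      then have "br x y \<in> B j" "br x y \<in> B k"
        using lie_ideal_D(3,4)[OF idB] jk xy by blast+
      then show ?thesis using B.summand_inter[OF jk False] by simp
    qed
    have "br x y = 0" if j: "j \<in> {1..n}" "x \<in> B j" and y: "y \<in> L" for j x y
      using y
    proof (induction rule: B.homogeneous_induct)
      case zero
      then show ?case using br_zero(1) j B.summand_subset by blast
    next
      case (add y z)
      then show ?case using br_add_right[of x y z] j B.summand_subset by auto
    qed (use br0 j in blast)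
    note br0' = this
    have "br x y = 0" if x: "x \<in> L" and y: "y \<in> L" for x y
      using x
    proof (induction rule: B.homogeneous_induct)
      case zero
      then show ?case using br_zero(2) y by blast
    next
      case (add x z)
      then show ?case using br_add_left[of x z y] y by auto
    qed (use br0' y in blast)
    then show False using LL by (simp add: lie_prod_eq_0_iff)
  qed
  interpret B: simple_ideal_sum scale br L "{1..n}" B
    using idB nonab min_image B by unfold_locales metis+

  \<comment> \<open>The centre is the centralizer of the graded ideal \<open>L\<close>, hence
    graded. It is not all of \<open>L\<close>, which has nonzero brackets, so it is zero.\<close>
  have "graded_ideal scale br L G gr L"
    unfolding graded_ideal_iff using lie_ideal_L deg.component_mem by blast
  then have "graded_ideal scale br L G gr (centralizer L)" by (rule graded_ideal_centralizer)
  then have "centralizer L = {0} \<or> centralizer L = L" using gs by (simp add: graded_simple_def)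
  moreover have "centralizer L \<noteq> L"
    using LL by (force simp: centralizer_def lie_prod_eq_0_iff)
  ultimately show "lie_semisimple scale br L" using B.semisimple by blast

  have "lie_isomorphic scale br (B i) (B j)" if i: "i \<in> {1..n}" and j: "j \<in> {1..n}" for i j
  proof -
    obtain \<chi> \<psi> where \<chi>: "\<chi> \<in> X" "B i = deg.diag \<chi> ` I" and \<psi>: "\<psi> \<in> X" "B j = deg.diag \<psi> ` I"
      using B[OF i] B[OF j] by blast
    \<comment> \<open>The quotient of the two characters carries the image of \<open>I\<close> under
      \<open>\<chi>\<close> to its image under \<open>\<psi>\<close>.\<close>
    define \<theta> where "\<theta> = (\<lambda>g. \<psi> g * inverse (\<chi> g))"
    have \<theta>: "is_character (carrier G) \<theta>"
      unfolding \<theta>_def by (intro is_character_mult is_character_inverse XD \<chi>(1) \<psi>(1))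
    have BL: "B i \<subseteq> L" using lie_ideal_D(2)[OF idB[OF i]] .
    have "deg.diag \<theta> (deg.diag \<chi> x) = deg.diag \<psi> x" if "x \<in> I" for x
    proof -
      have "x \<in> L" using that I'(2) by blast
      then show ?thesis
        using deg.diag_compose[OF diagL, of x \<psi> "\<lambda>g. inverse (\<chi> g)" \<chi>]
          diag_character_inverse(1)[OF XD[OF \<chi>(1)]] by (simp add: \<theta>_def)
    qed
    then have "deg.diag \<theta> ` B i = B j" by (simp add: \<chi>(2) \<psi>(2) image_image)
    moreover have "inj_on (deg.diag \<theta>) (B i)"
      using diag_character_inverse(1)[OF \<theta>] BL
      by (intro inj_on_inverseI[of _ "deg.diag (\<lambda>g. inverse (\<theta> g))"]) blast
    ultimately have "bij_betw (deg.diag \<theta>) (B i) (B j)" by (simp add: bij_betw_def)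
    moreover have "deg.diag \<theta> (x + y) = deg.diag \<theta> x + deg.diag \<theta> y"
      "deg.diag \<theta> (br x y) = br (deg.diag \<theta> x) (deg.diag \<theta> y)" if "x \<in> B i" "y \<in> B i" for x y
      using endo_add[OF deg.endo_diag] diag_character_br[OF \<theta>] that BL by blast+
    moreover have "deg.diag \<theta> (scale c x) = scale c (deg.diag \<theta> x)" if "x \<in> B i" for c x
      using endo_scale[OF deg.endo_diag] that BL by blast
    ultimately show ?thesis unfolding lie_isomorphic_def by (intro exI[of _ "deg.diag \<theta>"]) blast
  qed
  then show "\<exists>(n::nat) B. is_direct_sum scale L {1..n} B \<and>
      B ` {1..n} = {I. simple_component scale br L I} \<and>
      (\<forall>i\<in>{1..n}. \<forall>j\<in>{1..n}. lie_isomorphic scale br (B i) (B j))"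
    using ds B.simple_components_eq by blast
qed

end

theorem proposition3p1:
  fixes G :: "('g, 'm) monoid_scheme"
    and scale :: "'f::{alg_closed_field, field_char_0} \<Rightarrow> 'v::ab_group_add \<Rightarrow> 'v"
    and br :: "'v \<Rightarrow> 'v \<Rightarrow> 'v"
    and L :: "'v set"
    and gr :: "'g \<Rightarrow> 'v set"
  assumes "graded_lie_algebra scale br L G gr"
    and "finite_dim scale L"
  shows
    "(graded_simple scale br L G gr \<and> generate G (grading_supp G gr) = carrier G \<longrightarrow>
        comm_group G \<and>
        lie_semisimple scale br L \<and>
        (\<exists>(n::nat) B.
           is_direct_sum scale L {1..n} B \<and>
           B ` {1..n} = {I. simple_component scale br L I} \<and>
           (\<forall>i\<in>{1..n}. \<forall>j\<in>{1..n}. lie_isomorphic scale br (B i) (B j))))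
     \<and>
     (lie_semisimple scale br L \<longrightarrow>
        (\<exists>(m::nat) A.
           is_direct_sum scale L {1..m} A \<and>
           (\<forall>i\<in>{1..m}. graded_simple_component scale br L G gr (A i) \<and>
              commutative_subset G (grading_supp G (restrict_grading gr (A i))))))"
proof -
  interpret graded_lie_algebra scale br L G gr by fact
  interpret fd_graded_lie_algebra scale br L G gr by unfold_locales fact
  show ?thesis
  proof (intro conjI impI)
    assume *: "graded_simple scale br L G gr \<and> generate G (grading_supp G gr) = carrier G"
    show "comm_group G" "lie_semisimple scale br L"
      "\<exists>(n::nat) B. is_direct_sum scale L {1..n} B \<and>
         B ` {1..n} = {I. simple_component scale br L I} \<and>
         (\<forall>i\<in>{1..n}. \<forall>j\<in>{1..n}. lie_isomorphic scale br (B i) (B j))"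
      using graded_simple_structure * by blast+
  next
    assume "lie_semisimple scale br L"
    then obtain m :: nat and A where "is_direct_sum scale L {1..m} A"
      "\<And>i. i \<in> {1..m} \<Longrightarrow> graded_simple_component scale br L G gr (A i)"
      using semisimple_graded_decomposition by blast
    then show "\<exists>(m::nat) A. is_direct_sum scale L {1..m} A \<and>
        (\<forall>i\<in>{1..m}. graded_simple_component scale br L G gr (A i) \<and>
          commutative_subset G (grading_supp G (restrict_grading gr (A i))))"
      using graded_simple_component_commutative_supp by blast
  qed
qed

end
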